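(* Let $V\to M$ be a representation of a Lie groupoid $G\rightrightarrows M$. (i) Given any linear connection $\nabla$ on $V$, its $G$-invariance form $\Theta$ is multiplicative: $\Theta\in\Omega^1_m(G;\operatorname{End}V)$. (ii) The set $\mathcal A_{\mathrm{inv}}(G;V)$ of $G$-invariant linear connections on $V$ is an affine space over the invariant endomorphism-valued 1-forms $\Omega^1_{\mathrm{inv}}(M;\operatorname{End}V)$. (iii) The cohomology class of the $G$-invariance form $\Theta$ of a connection $\nabla$ on $V$ is independent of the choice of $\nabla$; denote it by $\mathrm{obs}_{\mathcal A_{\mathrm{inv}}(G;V)}=[\Theta]\in H^{1,1}(G;\operatorname{End}V)$. (iv) A $G$-invariant connection on $V$ exists if and only if $\mathrm{obs}_{\mathcal A_{\mathrm{inv}}(G;V)}=0$.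
   Context: $G\rightrightarrows M$ has source $s$, target $t$, multiplication $m$. A representation on $V\to M$ is a smooth action by linear maps $V_{s(g)}\to V_{t(g)}$, $v\mapsto g\cdot v$; it induces the representation $g\cdot T=g\circ T\circ g^{-1}$ on $\operatorname{End}V$. Let $\phi\colon t^*V\to s^*V$, $(g,v)\mapsto(g,g^{-1}\cdot v)$, and let $\nabla^s,\nabla^t$ be the pullback connections. The $G$-invariance form of $\nabla$ is $$\Theta\in\Omega^1(G;s^*\operatorname{End}V),\qquad\Theta(X)\xi=\phi\big(\nabla^t_X(\phi^{-1}\xi)\big)-\nabla^s_X\xi,\quad\xi\in\Gamma(s^*V),$$ and $\nabla$ is $G$-invariant if $\Theta=0$. For a representation $W$ of $G$ (here $W=\operatorname{End}V$) and $\gamma\in\Omega^q(M;W)$, set $(\delta^0\gamma)_g=(s^*\gamma)_g-g^{-1}\cdot(t^*\gamma)_g\in\Omega^q(G;s^*W)$; invariant forms are $\Omega^q_{\mathrm{inv}}(M;W)=\ker\delta^0$. A form $\omega\in\Omega^q(G;s^*W)$ is multiplicative, $\omega\in\Omega^q_m(G;W)$, if $\omega_{gh}(dm(X_i,Y_i))_i=\omega_h(Y_i)_i+h^{-1}\cdot\omega_g(X_i)_i$ for all composable $(X_i,Y_i)\in T_{(g,h)}G^{(2)}$. $H^{1,q}(G;W)=\Omega^q_m(G;W)/\operatorname{im}\delta^0$. Affine spaces are allowed to be empty. *)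

theory Defs
  imports "HOL-Analysis.Analysis" "HOL-Library.Function_Algebras"
begin

section \<open>Linear algebra preliminaries\<close>

instantiation "fun" :: (type, scaleR) scaleR
begin
definition scaleR_fun :: "real \<Rightarrow> ('a \<Rightarrow> 'b) \<Rightarrow> 'a \<Rightarrow> 'b"
  where "scaleR_fun r f = (\<lambda>x. r *\<^sub>R f x)"
instance ..
end

lemma scaleR_fun_apply [simp]: "(r *\<^sub>R f) x = r *\<^sub>R f x"
  by (simp add: scaleR_fun_def)

instance "fun" :: (type, real_vector) real_vector
  by standard (auto simp: fun_eq_iff algebra_simps)

text \<open>Model spaces are arbitrary finite-dimensional normed spaces. Unlike \<^class>\<open>euclidean_space\<close>,
  this class does not exclude dimension zero, which is needed for zero-dimensional manifolds (a Lie
  group is a groupoid over a point) and for bundles of rank zero.\<close>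

class fin_dim_normed = real_normed_vector +
  assumes ex_finite_generating: "\<exists>B. finite B \<and> (\<forall>x. \<exists>a. x = (\<Sum>b\<in>B. a b *\<^sub>R b))"

lemma ex_finite_span: "\<exists>B::'a::fin_dim_normed set. finite B \<and> span B = UNIV"
proof -
  obtain B :: "'a set" where "finite B" and *: "\<And>x. \<exists>a. x = (\<Sum>b\<in>B. a b *\<^sub>R b)"
    using ex_finite_generating by metis
  have "x \<in> span B" for x
    using *[of x] by (metis (no_types, lifting) span_sum span_scale span_base)
  then show ?thesis using \<open>finite B\<close> by blast
qed

subclass (in euclidean_space) fin_dim_normed
proof
  show "\<exists>B. finite B \<and> (\<forall>x. \<exists>a. x = (\<Sum>b\<in>B. a b *\<^sub>R b))"
    by (intro exI[of _ Basis] conjI allI exI[of _ "\<lambda>b. inner _ b"])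
       (simp_all add: euclidean_representation)
qed

instance blinfun :: (fin_dim_normed, fin_dim_normed) fin_dim_normed
proof
  obtain B :: "'a set" where B: "finite B" "span B = UNIV" using ex_finite_span by blast
  obtain C :: "'b set" where C: "finite C" "span C = UNIV" using ex_finite_span by blast
  define \<delta> :: "'a \<Rightarrow> 'b \<Rightarrow> 'a \<Rightarrow> 'b" where "\<delta> = (\<lambda>b y x. if x = b then y else 0)"
  define R :: "('a \<Rightarrow>\<^sub>L 'b) \<Rightarrow> 'a \<Rightarrow> 'b" where "R = (\<lambda>T x. if x \<in> B then T x else 0)"
  define D where "D = (\<lambda>(b, c). \<delta> b c) ` (B \<times> C)"
  have lin_R: "linear R"
    by (rule linearI) (auto simp: R_def fun_eq_iff blinfun.add_left blinfun.scaleR_left)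
  have inj_R: "inj R"
  proof (rule injI)
    fix S T assume "R S = R T"
    then have "blinfun_apply S b = blinfun_apply T b" if "b \<in> B" for b
      using that by (metis R_def)
    then have "blinfun_apply S x = blinfun_apply T x" for x
      using linear_eq_on[OF blinfun.bounded_linear_right[THEN bounded_linear.linear] blinfun.bounded_linear_right[THEN bounded_linear.linear], of x B S T] B by auto
    then show "S = T" by (rule blinfun_eqI)
  qed
  have lin_\<delta>: "linear (\<delta> b)" for b
    by (rule linearI) (auto simp: \<delta>_def fun_eq_iff)
  have \<delta>_span: "\<delta> b y \<in> span D" if "b \<in> B" for b y
  proof -
    have "\<delta> b y \<in> \<delta> b ` span C" using C by simp
    also have "\<dots> = span (\<delta> b ` C)" by (simp add: linear_span_image[OF lin_\<delta>])
    also have "\<dots> \<subseteq> span D" using that by (intro span_mono) (auto simp: D_def)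
    finally show ?thesis .
  qed
  have R_span: "R T \<in> span D" for T
  proof -
    have "(\<Sum>b\<in>B. \<delta> b (T b)) x = (\<Sum>b\<in>B. \<delta> b (T b) x)" for x
      using B(1) by (induction rule: finite_induct) auto
    then have "R T = (\<Sum>b\<in>B. \<delta> b (T b))"
      using B(1) by (auto simp: R_def \<delta>_def fun_eq_iff)
    then show ?thesis by (simp add: span_sum \<delta>_span)
  qed
  obtain K :: "('a \<Rightarrow>\<^sub>L 'b) set" where K: "independent K" "span K = UNIV"
    using basis_exists[of UNIV] by (metis top.extremum_uniqueI)
  have "independent (R ` K)"
    using linear_independent_injective_image[OF lin_R K(1)] inj_R inj_on_subset by blast
  moreover have "R ` K \<subseteq> span D" using R_span by blast
  moreover have "finite D" using B C by (simp add: D_def)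
  ultimately have "finite (R ` K)" using independent_span_bound by blast
  then have "finite K" using inj_R finite_imageD inj_on_subset by blast
  moreover have "\<exists>a. T = (\<Sum>b\<in>K. a b *\<^sub>R b)" for T
    using K(2) span_finite[OF \<open>finite K\<close>] by auto
  ultimately show "\<exists>B::('a \<Rightarrow>\<^sub>L 'b) set. finite B \<and> (\<forall>T. \<exists>a. T = (\<Sum>b\<in>B. a b *\<^sub>R b))" by blast
qed

definition linear_between ::
    "'a::real_vector set \<Rightarrow> 'b::real_vector set \<Rightarrow> ('a \<Rightarrow> 'b) \<Rightarrow> bool"
  where "linear_between S T f \<longleftrightarrow>
    f ` S \<subseteq> T \<and> (\<forall>u\<in>S. \<forall>v\<in>S. f (u + v) = f u + f v) \<and> (\<forall>r. \<forall>v\<in>S. f (r *\<^sub>R v) = r *\<^sub>R f v)"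

text \<open>A torsor \<open>P\<close>, possibly empty, under the vector space \<open>W\<close>.\<close>

definition affine_space_over ::
    "'p set \<Rightarrow> 'w::real_vector set \<Rightarrow> ('p \<Rightarrow> 'w \<Rightarrow> 'p) \<Rightarrow> bool"
  where "affine_space_over P W act \<longleftrightarrow>
    subspace W \<and>
    (\<forall>a\<in>P. \<forall>w\<in>W. act a w \<in> P) \<and>
    (\<forall>a\<in>P. act a 0 = a) \<and>
    (\<forall>a\<in>P. \<forall>v\<in>W. \<forall>w\<in>W. act (act a v) w = act a (v + w)) \<and>
    (\<forall>a\<in>P. \<forall>b\<in>P. \<exists>!w. w \<in> W \<and> act a w = b)"

section \<open>Smooth manifolds\<close>

text \<open>In finite dimension, \<open>f\<close> is of class \<open>C\<^sup>k\<^sup>+\<^sup>1\<close> on an open set iff it is differentiable there and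
  all its directional derivatives are of class \<open>C\<^sup>k\<close>.\<close>

primrec Ck_on :: "nat \<Rightarrow> 'a::real_normed_vector set \<Rightarrow> ('a \<Rightarrow> 'b::real_normed_vector) \<Rightarrow> bool"
  where
    "Ck_on 0 S f \<longleftrightarrow> continuous_on S f"
  | "Ck_on (Suc k) S f \<longleftrightarrow> (\<forall>x\<in>S. f differentiable (at x)) \<and>
      (\<forall>v. Ck_on k S (\<lambda>x. frechet_derivative f (at x) v))"

definition smooth_on :: "'a::real_normed_vector set \<Rightarrow> ('a \<Rightarrow> 'b::real_normed_vector) \<Rightarrow> bool"
  where "smooth_on S f \<longleftrightarrow> (\<forall>k. Ck_on k S f)"

text \<open>A chart is a pair of its domain and its coordinate map. A manifold is a whole type with a
  Hausdorff, second countable topology (imposed by type classes) together with a smooth atlas, not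
  necessarily maximal.\<close>

type_synonym ('a, 'e) chart = "'a set \<times> ('a \<Rightarrow> 'e)"

definition smooth_atlas ::
    "('a::{t2_space, second_countable_topology}, 'e::fin_dim_normed) chart set \<Rightarrow> bool"
  where "smooth_atlas A \<longleftrightarrow>
    (\<forall>(U, c)\<in>A. open U \<and> open (c ` U) \<and> homeomorphism U (c ` U) c (inv_into U c)) \<and>
    (\<Union>(U, c)\<in>A. U) = UNIV \<and>
    (\<forall>(U, c)\<in>A. \<forall>(W, d)\<in>A. smooth_on (c ` (U \<inter> W)) (d \<circ> inv_into U c))"

definition smooth_fun_on ::
    "('a, 'e::real_normed_vector) chart set \<Rightarrow> 'a set \<Rightarrow> ('a \<Rightarrow> 'b::real_normed_vector) \<Rightarrow> bool"
  where "smooth_fun_on A S f \<longleftrightarrow> (\<forall>(U, c)\<in>A. smooth_on (c ` (U \<inter> S)) (f \<circ> inv_into U c))"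

definition smooth_map ::
    "('a::topological_space, 'e::real_normed_vector) chart set \<Rightarrow>
     ('b::topological_space, 'f::real_normed_vector) chart set \<Rightarrow> ('a \<Rightarrow> 'b) \<Rightarrow> bool"
  where "smooth_map A B f \<longleftrightarrow> continuous_on UNIV f \<and>
    (\<forall>(U, c)\<in>A. \<forall>(W, d)\<in>B. smooth_on (c ` (U \<inter> f -` W)) (d \<circ> f \<circ> inv_into U c))"

text \<open>A tangent vector at \<open>p\<close> is the family of its coordinate vectors in all charts around \<open>p\<close>,
  related by the derivatives of the transition maps, and extended by 0 to all other pairs.\<close>

type_synonym ('a, 'e) tangent = "('a, 'e) chart \<Rightarrow> 'e"

definition tangent_space ::
    "('a, 'e::real_normed_vector) chart set \<Rightarrow> 'a \<Rightarrow> ('a, 'e) tangent set"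
  where "tangent_space A p = {X.
    (\<forall>(U, c)\<in>A. \<forall>(W, d)\<in>A. p \<in> U \<and> p \<in> W \<longrightarrow>
      X (W, d) = frechet_derivative (d \<circ> inv_into U c) (at (c p)) (X (U, c))) \<and>
    (\<forall>U c. \<not> ((U, c) \<in> A \<and> p \<in> U) \<longrightarrow> X (U, c) = 0)}"

definition chart_at :: "('a, 'e) chart set \<Rightarrow> 'a \<Rightarrow> ('a, 'e) chart"
  where "chart_at A p = (SOME (U, c). (U, c) \<in> A \<and> p \<in> U)"

definition coord_vector ::
    "('a, 'e::real_normed_vector) chart set \<Rightarrow> ('a, 'e) chart \<Rightarrow> 'e \<Rightarrow> 'a \<Rightarrow> ('a, 'e) tangent"
  where "coord_vector A = (\<lambda>(U, c) e p (W, d).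
    if (W, d) \<in> A \<and> p \<in> W then frechet_derivative (d \<circ> inv_into U c) (at (c p)) e else 0)"

definition differential ::
    "('a, 'e::real_normed_vector) chart set \<Rightarrow> ('b, 'f::real_normed_vector) chart set \<Rightarrow>
     ('a \<Rightarrow> 'b) \<Rightarrow> 'a \<Rightarrow> ('a, 'e) tangent \<Rightarrow> ('b, 'f) tangent"
  where "differential A B f p X = (\<lambda>(W, d).
    if (W, d) \<in> B \<and> f p \<in> W
    then let (U, c) = chart_at A p
         in frechet_derivative (d \<circ> f \<circ> inv_into U c) (at (c p)) (X (U, c))
    else 0)"

definition differential_fun ::
    "('a, 'e::real_normed_vector) chart set \<Rightarrow> ('a \<Rightarrow> real) \<Rightarrow> 'a \<Rightarrow> ('a, 'e) tangent \<Rightarrow> real"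
  where "differential_fun A f p X =
    (let (U, c) = chart_at A p
     in frechet_derivative (f \<circ> inv_into U c) (at (c p)) (X (U, c)))"

definition submersion ::
    "('a::topological_space, 'e::real_normed_vector) chart set \<Rightarrow>
     ('b::topological_space, 'f::real_normed_vector) chart set \<Rightarrow> ('a \<Rightarrow> 'b) \<Rightarrow> bool"
  where "submersion A B f \<longleftrightarrow> smooth_map A B f \<and>
    (\<forall>p. differential A B f p ` tangent_space A p = tangent_space B (f p))"

section \<open>Vector bundles, sections and forms\<close>

text \<open>The fibres of a vector bundle are linear subspaces of one real vector space \<open>'v\<close>. Nothing
  relates the fibres inside \<open>'v\<close>, which carries no topology, so this is no restriction: every family
  of vector spaces embeds in its direct sum. Topology and smooth structure are given by the local
  trivializations, pairs \<open>(U, \<psi>)\<close> with linear isomorphisms \<open>\<psi> x\<close> from the fibre at \<open>x \<in> U\<close> onto the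
  model fibre \<open>'f\<close>.\<close>

record ('a, 'v, 'f) vbundle =
  fibre :: "'a \<Rightarrow> 'v set"
  trivs :: "('a set \<times> ('a \<Rightarrow> 'v \<Rightarrow> 'f)) set"

definition vector_bundle ::
    "('a::topological_space, 'e::real_normed_vector) chart set \<Rightarrow>
     ('a, 'v::real_vector, 'f::fin_dim_normed) vbundle \<Rightarrow> bool"
  where "vector_bundle A V \<longleftrightarrow>
    (\<forall>x. subspace (fibre V x)) \<and>
    (\<forall>(U, \<psi>)\<in>trivs V. open U \<and>
      (\<forall>x\<in>U. linear_between (fibre V x) UNIV (\<psi> x) \<and> bij_betw (\<psi> x) (fibre V x) UNIV)) \<and>
    (\<Union>(U, \<psi>)\<in>trivs V. U) = UNIV \<and>
    (\<forall>(U, \<psi>)\<in>trivs V. \<forall>(W, \<theta>)\<in>trivs V. \<forall>e.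
      smooth_fun_on A (U \<inter> W) (\<lambda>x. \<theta> x (inv_into (fibre V x) (\<psi> x) e)))"

text \<open>Smooth vector bundle maps over the identity.\<close>

definition bundle_map ::
    "('a, 'e::real_normed_vector) chart set \<Rightarrow> ('a, 'v::real_vector, 'f::real_normed_vector) vbundle \<Rightarrow>
     ('a, 'w::real_vector, 'h::real_normed_vector) vbundle \<Rightarrow> ('a \<Rightarrow> 'v \<Rightarrow> 'w) \<Rightarrow> bool"
  where "bundle_map A V W F \<longleftrightarrow>
    (\<forall>x. linear_between (fibre V x) (fibre W x) (F x)) \<and>
    (\<forall>(U, \<psi>)\<in>trivs V. \<forall>(O', \<theta>)\<in>trivs W. \<forall>e.
      smooth_fun_on A (U \<inter> O') (\<lambda>x. \<theta> x (F x (inv_into (fibre V x) (\<psi> x) e))))"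

definition pullback :: "('a \<Rightarrow> 'b) \<Rightarrow> ('b, 'v, 'f) vbundle \<Rightarrow> ('a, 'v, 'f) vbundle"
  where "pullback f V =
    \<lparr>fibre = (\<lambda>x. fibre V (f x)), trivs = (\<lambda>(U, \<psi>). (f -` U, \<lambda>x. \<psi> (f x))) ` trivs V\<rparr>"

text \<open>An endomorphism of a fibre is represented by a function on \<open>'v\<close> vanishing off that fibre.\<close>

definition End_bundle ::
    "('a, 'v::real_vector, 'f::real_normed_vector) vbundle \<Rightarrow> ('a, 'v \<Rightarrow> 'v, 'f \<Rightarrow>\<^sub>L 'f) vbundle"
  where "End_bundle V =
    \<lparr>fibre = (\<lambda>x. {T. linear_between (fibre V x) (fibre V x) T \<and> (\<forall>v. v \<notin> fibre V x \<longrightarrow> T v = 0)}),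
     trivs = (\<lambda>(U, \<psi>). (U, \<lambda>x T. Blinfun (\<lambda>e. \<psi> x (T (inv_into (fibre V x) (\<psi> x) e))))) ` trivs V\<rparr>"

definition sections ::
    "('a, 'e::real_normed_vector) chart set \<Rightarrow> ('a, 'v, 'f::real_normed_vector) vbundle \<Rightarrow>
     ('a \<Rightarrow> 'v) set"
  where "sections A V = {\<xi>. (\<forall>x. \<xi> x \<in> fibre V x) \<and>
    (\<forall>(U, \<psi>)\<in>trivs V. smooth_fun_on A U (\<lambda>x. \<psi> x (\<xi> x)))}"

text \<open>Vector bundle valued 1-forms, extended by 0 off the tangent spaces.\<close>

definition one_forms ::
    "('a, 'e::real_normed_vector) chart set \<Rightarrow> ('a, 'v::real_vector, 'f::real_normed_vector) vbundle \<Rightarrow>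
     ('a \<Rightarrow> ('a, 'e) tangent \<Rightarrow> 'v) set"
  where "one_forms A V = {\<omega>.
    (\<forall>x. linear_between (tangent_space A x) (fibre V x) (\<omega> x)) \<and>
    (\<forall>x X. X \<notin> tangent_space A x \<longrightarrow> \<omega> x X = 0) \<and>
    (\<forall>(U, c)\<in>A. \<forall>(W, \<psi>)\<in>trivs V. \<forall>e.
      smooth_fun_on A (U \<inter> W) (\<lambda>x. \<psi> x (\<omega> x (coord_vector A (U, c) e x))))}"

section \<open>Linear connections\<close>

text \<open>\<open>nabla \<xi> x X\<close> is the covariant derivative of \<open>\<xi>\<close> in the direction \<open>X\<close> at \<open>x\<close>. Operators are
  extended by 0 to functions that are not smooth sections, so that equality of connections is
  equality of functions.\<close>

type_synonym ('a, 'e, 'v) operator = "('a \<Rightarrow> 'v) \<Rightarrow> 'a \<Rightarrow> ('a, 'e) tangent \<Rightarrow> 'v"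

definition connections ::
    "('a, 'e::real_normed_vector) chart set \<Rightarrow> ('a, 'v::real_vector, 'f::real_normed_vector) vbundle \<Rightarrow>
     ('a, 'e, 'v) operator set"
  where "connections A V = {nabla.
    (\<forall>\<xi>\<in>sections A V. nabla \<xi> \<in> one_forms A V) \<and>
    (\<forall>\<xi>. \<xi> \<notin> sections A V \<longrightarrow> nabla \<xi> = 0) \<and>
    linear_between (sections A V) (one_forms A V) nabla \<and>
    (\<forall>f. \<forall>\<xi>\<in>sections A V. smooth_fun_on A UNIV f \<longrightarrow>
      (\<forall>x. \<forall>X\<in>tangent_space A x.
        nabla (\<lambda>y. f y *\<^sub>R \<xi> y) x X = differential_fun A f x X *\<^sub>R \<xi> x + f x *\<^sub>R nabla \<xi> x X))}"

definition pullback_connection ::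
    "('a, 'e::real_normed_vector) chart set \<Rightarrow> ('b, 'k::real_normed_vector) chart set \<Rightarrow> ('a \<Rightarrow> 'b) \<Rightarrow>
     ('b, 'v::real_vector, 'f::real_normed_vector) vbundle \<Rightarrow>
     ('b, 'k, 'v) operator \<Rightarrow> ('a, 'e, 'v) operator"
  where "pullback_connection A B f V nabla = (THE D.
    D \<in> connections A (pullback f V) \<and>
    (\<forall>\<xi>\<in>sections B V. \<forall>x. \<forall>X\<in>tangent_space A x.
      D (\<xi> \<circ> f) x X = nabla \<xi> (f x) (differential A B f x X)))"

definition translate ::
    "('a, 'e::real_normed_vector) chart set \<Rightarrow> ('a, 'v::real_vector, 'f::real_normed_vector) vbundle \<Rightarrow>
     ('a, 'e, 'v) operator \<Rightarrow> ('a \<Rightarrow> ('a, 'e) tangent \<Rightarrow> 'v \<Rightarrow> 'v) \<Rightarrow> ('a, 'e, 'v) operator"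
  where "translate A V nabla \<gamma> =
    (\<lambda>\<xi>. if \<xi> \<in> sections A V then (\<lambda>x X. nabla \<xi> x X + \<gamma> x X (\<xi> x)) else 0)"

section \<open>Lie groupoids and representations\<close>

text \<open>\<open>mult G g h\<close> is meaningful only for composable arrows, \<open>src G g = tgt G h\<close>.\<close>

record ('m, 'e, 'g, 'k) groupoid =
  objs :: "('m, 'e) chart set"
  arrs :: "('g, 'k) chart set"
  src :: "'g \<Rightarrow> 'm"
  tgt :: "'g \<Rightarrow> 'm"
  mult :: "'g \<Rightarrow> 'g \<Rightarrow> 'g"
  idt :: "'m \<Rightarrow> 'g"
  ginv :: "'g \<Rightarrow> 'g"

definition groupoid_laws :: "('m, 'e, 'g, 'k) groupoid \<Rightarrow> bool"
  where "groupoid_laws G \<longleftrightarrow>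
    (\<forall>x. src G (idt G x) = x \<and> tgt G (idt G x) = x) \<and>
    (\<forall>g h. src G g = tgt G h \<longrightarrow>
      src G (mult G g h) = src G h \<and> tgt G (mult G g h) = tgt G g) \<and>
    (\<forall>g h k. src G g = tgt G h \<and> src G h = tgt G k \<longrightarrow>
      mult G (mult G g h) k = mult G g (mult G h k)) \<and>
    (\<forall>g. mult G g (idt G (src G g)) = g \<and> mult G (idt G (tgt G g)) g = g) \<and>
    (\<forall>g. src G (ginv G g) = tgt G g \<and> tgt G (ginv G g) = src G g \<and>
      mult G (ginv G g) g = idt G (src G g) \<and> mult G g (ginv G g) = idt G (tgt G g))"

text \<open>The submanifold of composable pairs of arrows and the multiplication in product charts.\<close>

definition composable_coords ::
    "('m, 'e, 'g, 'k) groupoid \<Rightarrow> ('g, 'k) chart \<Rightarrow> ('g, 'k) chart \<Rightarrow> ('k \<times> 'k) set"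
  where "composable_coords G = (\<lambda>(U, c) (W, d). {(c g, d h) | g h. g \<in> U \<and> h \<in> W \<and> src G g = tgt G h})"

definition mult_coords ::
    "('m, 'e, 'g, 'k) groupoid \<Rightarrow> ('g, 'k) chart \<Rightarrow> ('g, 'k) chart \<Rightarrow> ('g, 'k) chart \<Rightarrow>
     'k \<times> 'k \<Rightarrow> 'k"
  where "mult_coords G = (\<lambda>(U, c) (W, d) (U', c') (y, z).
    c' (mult G (inv_into U c y) (inv_into W d z)))"

text \<open>Smoothness of the multiplication on the embedded submanifold of composable pairs: near every
  composable pair, its expression in charts extends to a smooth map on an open set.\<close>

definition smooth_mult :: "('m, 'e, 'g, 'k::real_normed_vector) groupoid \<Rightarrow> bool"
  where "smooth_mult G \<longleftrightarrow>
    (\<forall>(U, c)\<in>arrs G. \<forall>(W, d)\<in>arrs G. \<forall>(U', c')\<in>arrs G. \<forall>g\<in>U. \<forall>h\<in>W.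
      src G g = tgt G h \<and> mult G g h \<in> U' \<longrightarrow>
      (\<exists>N F. open N \<and> (c g, d h) \<in> N \<and> smooth_on N F \<and>
        (\<forall>(y, z)\<in>N \<inter> composable_coords G (U, c) (W, d).
          mult G (inv_into U c y) (inv_into W d z) \<in> U' \<and>
          F (y, z) = mult_coords G (U, c) (W, d) (U', c') (y, z))))"

definition lie_groupoid ::
    "('m::{t2_space, second_countable_topology}, 'e::fin_dim_normed,
      'g::{t2_space, second_countable_topology}, 'k::fin_dim_normed) groupoid \<Rightarrow> bool"
  where "lie_groupoid G \<longleftrightarrow>
    smooth_atlas (objs G) \<and> smooth_atlas (arrs G) \<and> groupoid_laws G \<and>
    submersion (arrs G) (objs G) (src G) \<and> submersion (arrs G) (objs G) (tgt G) \<and>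
    smooth_map (objs G) (arrs G) (idt G) \<and> smooth_map (arrs G) (arrs G) (ginv G) \<and>
    smooth_mult G"

text \<open>Tangent space of the submanifold of composable pairs at \<open>(g, h)\<close>.\<close>

definition composable_tangents ::
    "('m, 'e::real_normed_vector, 'g, 'k::real_normed_vector) groupoid \<Rightarrow> 'g \<Rightarrow> 'g \<Rightarrow>
     (('g, 'k) tangent \<times> ('g, 'k) tangent) set"
  where "composable_tangents G g h =
    {(X, Y). X \<in> tangent_space (arrs G) g \<and> Y \<in> tangent_space (arrs G) h \<and>
      differential (arrs G) (objs G) (src G) g X = differential (arrs G) (objs G) (tgt G) h Y}"

text \<open>The differential of the multiplication. The derivative within the set of composable pairs is
  not unique as a linear map on \<open>'k \<times> 'k\<close>, but its values on \<^const>\<open>composable_tangents\<close> are.\<close>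

definition dmult ::
    "('m, 'e, 'g, 'k::real_normed_vector) groupoid \<Rightarrow> 'g \<Rightarrow> 'g \<Rightarrow>
     ('g, 'k) tangent \<Rightarrow> ('g, 'k) tangent \<Rightarrow> ('g, 'k) tangent"
  where "dmult G g h X Y = (\<lambda>(U', c').
    if (U', c') \<in> arrs G \<and> mult G g h \<in> U'
    then let (U, c) = chart_at (arrs G) g; (W, d) = chart_at (arrs G) h
         in frechet_derivative (mult_coords G (U, c) (W, d) (U', c'))
              (at (c g, d h) within composable_coords G (U, c) (W, d)) (X (U, c), Y (W, d))
    else 0)"

definition groupoid_rep ::
    "('m, 'e, 'g, 'k::real_normed_vector) groupoid \<Rightarrow>
     ('m, 'v::real_vector, 'f::real_normed_vector) vbundle \<Rightarrow> ('g \<Rightarrow> 'v \<Rightarrow> 'v) \<Rightarrow> bool"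
  where "groupoid_rep G V \<rho> \<longleftrightarrow>
    bundle_map (arrs G) (pullback (src G) V) (pullback (tgt G) V) \<rho> \<and>
    (\<forall>x. \<forall>v\<in>fibre V x. \<rho> (idt G x) v = v) \<and>
    (\<forall>g h. src G g = tgt G h \<longrightarrow> (\<forall>v\<in>fibre V (src G h). \<rho> (mult G g h) v = \<rho> g (\<rho> h v)))"

definition End_action ::
    "('m, 'e, 'g, 'k) groupoid \<Rightarrow> ('m, 'v::real_vector, 'f) vbundle \<Rightarrow> ('g \<Rightarrow> 'v \<Rightarrow> 'v) \<Rightarrow>
     'g \<Rightarrow> ('v \<Rightarrow> 'v) \<Rightarrow> 'v \<Rightarrow> 'v"
  where "End_action G V \<rho> g T =
    (\<lambda>v. if v \<in> fibre V (tgt G g) then \<rho> g (T (\<rho> (ginv G g) v)) else 0)"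

section \<open>Multiplicative forms and cohomology in bidegree (1, 1)\<close>

definition delta0 ::
    "('m, 'e::real_normed_vector, 'g, 'k::real_normed_vector) groupoid \<Rightarrow>
     ('g \<Rightarrow> 'w::real_vector \<Rightarrow> 'w) \<Rightarrow>
     ('m \<Rightarrow> ('m, 'e) tangent \<Rightarrow> 'w) \<Rightarrow> 'g \<Rightarrow> ('g, 'k) tangent \<Rightarrow> 'w"
  where "delta0 G \<rho> \<gamma> = (\<lambda>g X.
    if X \<in> tangent_space (arrs G) g
    then \<gamma> (src G g) (differential (arrs G) (objs G) (src G) g X)
         - \<rho> (ginv G g) (\<gamma> (tgt G g) (differential (arrs G) (objs G) (tgt G) g X))
    else 0)"

definition invariant_forms ::
    "('m, 'e::real_normed_vector, 'g, 'k::real_normed_vector) groupoid \<Rightarrow>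
     ('m, 'w::real_vector, 'f::real_normed_vector) vbundle \<Rightarrow> ('g \<Rightarrow> 'w \<Rightarrow> 'w) \<Rightarrow>
     ('m \<Rightarrow> ('m, 'e) tangent \<Rightarrow> 'w) set"
  where "invariant_forms G W \<rho> = {\<gamma> \<in> one_forms (objs G) W. delta0 G \<rho> \<gamma> = 0}"

definition multiplicative_forms ::
    "('m, 'e::real_normed_vector, 'g, 'k::real_normed_vector) groupoid \<Rightarrow>
     ('m, 'w::real_vector, 'f::real_normed_vector) vbundle \<Rightarrow> ('g \<Rightarrow> 'w \<Rightarrow> 'w) \<Rightarrow>
     ('g \<Rightarrow> ('g, 'k) tangent \<Rightarrow> 'w) set"
  where "multiplicative_forms G W \<rho> = {\<omega> \<in> one_forms (arrs G) (pullback (src G) W).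
    \<forall>g h. src G g = tgt G h \<longrightarrow> (\<forall>(X, Y)\<in>composable_tangents G g h.
      \<omega> (mult G g h) (dmult G g h X Y) = \<omega> h Y + \<rho> (ginv G h) (\<omega> g X))}"

definition cohomologous ::
    "('m, 'e::real_normed_vector, 'g, 'k::real_normed_vector) groupoid \<Rightarrow>
     ('m, 'w::real_vector, 'f::real_normed_vector) vbundle \<Rightarrow> ('g \<Rightarrow> 'w \<Rightarrow> 'w) \<Rightarrow>
     (('g \<Rightarrow> ('g, 'k) tangent \<Rightarrow> 'w) \<times> ('g \<Rightarrow> ('g, 'k) tangent \<Rightarrow> 'w)) set"
  where "cohomologous G W \<rho> = {(\<omega>, \<omega>').
    \<omega> \<in> multiplicative_forms G W \<rho> \<and> \<omega>' \<in> multiplicative_forms G W \<rho> \<and>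
    \<omega> - \<omega>' \<in> delta0 G \<rho> ` one_forms (objs G) W}"

definition H11 ::
    "('m, 'e::real_normed_vector, 'g, 'k::real_normed_vector) groupoid \<Rightarrow>
     ('m, 'w::real_vector, 'f::real_normed_vector) vbundle \<Rightarrow> ('g \<Rightarrow> 'w \<Rightarrow> 'w) \<Rightarrow>
     ('g \<Rightarrow> ('g, 'k) tangent \<Rightarrow> 'w) set set"
  where "H11 G W \<rho> = multiplicative_forms G W \<rho> // cohomologous G W \<rho>"

definition coh_class ::
    "('m, 'e::real_normed_vector, 'g, 'k::real_normed_vector) groupoid \<Rightarrow>
     ('m, 'w::real_vector, 'f::real_normed_vector) vbundle \<Rightarrow> ('g \<Rightarrow> 'w \<Rightarrow> 'w) \<Rightarrow>
     ('g \<Rightarrow> ('g, 'k) tangent \<Rightarrow> 'w) \<Rightarrow> ('g \<Rightarrow> ('g, 'k) tangent \<Rightarrow> 'w) set"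
  where "coh_class G W \<rho> \<omega> = cohomologous G W \<rho> `` {\<omega>}"

section \<open>Invariant connections\<close>

text \<open>The bundle map \<open>t\<^sup>*V \<rightarrow> s\<^sup>*V\<close>, its inverse being applied to sections of \<open>s\<^sup>*V\<close>.\<close>

definition phi :: "('m, 'e, 'g, 'k) groupoid \<Rightarrow> ('g \<Rightarrow> 'v \<Rightarrow> 'v) \<Rightarrow> 'g \<Rightarrow> 'v \<Rightarrow> 'v"
  where "phi G \<rho> g v = \<rho> (ginv G g) v"

definition phi_inv ::
    "('m, 'e, 'g, 'k) groupoid \<Rightarrow> ('m, 'v, 'f) vbundle \<Rightarrow> ('g \<Rightarrow> 'v \<Rightarrow> 'v) \<Rightarrow>
     ('g \<Rightarrow> 'v) \<Rightarrow> 'g \<Rightarrow> 'v"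
  where "phi_inv G V \<rho> \<xi> = (\<lambda>g. inv_into (fibre V (tgt G g)) (phi G \<rho> g) (\<xi> g))"

definition invariance_form ::
    "('m, 'e::real_normed_vector, 'g, 'k::real_normed_vector) groupoid \<Rightarrow>
     ('m, 'v::real_vector, 'f::real_normed_vector) vbundle \<Rightarrow> ('g \<Rightarrow> 'v \<Rightarrow> 'v) \<Rightarrow>
     ('m, 'e, 'v) operator \<Rightarrow> 'g \<Rightarrow> ('g, 'k) tangent \<Rightarrow> 'v \<Rightarrow> 'v"
  where "invariance_form G V \<rho> nabla =
    (let nabla_s = pullback_connection (arrs G) (objs G) (src G) V nabla;
         nabla_t = pullback_connection (arrs G) (objs G) (tgt G) V nabla
     in THE \<Theta>. \<Theta> \<in> one_forms (arrs G) (pullback (src G) (End_bundle V)) \<and>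
          (\<forall>\<xi>\<in>sections (arrs G) (pullback (src G) V). \<forall>g. \<forall>X\<in>tangent_space (arrs G) g.
            \<Theta> g X (\<xi> g) = phi G \<rho> g (nabla_t (phi_inv G V \<rho> \<xi>) g X) - nabla_s \<xi> g X))"

definition invariant_connections ::
    "('m, 'e::real_normed_vector, 'g, 'k::real_normed_vector) groupoid \<Rightarrow>
     ('m, 'v::real_vector, 'f::real_normed_vector) vbundle \<Rightarrow> ('g \<Rightarrow> 'v \<Rightarrow> 'v) \<Rightarrow>
     ('m, 'e, 'v) operator set"
  where "invariant_connections G V \<rho> =
    {nabla \<in> connections (objs G) V. invariance_form G V \<rho> nabla = 0}"

definition obs ::
    "('m, 'e::real_normed_vector, 'g, 'k::real_normed_vector) groupoid \<Rightarrow>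
     ('m, 'v::real_vector, 'f::real_normed_vector) vbundle \<Rightarrow> ('g \<Rightarrow> 'v \<Rightarrow> 'v) \<Rightarrow>
     ('g \<Rightarrow> ('g, 'k) tangent \<Rightarrow> 'v \<Rightarrow> 'v) set"
  where "obs G V \<rho> = (THE C. \<exists>nabla\<in>connections (objs G) V.
    C = coh_class G (End_bundle V) (End_action G V \<rho>) (invariance_form G V \<rho> nabla))"

end

theory Submission
  imports Defs
begin

text \<open>
  Everything rests on two facts about linear connections on a vector bundle \<open>E\<close>. A connection is local,
  so in a trivialization it is the ordinary derivative plus Christoffel symbols (\<open>conn_formula\<close>). The
  derivative terms of two connections are equal, so connections differ by a unique one-form with values
  in \<open>End E\<close> (\<open>conn_diff_form\<close>), and adding such a form to a connection gives a connection
  (\<open>translate_connection\<close>).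

  Applied to the two connections \<open>\<phi> \<circ> \<nabla>\<^sup>t \<circ> \<phi>\<inverse>\<close> and \<open>\<nabla>\<^sup>s\<close> on \<open>s\<^sup>*V\<close> this yields existence and uniqueness of
  the invariance form \<open>\<Theta>\<close>. Replacing \<open>\<nabla>\<close> by \<open>\<nabla> + \<gamma>\<close> changes \<open>\<Theta>\<close> into \<open>\<Theta> - \<delta>\<^sup>0\<gamma>\<close> (\<open>Theta_translate\<close>). As any
  two connections differ by such a \<open>\<gamma>\<close>, the class of \<open>\<Theta>\<close> is independent of \<open>\<nabla>\<close>. The invariant connections
  form a torsor under \<open>ker \<delta>\<^sup>0\<close>, and if \<open>\<Theta> = \<delta>\<^sup>0\<gamma>\<close> then \<open>\<nabla> + \<gamma>\<close> is invariant.

  Multiplicativity of \<open>\<Theta>\<close> is a local computation. If \<open>P(g)\<close> is the matrix of the action of \<open>g\<close> in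
  trivializations around its source and target, and \<open>A\<close> denotes Christoffel symbols, then
  \<open>\<Theta>(X) = P\<inverse> (dP(X) + A(dt X) P) - A(ds X)\<close> (\<open>Theta_formula\<close>). Differentiating \<open>P(gh) = P(g) P(h)\<close> gives
  the claim, as the middle terms cancel. The differentiation has to take place inside the
  set of composable pairs, where the derivative of the multiplication is only determined on tangent
  vectors. It is carried out along curves: every composable pair of tangent vectors is the
  velocity of a curve of composable pairs, because curves lift through the submersion \<open>s\<close> with prescribed
  velocity (\<open>submersion_lift\<close>, by the contraction principle), and along such curves the multiplication
  obeys the chain rule (\<open>velocity_mult\<close>).

  The definite descriptions of the pullback connections and of the obstruction class require
  existence of connections. Both kinds of connection are obtained by one gluing construction with a
  partition of unity (\<open>glue_connection\<close>), which in turn needs bump functions and the compactness of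
  closed bounded sets in finite-dimensional normed spaces.
\<close>

section \<open>Finite-dimensional normed spaces\<close>

lemma ex_finite_basis:
  "\<exists>B::'a::fin_dim_normed set. finite B \<and> independent B \<and> span B = UNIV"
proof -
  obtain S :: "'a set" where S: "finite S" "span S = UNIV" using ex_finite_span by blast
  obtain B where B: "B \<subseteq> S" "independent B" "S \<subseteq> span B"
    using maximal_independent_subset[of S] by metis
  have "span B = UNIV"
    using B(3) S(2) by (metis span_mono span_span top.extremum_uniqueI)
  with B S show ?thesis by (meson finite_subset)
qed

text \<open>An arbitrary but fixed basis. All spaces in play are finite-dimensional without a given dimension, so
  linear objects are expanded in this basis throughout.\<close>

definition fbasis :: "'a::fin_dim_normed set"
  where "fbasis = (SOME B. finite B \<and> independent B \<and> span B = UNIV)"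

lemma fbasis: "finite (fbasis::'a::fin_dim_normed set)" "independent (fbasis::'a set)"
    "span (fbasis::'a set) = UNIV"
  using someI_ex[OF ex_finite_basis[where 'a='a]] unfolding fbasis_def by auto

definition fcoord :: "'a::fin_dim_normed \<Rightarrow> 'a \<Rightarrow> real"
  where "fcoord b x = representation fbasis x b"

lemma linear_fcoord: "linear (fcoord b)"
  by (rule linearI)
     (simp_all add: fcoord_def fbasis real_vector.representation_add real_vector.representation_scale)

lemma fcoord_sum: "(\<Sum>b\<in>fbasis. fcoord b x *\<^sub>R b) = x"
  unfolding fcoord_def by (rule real_vector.sum_representation_eq) (auto simp: fbasis)

text \<open>Bolzano--Weierstrass in the coordinates with indices in \<open>B\<close>, adding one coordinate at a time.\<close>

lemma bounded_functions_convergent_subsequence: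
  fixes u :: "nat \<Rightarrow> 'b \<Rightarrow> real"
  assumes "finite B" and "\<And>n b. b \<in> B \<Longrightarrow> \<bar>u n b\<bar> \<le> K"
  shows "\<exists>r l. strict_mono (r::nat \<Rightarrow> nat) \<and> (\<forall>b\<in>B. (\<lambda>n. u (r n) b) \<longlonglongrightarrow> l b)"
  using assms
proof (induction B rule: finite_induct)
  case empty
  show ?case by (intro exI[of _ id]) (auto simp: strict_mono_def)
next
  case (insert a B)
  then obtain r l where r: "strict_mono (r::nat \<Rightarrow> nat)" "\<forall>b\<in>B. (\<lambda>n. u (r n) b) \<longlonglongrightarrow> l b"
    by auto
  have "bounded (range (\<lambda>n. u (r n) a))"
    using insert.prems by (auto simp: bounded_iff)
  then obtain m s where s: "strict_mono (s::nat \<Rightarrow> nat)" "((\<lambda>n. u (r n) a) \<circ> s) \<longlonglongrightarrow> m"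
    using bounded_imp_convergent_subsequence by blast
  have "(\<lambda>n. u ((r \<circ> s) n) b) \<longlonglongrightarrow> (l(a := m)) b" if "b \<in> insert a B" for b
  proof (cases "b = a")
    case True
    with s show ?thesis by (simp add: o_def)
  next
    case False
    with that have "(\<lambda>n. u (r n) b) \<longlonglongrightarrow> l b" using r by auto
    from LIMSEQ_subseq_LIMSEQ[OF this s(1)] False show ?thesis by (simp add: o_def)
  qed
  moreover have "strict_mono (r \<circ> s)" using r(1) s(1) by (rule strict_mono_o)
  ultimately show ?case by blast
qed

text \<open>Every norm dominates the sum norm of the coordinates: otherwise some sequence would have
  coordinate norm 1 and tend to 0, but by compactness in coordinates it subconverges to a nonzero
  combination of the basis.\<close>

lemma fcoord_norm_bound:
  "\<exists>C>0. \<forall>x::'a::fin_dim_normed. (\<Sum>b\<in>fbasis. \<bar>fcoord b x\<bar>) \<le> C * norm x"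
proof (rule ccontr)
  let ?N = "\<lambda>x::'a. \<Sum>b\<in>fbasis. \<bar>fcoord b x\<bar>"
  assume "\<not> ?thesis"
  then have "\<exists>x::'a. ?N x > real (Suc n) * norm x" for n
    by (meson not_le of_nat_0_less_iff zero_less_Suc)
  then obtain x :: "nat \<Rightarrow> 'a" where x: "\<And>n. ?N (x n) > real (Suc n) * norm (x n)" by metis
  have pos: "?N (x n) > 0" for n
    by (rule le_less_trans[OF _ x[of n]]) simp
  define y where "y n = (1 / ?N (x n)) *\<^sub>R x n" for n
  have coord_y: "fcoord b (y n) = fcoord b (x n) / ?N (x n)" for b n
    unfolding y_def by (simp add: linear_scale[OF linear_fcoord])
  have N_y: "?N (y n) = 1" for n
    using pos[of n] by (simp add: coord_y flip: sum_divide_distrib)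
  have norm_y: "norm (y n) \<le> 1 / real (Suc n)" for n
    using x[of n] pos[of n] by (simp add: y_def field_simps)
  have "\<bar>fcoord b (y n)\<bar> \<le> 1" if "b \<in> fbasis" for b n
    using member_le_sum[of b fbasis "\<lambda>b. \<bar>fcoord b (y n)\<bar>"] that N_y[of n] fbasis(1) by simp
  from bounded_functions_convergent_subsequence[OF fbasis(1), of "\<lambda>n b. fcoord b (y n)", OF this]
  obtain r l where r: "strict_mono (r::nat \<Rightarrow> nat)"
    and l: "\<And>b. b \<in> fbasis \<Longrightarrow> (\<lambda>n. fcoord b (y (r n))) \<longlonglongrightarrow> l b" by blast
  have "(\<lambda>n. \<Sum>b\<in>fbasis. fcoord b (y (r n)) *\<^sub>R b) \<longlonglongrightarrow> (\<Sum>b\<in>fbasis. l b *\<^sub>R b)"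
    by (intro tendsto_intros l)
  then have lim: "(\<lambda>n. y (r n)) \<longlonglongrightarrow> (\<Sum>b\<in>fbasis. l b *\<^sub>R b)" by (simp add: fcoord_sum)
  have "y \<longlonglongrightarrow> 0"
    by (rule Lim_null_comparison[OF _ LIMSEQ_Suc[OF lim_1_over_n]])
       (rule always_eventually, use norm_y in auto)
  from LIMSEQ_unique[OF LIMSEQ_subseq_LIMSEQ[OF this r, unfolded o_def] lim]
  have "(\<Sum>b\<in>fbasis. l b *\<^sub>R b) = 0" by simp
  then have l0: "l b = 0" if "b \<in> fbasis" for b
    using that fbasis(1,2) independentD by blast
  have "(\<lambda>n. ?N (y (r n))) \<longlonglongrightarrow> (\<Sum>b\<in>fbasis. \<bar>l b\<bar>)"
    by (intro tendsto_intros l)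
  then have "(\<lambda>n. 1) \<longlonglongrightarrow> (0::real)" by (simp add: N_y l0)
  from LIMSEQ_unique[OF this tendsto_const] show False by simp
qed

lemma bounded_linear_fcoord [bounded_linear]: "bounded_linear (fcoord b)"
proof (cases "b \<in> fbasis")
  case True
  obtain C where C: "\<forall>x::'a. (\<Sum>b\<in>fbasis. \<bar>fcoord b x\<bar>) \<le> C * norm x"
    using fcoord_norm_bound by blast
  show ?thesis
  proof (rule bounded_linear_intro[where K = C])
    show "norm (fcoord b x) \<le> norm x * C" for x
    proof -
      have "\<bar>fcoord b x\<bar> \<le> (\<Sum>b\<in>fbasis. \<bar>fcoord b x\<bar>)"
        using True fbasis(1) by (intro member_le_sum) auto
      also have "\<dots> \<le> C * norm x" using C by blast
      finally show ?thesis by (simp add: mult.commute)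
    qed
  qed (simp_all add: linear_add[OF linear_fcoord] linear_scale[OF linear_fcoord])
next
  case False
  then have "fcoord b = (\<lambda>_. 0)"
    using real_vector.representation_ne_zero unfolding fcoord_def by blast
  then show ?thesis by simp
qed

lemma linear_expand:
  fixes f :: "'a::fin_dim_normed \<Rightarrow> 'b::real_vector"
  assumes "linear f"
  shows "f x = (\<Sum>b\<in>fbasis. fcoord b x *\<^sub>R f b)"
  using assms by (metis (mono_tags, lifting) fcoord_sum linear_scale linear_sum sum.cong)

lemma fin_dim_bounded_linear:
  fixes f :: "'a::fin_dim_normed \<Rightarrow> 'b::real_normed_vector"
  assumes "linear f"
  shows "bounded_linear f"
proof -
  have "bounded_linear (\<lambda>x. \<Sum>b\<in>fbasis. fcoord b x *\<^sub>R f b)"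
    by (intro bounded_linear_sum bounded_linear_scaleR_const[OF bounded_linear_fcoord])
  moreover have "f = (\<lambda>x. \<Sum>b\<in>fbasis. fcoord b x *\<^sub>R f b)"
    using linear_expand[OF assms] by (rule ext)
  ultimately show ?thesis by metis
qed

text \<open>Bounded sequences have bounded coordinates by \<open>fcoord_norm_bound\<close>, so they subconverge.\<close>

lemma fin_dim_compact:
  fixes S :: "'a::fin_dim_normed set"
  assumes "bounded S" "closed S"
  shows "compact S"
  unfolding compact_eq_seq_compact_metric
proof (rule seq_compactI)
  fix f :: "nat \<Rightarrow> 'a"
  assume f: "\<forall>n. f n \<in> S"
  then obtain K where K: "\<And>n. norm (f n) \<le> K" using assms(1) by (auto simp: bounded_iff)
  obtain C where C: "C > 0" "\<forall>x::'a. (\<Sum>b\<in>fbasis. \<bar>fcoord b x\<bar>) \<le> C * norm x"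
    using fcoord_norm_bound by blast
  have "\<bar>fcoord b (f n)\<bar> \<le> C * K" if "b \<in> fbasis" for b n
  proof -
    have "\<bar>fcoord b (f n)\<bar> \<le> (\<Sum>b\<in>fbasis. \<bar>fcoord b (f n)\<bar>)"
      using that fbasis(1) by (intro member_le_sum) auto
    also have "\<dots> \<le> C * norm (f n)" using C(2) by blast
    also have "\<dots> \<le> C * K" using K C(1) by simp
    finally show ?thesis .
  qed
  from bounded_functions_convergent_subsequence[OF fbasis(1), of "\<lambda>n b. fcoord b (f n)", OF this]
  obtain r l where r: "strict_mono (r::nat \<Rightarrow> nat)"
    and l: "\<And>b. b \<in> fbasis \<Longrightarrow> (\<lambda>n. fcoord b (f (r n))) \<longlonglongrightarrow> l b" by blast
  have "(\<lambda>n. \<Sum>b\<in>fbasis. fcoord b (f (r n)) *\<^sub>R b) \<longlonglongrightarrow> (\<Sum>b\<in>fbasis. l b *\<^sub>R b)"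
    by (intro tendsto_intros l)
  then have lim: "(f \<circ> r) \<longlonglongrightarrow> (\<Sum>b\<in>fbasis. l b *\<^sub>R b)" by (simp add: fcoord_sum o_def)
  moreover have "(\<Sum>b\<in>fbasis. l b *\<^sub>R b) \<in> S"
    using closed_sequentially[OF assms(2) _ lim] f by simp
  ultimately show "\<exists>l\<in>S. \<exists>r. strict_mono (r::nat \<Rightarrow> nat) \<and> (f \<circ> r) \<longlonglongrightarrow> l" using r by blast
qed

section \<open>Smooth germs on normed spaces\<close>

text \<open>Smoothness at a point is smoothness on some neighbourhood of it. All of the calculus below is
  done with these germs; \<^const>\<open>smooth_on\<close> on an open set is recovered by \<open>smooth_on_iff\<close>.\<close>

definition smooth_at :: "'a::real_normed_vector \<Rightarrow> ('a \<Rightarrow> 'b::real_normed_vector) \<Rightarrow> bool"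
  where "smooth_at x f \<longleftrightarrow> (\<exists>S. open S \<and> x \<in> S \<and> smooth_on S f)"

lemma frechet_derivative_eq: "(f has_derivative D) (at x) \<Longrightarrow> frechet_derivative f (at x) = D"
  using frechet_derivative_at by metis

lemma has_derivative_transform_eventually_nhds:
  assumes "(f has_derivative D) (at x)" "\<forall>\<^sub>F y in nhds x. f y = g y"
  shows "(g has_derivative D) (at x)"
proof -
  obtain S where "open S" "x \<in> S" "\<And>y. y \<in> S \<Longrightarrow> f y = g y"
    using assms(2) by (auto simp: eventually_nhds)
  then show ?thesis by (rule has_derivative_transform_within_open[OF assms(1)])
qed

lemma Ck_on_subset: "Ck_on k S f \<Longrightarrow> T \<subseteq> S \<Longrightarrow> Ck_on k T f"
  by (induction k arbitrary: f) (auto intro: continuous_on_subset)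

lemma Ck_on_cong:
  assumes "open S" "\<And>x. x \<in> S \<Longrightarrow> f x = g x"
  shows "Ck_on k S f \<longleftrightarrow> Ck_on k S g"
  using assms(2)
proof (induction k arbitrary: f g)
  case 0
  then show ?case by (auto cong: continuous_on_cong)
next
  case (Suc k)
  have *: "(f has_derivative D) (at x) \<longleftrightarrow> (g has_derivative D) (at x)" if "x \<in> S" for x D
    using has_derivative_transform_within_open[OF _ assms(1) that]
    by (metis Suc.prems)
  have "frechet_derivative f (at x) = frechet_derivative g (at x)" if "x \<in> S" for x
    using that by (simp add: frechet_derivative_def *)
  then have "Ck_on k S (\<lambda>x. frechet_derivative f (at x) v) \<longleftrightarrow> Ck_on k S (\<lambda>x. frechet_derivative g (at x) v)" for v
    by (intro Suc.IH) auto
  then show ?case by (auto simp: differentiable_def *)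
qed

lemma Ck_on_local:
  assumes "\<And>x. x \<in> S \<Longrightarrow> \<exists>T. open T \<and> x \<in> T \<and> Ck_on k T f"
  shows "Ck_on k S f"
  using assms
proof (induction k arbitrary: f)
  case 0
  show ?case
  proof (simp, rule continuous_at_imp_continuous_on, rule ballI)
    fix x assume "x \<in> S"
    then obtain T where T: "open T" "x \<in> T" "Ck_on 0 T f" using 0 by blast
    then show "isCont f x"
      by (simp add: continuous_on_eq_continuous_at)
  qed
next
  case (Suc k)
  have "Ck_on k S (\<lambda>x. frechet_derivative f (at x) v)" for v
    using Suc.prems by (intro Suc.IH) (metis Ck_on.simps(2))
  moreover have "f differentiable at x" if "x \<in> S" for x
    using Suc.prems[OF that] by (auto)
  ultimately show ?case by simp
qed

lemma smooth_on_iff: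
  assumes "open S"
  shows "smooth_on S f \<longleftrightarrow> (\<forall>x\<in>S. smooth_at x f)"
proof
  assume "smooth_on S f"
  with assms show "\<forall>x\<in>S. smooth_at x f" by (auto simp: smooth_at_def)
next
  assume *: "\<forall>x\<in>S. smooth_at x f"
  show "smooth_on S f"
    unfolding smooth_on_def
  proof
    fix k
    show "Ck_on k S f" using * by (intro Ck_on_local) (auto simp: smooth_at_def smooth_on_def)
  qed
qed

lemma smooth_at_cong:
  assumes "\<forall>\<^sub>F y in nhds x. f y = g y" "smooth_at x f"
  shows "smooth_at x g"
proof -
  obtain S where S: "open S" "x \<in> S" "smooth_on S f" using assms(2) by (auto simp: smooth_at_def)
  obtain T where T: "open T" "x \<in> T" "\<And>y. y \<in> T \<Longrightarrow> f y = g y"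
    using assms(1) by (auto simp: eventually_nhds)
  have "smooth_on (S \<inter> T) f" using S by (auto simp: smooth_on_def intro: Ck_on_subset)
  then have "smooth_on (S \<inter> T) g"
    unfolding smooth_on_def using Ck_on_cong[of "S \<inter> T" f g] S T by auto
  then show ?thesis unfolding smooth_at_def using S T by (meson IntI open_Int)
qed

lemma Ck_on_Suc: "Ck_on (Suc k) S f \<Longrightarrow> Ck_on k S f"
proof (induction k arbitrary: f)
  case 0
  then show ?case
    by (auto intro!: continuous_at_imp_continuous_on differentiable_imp_continuous_within)
next
  case (Suc k)
  then show ?case by (metis Ck_on.simps(2))
qed

lemma smooth_at_differentiable: "smooth_at x f \<Longrightarrow> f differentiable at x"
  by (metis smooth_at_def smooth_on_def Ck_on.simps(2))

lemma smooth_at_has_derivative: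
  "smooth_at x f \<Longrightarrow> (f has_derivative frechet_derivative f (at x)) (at x)"
  using smooth_at_differentiable frechet_derivative_works by blast

lemma smooth_at_isCont: "smooth_at x f \<Longrightarrow> isCont f x"
  using smooth_at_differentiable differentiable_imp_continuous_within by blast

lemma smooth_at_frechet_derivative:
  "smooth_at x f \<Longrightarrow> smooth_at x (\<lambda>y. frechet_derivative f (at y) v)"
  unfolding smooth_at_def smooth_on_def by (metis Ck_on.simps(2))

lemma eventually_smooth_at: "smooth_at x f \<Longrightarrow> \<forall>\<^sub>F y in nhds x. smooth_at y f"
  unfolding smooth_at_def eventually_nhds by blast

lemma Ck_on_const: "Ck_on k S (\<lambda>_. c)"
  by (induction k arbitrary: c) auto

lemma Ck_on_bounded_linear_compose:
  assumes "bounded_linear L" and "open S" and "Ck_on k S f"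
  shows "Ck_on k S (\<lambda>x. L (f x))"
  using assms(3)
proof (induction k arbitrary: f)
  case 0
  then show ?case
    by (simp add: bounded_linear.continuous_on[OF assms(1)])
next
  case (Suc k)
  have D: "((\<lambda>x. L (f x)) has_derivative (\<lambda>v. L (frechet_derivative f (at x) v))) (at x)"
    if "x \<in> S" for x
    using Suc.prems that
    by (intro bounded_linear.has_derivative[OF assms(1)]) (simp add: frechet_derivative_works[symmetric])
  have "Ck_on k S (\<lambda>x. L (frechet_derivative f (at x) v))" for v
    using Suc by simp
  then have "Ck_on k S (\<lambda>x. frechet_derivative (\<lambda>x. L (f x)) (at x) v)" for v
    by (subst Ck_on_cong[OF assms(2)]) (auto simp: frechet_derivative_eq[OF D])
  then show ?case using D by (auto simp: differentiable_def)
qed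

lemma Ck_on_add:
  assumes "open S" "Ck_on k S f" "Ck_on k S g"
  shows "Ck_on k S (\<lambda>x. f x + g x)"
  using assms(2,3)
proof (induction k arbitrary: f g)
  case 0
  then show ?case by (simp add: continuous_on_add)
next
  case (Suc k)
  have D: "((\<lambda>x. f x + g x) has_derivative
      (\<lambda>v. frechet_derivative f (at x) v + frechet_derivative g (at x) v)) (at x)"
    if "x \<in> S" for x
    using Suc.prems that by (intro has_derivative_add) (simp_all add: frechet_derivative_works[symmetric])
  have "Ck_on k S (\<lambda>x. frechet_derivative f (at x) v + frechet_derivative g (at x) v)" for v
    using Suc by simp
  then have "Ck_on k S (\<lambda>x. frechet_derivative (\<lambda>x. f x + g x) (at x) v)" for v
    by (subst Ck_on_cong[OF assms(1)]) (auto simp: frechet_derivative_eq[OF D])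
  then show ?case using D by (auto simp: differentiable_def)
qed

lemma Ck_on_sum:
  assumes "open S" "\<And>i. i \<in> I \<Longrightarrow> Ck_on k S (f i)"
  shows "Ck_on k S (\<lambda>x. \<Sum>i\<in>I. f i x)"
  using assms(2)
  by (induction I rule: infinite_finite_induct) (auto intro: Ck_on_const Ck_on_add[OF assms(1)])

lemma Ck_on_scaleR:
  fixes f :: "'a::real_normed_vector \<Rightarrow> real"
  assumes "open S" "Ck_on k S f" "Ck_on k S g"
  shows "Ck_on k S (\<lambda>x. f x *\<^sub>R g x)"
  using assms(2,3)
proof (induction k arbitrary: f g)
  case 0
  then show ?case by (simp add: continuous_on_scaleR)
next
  case (Suc k)
  have D: "((\<lambda>x. f x *\<^sub>R g x) has_derivative
      (\<lambda>v. f x *\<^sub>R frechet_derivative g (at x) v + frechet_derivative f (at x) v *\<^sub>R g x)) (at x)"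
    if "x \<in> S" for x
    using Suc.prems that by (intro has_derivative_scaleR) (simp_all add: frechet_derivative_works[symmetric])
  have "Ck_on k S (\<lambda>x. f x *\<^sub>R frechet_derivative g (at x) v + frechet_derivative f (at x) v *\<^sub>R g x)" for v
    using Suc.prems Ck_on_Suc[OF Suc.prems(1)] Ck_on_Suc[OF Suc.prems(2)]
    by (intro Ck_on_add[OF assms(1)] Suc.IH) simp_all
  then have "Ck_on k S (\<lambda>x. frechet_derivative (\<lambda>x. f x *\<^sub>R g x) (at x) v)" for v
    by (subst Ck_on_cong[OF assms(1)]) (auto simp: frechet_derivative_eq[OF D])
  then show ?case using D by (auto simp: differentiable_def)
qed

text \<open>The chain rule for directional derivatives: the direction \<open>Df\<^sub>x(v)\<close> depends on \<open>x\<close>, so it is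
  expanded in the basis, which turns the derivative of \<open>g \<circ> f\<close> into a sum of products of functions
  of lower order.\<close>

lemma Ck_on_compose:
  fixes f :: "'a::real_normed_vector \<Rightarrow> 'b::fin_dim_normed" and g :: "'b \<Rightarrow> 'c::real_normed_vector"
  assumes "open S" "open T" "f ` S \<subseteq> T" "Ck_on k S f" "Ck_on k T g"
  shows "Ck_on k S (\<lambda>x. g (f x))"
  using assms(4,5)
proof (induction k arbitrary: g)
  case 0
  then show ?case using assms(3) continuous_on_compose2 by (metis Ck_on.simps(1))
next
  case (Suc k)
  let ?D = "\<lambda>x v. \<Sum>b\<in>fbasis. fcoord b (frechet_derivative f (at x) v) *\<^sub>R frechet_derivative g (at (f x)) b"
  have D: "((\<lambda>x. g (f x)) has_derivative ?D x) (at x)" if "x \<in> S" for x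
  proof -
    have g: "(g has_derivative frechet_derivative g (at (f x))) (at (f x))"
      using Suc.prems(2) that assms(3) by (auto simp: frechet_derivative_works[symmetric])
    have "((\<lambda>x. g (f x)) has_derivative
        (\<lambda>v. frechet_derivative g (at (f x)) (frechet_derivative f (at x) v))) (at x)"
      by (rule has_derivative_compose[where f = f and g = g, OF _ g])
         (use Suc.prems(1) that in \<open>simp add: frechet_derivative_works[symmetric]\<close>)
    moreover have "(\<lambda>v. frechet_derivative g (at (f x)) (frechet_derivative f (at x) v)) = ?D x"
      by (rule ext, rule linear_expand[OF has_derivative_linear[OF g]])
    ultimately show ?thesis by simp
  qed
  have "Ck_on k S (\<lambda>x. ?D x v)" for v
  proof (intro Ck_on_sum Ck_on_scaleR assms(1))
    fix b :: 'b
    show "Ck_on k S (\<lambda>x. fcoord b (frechet_derivative f (at x) v))"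
      using Suc.prems(1) by (intro Ck_on_bounded_linear_compose[OF bounded_linear_fcoord assms(1)]) simp
    show "Ck_on k S (\<lambda>x. frechet_derivative g (at (f x)) b)"
      using Suc.prems Ck_on_Suc[OF Suc.prems(1)]
      by (intro Suc.IH[of "\<lambda>y. frechet_derivative g (at y) b"]) simp_all
  qed
  then have "Ck_on k S (\<lambda>x. frechet_derivative (\<lambda>x. g (f x)) (at x) v)" for v
    by (subst Ck_on_cong[OF assms(1)]) (auto simp: frechet_derivative_eq[OF D])
  then show ?case using D by (auto simp: differentiable_def)
qed

lemma smooth_at_compose:
  fixes f :: "'a::real_normed_vector \<Rightarrow> 'b::fin_dim_normed" and g :: "'b \<Rightarrow> 'c::real_normed_vector"
  assumes "smooth_at x f" "smooth_at (f x) g"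
  shows "smooth_at x (\<lambda>x. g (f x))"
proof -
  obtain S where S: "open S" "x \<in> S" "smooth_on S f" using assms(1) by (auto simp: smooth_at_def)
  obtain T where T: "open T" "f x \<in> T" "smooth_on T g" using assms(2) by (auto simp: smooth_at_def)
  have cont: "continuous_on S f" using S(3) by (auto simp: smooth_on_def dest: spec[of _ 0])
  have "open (S \<inter> f -` T)" using cont S(1) T(1) by (simp add: continuous_on_open_vimage Int_commute)
  moreover have "smooth_on (S \<inter> f -` T) (\<lambda>x. g (f x))"
    unfolding smooth_on_def
  proof
    fix k
    show "Ck_on k (S \<inter> f -` T) (\<lambda>x. g (f x))"
      by (rule Ck_on_compose[OF \<open>open (S \<inter> f -` T)\<close> T(1)])
         (use S(3) T(3) in \<open>auto simp: smooth_on_def intro: Ck_on_subset\<close>)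
  qed
  ultimately show ?thesis unfolding smooth_at_def using S T by blast
qed

lemma smooth_at_const: "smooth_at x (\<lambda>_. c)"
  unfolding smooth_at_def smooth_on_def using Ck_on_const by blast

lemma smooth_at_bounded_linear_compose:
  assumes "bounded_linear L" "smooth_at x f"
  shows "smooth_at x (\<lambda>x. L (f x))"
  using assms Ck_on_bounded_linear_compose unfolding smooth_at_def smooth_on_def by metis

lemma smooth_at_ident: "smooth_at x (\<lambda>x. x)"
proof -
  have "Ck_on k UNIV (\<lambda>x::'a. x)" for k
    by (cases k) (auto simp: Ck_on_const frechet_derivative_eq[OF has_derivative_ident])
  then show ?thesis unfolding smooth_at_def smooth_on_def by (intro exI[of _ UNIV]) simp
qed

text \<open>Closure of \<^const>\<open>Ck_on\<close> under a binary operation passes to germs after shrinking to a common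
  neighbourhood.\<close>

lemma smooth_at_pair:
  assumes "smooth_at x f" "smooth_at x g"
    and "\<And>S k. open S \<Longrightarrow> Ck_on k S f \<Longrightarrow> Ck_on k S g \<Longrightarrow> Ck_on k S (\<lambda>x. H x)"
  shows "smooth_at x H"
proof -
  obtain S T where "open S" "x \<in> S" "smooth_on S f" "open T" "x \<in> T" "smooth_on T g"
    using assms(1,2) by (auto simp: smooth_at_def)
  then show ?thesis
    unfolding smooth_at_def smooth_on_def
    by (intro exI[of _ "S \<inter> T"]) (auto intro!: assms(3) intro: Ck_on_subset)
qed

lemma smooth_at_add:
  "smooth_at x f \<Longrightarrow> smooth_at x g \<Longrightarrow> smooth_at x (\<lambda>x. f x + g x)"
  by (erule (1) smooth_at_pair) (rule Ck_on_add)

lemma smooth_at_scaleR: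
  fixes f :: "'a::real_normed_vector \<Rightarrow> real"
  shows "smooth_at x f \<Longrightarrow> smooth_at x g \<Longrightarrow> smooth_at x (\<lambda>x. f x *\<^sub>R g x)"
  by (erule (1) smooth_at_pair) (rule Ck_on_scaleR)

lemma smooth_at_mult:
  fixes f :: "'a::real_normed_vector \<Rightarrow> real"
  shows "smooth_at x f \<Longrightarrow> smooth_at x g \<Longrightarrow> smooth_at x (\<lambda>x. f x * g x)"
  using smooth_at_scaleR[of x f g] by simp

lemma smooth_at_sum:
  "(\<And>i. i \<in> I \<Longrightarrow> smooth_at x (f i)) \<Longrightarrow> smooth_at x (\<lambda>x. \<Sum>i\<in>I. f i x)"
  by (induction I rule: infinite_finite_induct) (auto intro: smooth_at_add smooth_at_const)

lemma smooth_at_inverse: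
  assumes "smooth_at x f" "f x \<noteq> (0::real)"
  shows "smooth_at x (\<lambda>x. inverse (f x))"
proof -
  have op: "open (- {0::real})" by (rule open_Compl) simp
  have D: "(inverse has_derivative (\<lambda>v. - v *\<^sub>R (inverse y * inverse y))) (at y)"
    if "y \<in> - {0::real}" for y
    using has_derivative_inverse'[of y UNIV] that by (simp add: ac_simps)
  have "Ck_on k (- {0}) (inverse :: real \<Rightarrow> real)" for k
  proof (induction k)
    case 0
    have "continuous_on (- {0}) (\<lambda>y::real. inverse y)" by (intro continuous_intros) auto
    then show ?case by simp
  next
    case (Suc k)
    have "Ck_on k (- {0}) (\<lambda>y. - v *\<^sub>R (inverse y *\<^sub>R inverse y))" for v :: real
      by (rule Ck_on_scaleR[OF op Ck_on_const Ck_on_scaleR[OF op Suc Suc]])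
    then have "Ck_on k (- {0}) (\<lambda>y. frechet_derivative inverse (at y) v)" for v :: real
      by (subst Ck_on_cong[OF op]) (auto simp: frechet_derivative_eq[OF D])
    then show ?case using D unfolding differentiable_def Ck_on.simps by blast
  qed
  then have "smooth_at (f x) (inverse :: real \<Rightarrow> real)"
    using assms(2) op unfolding smooth_at_def smooth_on_def by blast
  from smooth_at_compose[OF assms(1) this] show ?thesis .
qed

section \<open>Bump functions\<close>

text \<open>The derivative of a member of this family is a combination of two others, so all members
  are smooth by a simultaneous induction.\<close>

definition flat :: "nat \<Rightarrow> real \<Rightarrow> real"
  where "flat n x = (if x > 0 then exp (- inverse x) / x ^ n else 0)"

lemma flat_has_derivative:
  "(flat n has_real_derivative flat (n + 2) x - real n * flat (n + 1) x) (at x)"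
proof -
  consider "x > 0" | "x < 0" | "x = 0" by linarith
  then show ?thesis
  proof cases
    case 1
    have "((\<lambda>x. exp (- inverse x) / x ^ n) has_real_derivative
        flat (n + 2) x - real n * flat (n + 1) x) (at x)"
    proof (cases n)
      case 0
      with 1 show ?thesis
        by (auto intro!: derivative_eq_intros simp: flat_def field_simps power2_eq_square)
    next
      case (Suc m)
      have p: "((\<lambda>x. x ^ Suc m) has_real_derivative (1 + real m) * x ^ m) (at x)"
        using DERIV_power_Suc[OF DERIV_ident, of m x UNIV] by simp
      have e: "((\<lambda>x. exp (- inverse x)) has_real_derivative exp (- inverse x) / (x * x)) (at x)"
        using 1 by (auto intro!: derivative_eq_intros simp: field_simps)
      from DERIV_divide[OF e p] 1 Suc show ?thesis
        by (auto simp: flat_def field_simps elim!: DERIV_cong)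
    qed
    moreover have "\<forall>\<^sub>F y in nhds x. flat n y = exp (- inverse y) / y ^ n"
      using eventually_nhds_in_open[of "{0<..}" x] 1
      by (auto elim!: eventually_mono simp: flat_def)
    ultimately show ?thesis by (rule iffD2[OF DERIV_cong_ev[OF refl _ refl], rotated])
  next
    case 2
    have "\<forall>\<^sub>F y in nhds x. flat n y = 0"
      using eventually_nhds_in_open[of "{..<0}" x] 2
      by (auto elim!: eventually_mono simp: flat_def)
    moreover have "flat (n + 2) x - real n * flat (n + 1) x = 0" using 2 by (simp add: flat_def)
    ultimately show ?thesis using DERIV_cong_ev[of x x "flat n" "\<lambda>_. 0"] by simp
  next
    case 3
    have "((\<lambda>y. y ^ (n + 1) / exp y) \<longlongrightarrow> (0::real)) at_top" by (rule tendsto_power_div_exp_0)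
    then have "((\<lambda>y. flat (n + 1) (inverse y)) \<longlongrightarrow> 0) at_top"
      by (rule Lim_transform_eventually)
         (use eventually_gt_at_top[of 0] in \<open>eventually_elim, simp add: flat_def field_simps exp_minus\<close>)
    then have right: "(flat (n + 1) \<longlongrightarrow> 0) (at_right 0)"
      by (simp add: filterlim_at_right_to_top)
    have "(flat (n + 1) \<longlongrightarrow> 0) (at_left 0)"
      by (rule Lim_transform_eventually[OF tendsto_const])
         (auto simp: flat_def eventually_at_filter)
    with right have "(flat (n + 1) \<longlongrightarrow> 0) (at 0)" by (simp add: filterlim_split_at)
    moreover have "(\<lambda>h. (flat n (0 + h) - flat n 0) / h) = flat (n + 1)"
      by (auto simp: fun_eq_iff flat_def)
    ultimately show ?thesis using 3 by (simp add: DERIV_def) (simp add: flat_def)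
  qed
qed

lemma smooth_at_flat: "smooth_at x (flat n)"
proof -
  have D: "(flat n has_derivative (\<lambda>v. v *\<^sub>R (flat (n + 2) x + - real n *\<^sub>R flat (n + 1) x))) (at x)" for n x
  proof -
    have "(*) (flat (n + 2) x - real n * flat (n + 1) x)
        = (\<lambda>v. v *\<^sub>R (flat (n + 2) x + - real n *\<^sub>R flat (n + 1) x))"
      by (auto simp: fun_eq_iff)
    then show ?thesis
      using flat_has_derivative[of n x] unfolding has_field_derivative_def by simp
  qed
  have "Ck_on k UNIV (flat n)" for k
  proof (induction k arbitrary: n)
    case 0
    show ?case using D by (auto intro!: continuous_at_imp_continuous_on has_derivative_continuous)
  next
    case (Suc k)
    have "Ck_on k UNIV (\<lambda>x. v *\<^sub>R (flat (n + 2) x + - real n *\<^sub>R flat (n + 1) x))" for v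
      by (rule Ck_on_scaleR[OF open_UNIV Ck_on_const
            Ck_on_add[OF open_UNIV Suc Ck_on_scaleR[OF open_UNIV Ck_on_const Suc]]])
    then show ?case using D by (auto simp: differentiable_def frechet_derivative_eq[OF D])
  qed
  then show ?thesis unfolding smooth_at_def smooth_on_def by blast
qed

lemma smooth_step_exists:
  "\<exists>\<sigma>::real \<Rightarrow> real. (\<forall>x. smooth_at x \<sigma>) \<and> (\<forall>t\<le>1. \<sigma> t = 1) \<and> (\<forall>t\<ge>2. \<sigma> t = 0)"
proof -
  define \<sigma> where "\<sigma> = (\<lambda>t. flat 0 (2 - t) * inverse (flat 0 (2 - t) + flat 0 (t - 1)))"
  have lin: "smooth_at x (\<lambda>t. a + b *\<^sub>R t)" for a b x :: real
    by (intro smooth_at_add smooth_at_scaleR smooth_at_const smooth_at_ident)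
  have f1: "smooth_at x (\<lambda>t. flat 0 (2 - t))" for x
    using smooth_at_compose[OF lin[of x 2 "- 1"] smooth_at_flat[of _ 0]] by simp
  have f2: "smooth_at x (\<lambda>t. flat 0 (t - 1))" for x
    using smooth_at_compose[OF lin[of x "- 1" 1] smooth_at_flat[of _ 0]] by simp
  have pos: "flat 0 (2 - t) + flat 0 (t - 1) \<noteq> 0" for t
  proof -
    have "flat 0 (2 - t) > 0 \<or> flat 0 (t - 1) > 0" by (auto simp: flat_def)
    moreover have "flat 0 (2 - t) \<ge> 0" "flat 0 (t - 1) \<ge> 0" by (auto simp: flat_def)
    ultimately show ?thesis by linarith
  qed
  have "smooth_at x \<sigma>" for x
    unfolding \<sigma>_def
    by (rule smooth_at_mult[OF f1 smooth_at_inverse[OF smooth_at_add[OF f1 f2] pos]])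
  moreover have "\<sigma> t = 1" if "t \<le> 1" for t
    using that pos[of t] by (simp add: \<sigma>_def flat_def)
  moreover have "\<sigma> t = 0" if "t \<ge> 2" for t
    using that by (simp add: \<sigma>_def flat_def)
  ultimately show ?thesis by blast
qed

text \<open>The norm need not be smooth off the origin, so the bump function is a function of the sum of
  the squares of the coordinates instead.\<close>

lemma fin_dim_bump:
  fixes p :: "'e::fin_dim_normed"
  assumes "open S" "p \<in> S"
  shows "\<exists>h::'e \<Rightarrow> real. \<exists>W K. (\<forall>x. smooth_at x h) \<and> open W \<and> p \<in> W \<and> (\<forall>x\<in>W. h x = 1) \<and>
    compact K \<and> K \<subseteq> S \<and> (\<forall>x. x \<notin> K \<longrightarrow> h x = 0)"
proof -
  obtain \<sigma> :: "real \<Rightarrow> real" where \<sigma>: "\<And>x. smooth_at x \<sigma>" "\<And>t. t \<le> 1 \<Longrightarrow> \<sigma> t = 1" "\<And>t. t \<ge> 2 \<Longrightarrow> \<sigma> t = 0"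
    using smooth_step_exists by blast
  obtain r where r: "r > 0" "cball p r \<subseteq> S"
    using assms open_contains_cball by blast
  define q where "q = (\<lambda>x::'e. \<Sum>b\<in>fbasis. fcoord b (x - p) * fcoord b (x - p))"
  define M where "M = (\<Sum>b\<in>(fbasis::'e set). norm b) + 1"
  have M: "M > 0" unfolding M_def by (intro add_nonneg_pos sum_nonneg) auto
  define \<delta> where "\<delta> = (r / M)\<^sup>2"
  have \<delta>: "\<delta> > 0" using r M by (simp add: \<delta>_def)
  have minus: "smooth_at x (\<lambda>x. x - p)" for x
    using smooth_at_add[OF smooth_at_ident smooth_at_const[of x "- p"]] by simp
  have q_smooth: "smooth_at x q" for x
    unfolding q_def
    by (intro smooth_at_sum smooth_at_mult smooth_at_bounded_linear_compose[OF bounded_linear_fcoord] minus)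
  have q_small: "norm (x - p) \<le> r" if "q x \<le> \<delta>" for x
  proof -
    have c: "\<bar>fcoord b (x - p)\<bar> \<le> r / M" if b: "b \<in> fbasis" for b
    proof -
      have "(fcoord b (x - p))\<^sup>2 \<le> q x"
        unfolding q_def power2_eq_square using b fbasis(1)
        by (intro member_le_sum[of b fbasis "\<lambda>b. fcoord b (x - p) * fcoord b (x - p)"]) auto
      then have "(fcoord b (x - p))\<^sup>2 \<le> (r / M)\<^sup>2" using that \<open>q x \<le> \<delta>\<close> by (simp add: \<delta>_def)
      then show ?thesis using r M by (simp add: abs_le_square_iff[symmetric])
    qed
    have "norm (x - p) = norm (\<Sum>b\<in>fbasis. fcoord b (x - p) *\<^sub>R b)" by (simp add: fcoord_sum)
    also have "\<dots> \<le> (\<Sum>b\<in>(fbasis::'e set). r / M * norm b)"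
      by (intro sum_norm_le) (simp add: c mult_right_mono del: times_divide_eq_left)
    also have "\<dots> \<le> r / M * M"
      unfolding sum_distrib_left[symmetric] M_def[symmetric]
      using r M by (intro mult_left_mono) (auto simp: M_def)
    also have "\<dots> = r" using M by simp
    finally show ?thesis .
  qed
  have q_cont: "continuous_on UNIV q"
    using q_smooth smooth_at_isCont by (blast intro: continuous_at_imp_continuous_on)
  define h where "h = (\<lambda>x. \<sigma> ((2 / \<delta>) *\<^sub>R q x))"
  have "smooth_at x h" for x
    unfolding h_def
    by (rule smooth_at_compose[OF smooth_at_scaleR[OF smooth_at_const q_smooth] \<sigma>(1)])
  moreover have "open {x. q x < \<delta> / 2}"
    using open_Collect_less[OF q_cont continuous_on_const] .
  moreover have "p \<in> {x. q x < \<delta> / 2}"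
    using \<delta> by (simp add: q_def linear_0[OF linear_fcoord])
  moreover have "\<forall>x\<in>{x. q x < \<delta> / 2}. h x = 1"
    using \<delta> by (auto simp: h_def field_simps intro!: \<sigma>(2))
  moreover have "compact {x. q x \<le> \<delta>}"
  proof (rule fin_dim_compact)
    show "bounded {x. q x \<le> \<delta>}"
      by (rule bounded_subset[OF bounded_cball[of p r]])
         (use q_small in \<open>auto simp: dist_norm norm_minus_commute\<close>)
    show "closed {x. q x \<le> \<delta>}" using closed_Collect_le[OF q_cont continuous_on_const] .
  qed
  moreover have "{x. q x \<le> \<delta>} \<subseteq> S"
    using q_small r by (auto simp: subset_iff dist_norm norm_minus_commute)
  moreover have "\<forall>x. x \<notin> {x. q x \<le> \<delta>} \<longrightarrow> h x = 0"
    using \<delta> by (auto simp: h_def field_simps intro!: \<sigma>(3))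
  ultimately show ?thesis by blast
qed

section \<open>Smooth germs on manifolds\<close>

locale manifold =
  fixes A :: "('a::{t2_space, second_countable_topology}, 'e::fin_dim_normed) chart set"
  assumes atlas: "smooth_atlas A"
begin

lemma chart:
  assumes "(U, c) \<in> A"
  shows chart_open: "open U" and chart_open_image: "open (c ` U)"
    and chart_homeomorphism: "homeomorphism U (c ` U) c (inv_into U c)"
    and chart_continuous_on: "continuous_on U c"
    and chart_inv_continuous_on: "continuous_on (c ` U) (inv_into U c)"
    and chart_inv: "\<And>x. x \<in> U \<Longrightarrow> inv_into U c (c x) = x"
  using assms atlas by (auto simp: smooth_atlas_def homeomorphism_def)

lemma chart_open_image_Int: "(U, c) \<in> A \<Longrightarrow> open S \<Longrightarrow> open (c ` (U \<inter> S))"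
  using homeomorphism_imp_open_map[OF chart_homeomorphism, of U c "U \<inter> S"] chart_open[of U c]
    chart_open_image[of U c]
  by (metis Int_lower1 open_Int openin_open_eq openin_open_trans topological_space_class.openI)

lemma ex_chart: "\<exists>U c. (U, c) \<in> A \<and> p \<in> U"
  using atlas unfolding smooth_atlas_def by blast

lemma chart_at: obtains U c where "chart_at A p = (U, c)" "(U, c) \<in> A" "p \<in> U"
proof -
  have "\<exists>C. (case C of (U, c) \<Rightarrow> (U, c) \<in> A \<and> p \<in> U)" using ex_chart[of p] by auto
  from someI_ex[OF this] show ?thesis
    using that unfolding chart_at_def by (metis (mono_tags, lifting) case_prod_conv surj_pair)
qed

lemma nhds_chart:
  assumes "(U, c) \<in> A" "p \<in> U"
  shows "(\<forall>\<^sub>F y in nhds (c p). P (inv_into U c y)) \<longleftrightarrow> (\<forall>\<^sub>F x in nhds p. P x)"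
proof
  assume "\<forall>\<^sub>F y in nhds (c p). P (inv_into U c y)"
  moreover have "(c \<longlongrightarrow> c p) (nhds p)"
    using chart_continuous_on[OF assms(1)] chart_open[OF assms(1)] assms(2)
    by (simp add: continuous_on_eq_continuous_at continuous_at tendsto_at_iff_tendsto_nhds)
  ultimately have "\<forall>\<^sub>F x in nhds p. P (inv_into U c (c x))"
    by (auto simp: filterlim_iff)
  then show "\<forall>\<^sub>F x in nhds p. P x"
    using eventually_nhds_in_open[OF chart_open[OF assms(1)] assms(2)]
    by eventually_elim (simp add: chart_inv[OF assms(1)])
next
  assume *: "\<forall>\<^sub>F x in nhds p. P x"
  have "(inv_into U c \<longlongrightarrow> p) (nhds (c p))"
    using chart_inv_continuous_on[OF assms(1)] chart_open_image[OF assms(1)] assms(2) chart_inv[OF assms]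
    by (auto simp: continuous_on_eq_continuous_at continuous_at tendsto_at_iff_tendsto_nhds
        dest!: bspec[of _ _ "c p"])
  with * show "\<forall>\<^sub>F y in nhds (c p). P (inv_into U c y)" by (auto simp: filterlim_iff)
qed

lemma transition_smooth:
  assumes "(U, c) \<in> A" "(W, d) \<in> A" "p \<in> U" "p \<in> W"
  shows "smooth_at (c p) (\<lambda>y. d (inv_into U c y))"
proof -
  have "smooth_on (c ` (U \<inter> W)) (d \<circ> inv_into U c)"
    using atlas assms(1,2) unfolding smooth_atlas_def by blast
  moreover have "open (c ` (U \<inter> W))" using chart_open_image_Int[OF assms(1) chart_open[OF assms(2)]] .
  ultimately show ?thesis using assms(3,4) by (auto simp: smooth_on_iff o_def)
qed

text \<open>Smoothness at a point is required in all charts but can be tested in one (\<open>msmooth_chart_iff\<close>).\<close>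

definition msmooth :: "'a \<Rightarrow> ('a \<Rightarrow> 'b::real_normed_vector) \<Rightarrow> bool"
  where "msmooth p f \<longleftrightarrow> (\<forall>(U, c)\<in>A. p \<in> U \<longrightarrow> smooth_at (c p) (\<lambda>y. f (inv_into U c y)))"

lemma msmoothD: "msmooth p f \<Longrightarrow> (U, c) \<in> A \<Longrightarrow> p \<in> U \<Longrightarrow> smooth_at (c p) (\<lambda>y. f (inv_into U c y))"
  unfolding msmooth_def by blast

lemma msmooth_chart_iff:
  assumes "(U, c) \<in> A" "p \<in> U"
  shows "msmooth p f \<longleftrightarrow> smooth_at (c p) (\<lambda>y. f (inv_into U c y))"
proof
  assume L: "smooth_at (c p) (\<lambda>y. f (inv_into U c y))"
  show "msmooth p f"
    unfolding msmooth_def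
  proof safe
    fix W d assume W: "(W, d) \<in> A" "p \<in> W"
    have "smooth_at (d p) (\<lambda>y. c (inv_into W d y))" using transition_smooth W assms by blast
    moreover have "smooth_at (c (inv_into W d (d p))) (\<lambda>y. f (inv_into U c y))"
      using L W by (simp add: chart_inv)
    ultimately have "smooth_at (d p) (\<lambda>y. f (inv_into U c (c (inv_into W d y))))"
      by (rule smooth_at_compose)
    moreover have "\<forall>\<^sub>F y in nhds (d p). f (inv_into U c (c (inv_into W d y))) = f (inv_into W d y)"
      unfolding nhds_chart[OF W, of "\<lambda>x. f (inv_into U c (c x)) = f x"]
      using eventually_nhds_in_open[OF chart_open[OF assms(1)] assms(2)]
      by eventually_elim (simp add: chart_inv[OF assms(1)])
    ultimately show "smooth_at (d p) (\<lambda>y. f (inv_into W d y))" by (rule smooth_at_cong[rotated])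
  qed
qed (use assms msmoothD in blast)

lemma smooth_fun_on_iff:
  assumes "open S"
  shows "smooth_fun_on A S f \<longleftrightarrow> (\<forall>p\<in>S. msmooth p f)"
proof -
  have "smooth_fun_on A S f \<longleftrightarrow>
      (\<forall>(U, c)\<in>A. \<forall>p\<in>U \<inter> S. smooth_at (c p) (\<lambda>y. f (inv_into U c y)))"
    unfolding smooth_fun_on_def
    by (intro ball_cong refl) (auto simp: smooth_on_iff[OF chart_open_image_Int[OF _ assms]] o_def)
  also have "\<dots> \<longleftrightarrow> (\<forall>p\<in>S. msmooth p f)" unfolding msmooth_def by blast
  finally show ?thesis .
qed

lemma msmooth_cong:
  assumes "\<forall>\<^sub>F x in nhds p. f x = g x" "msmooth p f"
  shows "msmooth p g"
  unfolding msmooth_def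
proof safe
  fix U c assume U: "(U, c) \<in> A" "p \<in> U"
  show "smooth_at (c p) (\<lambda>y. g (inv_into U c y))"
    by (rule smooth_at_cong[OF _ msmoothD[OF assms(2) U]])
       (use nhds_chart[OF U, of "\<lambda>x. f x = g x"] assms(1) in simp)
qed

lemma eventually_msmooth:
  assumes "msmooth p f"
  shows "\<forall>\<^sub>F x in nhds p. msmooth x f"
proof -
  obtain U c where U: "(U, c) \<in> A" "p \<in> U" using ex_chart by blast
  have "\<forall>\<^sub>F y in nhds (c p). smooth_at y (\<lambda>y. f (inv_into U c y)) \<and> y \<in> c ` U"
    using eventually_smooth_at[OF msmoothD[OF assms U]]
      eventually_nhds_in_open[OF chart_open_image[OF U(1)], of "c p"] U(2)
    by (auto intro: eventually_conj)
  then have "\<forall>\<^sub>F y in nhds (c p). smooth_at (c (inv_into U c y)) (\<lambda>y. f (inv_into U c y))"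
    by (rule eventually_mono) (simp add: f_inv_into_f)
  then have "\<forall>\<^sub>F x in nhds p. smooth_at (c x) (\<lambda>y. f (inv_into U c y))"
    by (subst (asm) nhds_chart[OF U, of "\<lambda>x. smooth_at (c x) (\<lambda>y. f (inv_into U c y))"])
  then show ?thesis
    using eventually_nhds_in_open[OF chart_open[OF U(1)] U(2)]
    by eventually_elim (use msmooth_chart_iff[OF U(1)] in blast)
qed

lemma msmooth_const: "msmooth p (\<lambda>_. k)"
  unfolding msmooth_def by (auto intro: smooth_at_const)

lemma msmooth_add: "msmooth p f \<Longrightarrow> msmooth p g \<Longrightarrow> msmooth p (\<lambda>x. f x + g x)"
  unfolding msmooth_def by (auto intro: smooth_at_add)

lemma msmooth_scaleR:
  fixes f :: "'a \<Rightarrow> real"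
  shows "msmooth p f \<Longrightarrow> msmooth p g \<Longrightarrow> msmooth p (\<lambda>x. f x *\<^sub>R g x)"
  unfolding msmooth_def by (auto intro: smooth_at_scaleR)

lemma msmooth_mult:
  fixes f :: "'a \<Rightarrow> real"
  shows "msmooth p f \<Longrightarrow> msmooth p g \<Longrightarrow> msmooth p (\<lambda>x. f x * g x)"
  unfolding msmooth_def by (auto intro: smooth_at_mult)

lemma msmooth_sum: "(\<And>i. i \<in> I \<Longrightarrow> msmooth p (f i)) \<Longrightarrow> msmooth p (\<lambda>x. \<Sum>i\<in>I. f i x)"
  unfolding msmooth_def by (auto intro!: smooth_at_sum)

lemma msmooth_bounded_linear: "bounded_linear L \<Longrightarrow> msmooth p f \<Longrightarrow> msmooth p (\<lambda>x. L (f x))"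
  unfolding msmooth_def by (auto intro: smooth_at_bounded_linear_compose)

lemma msmooth_compose:
  fixes f :: "'a \<Rightarrow> 'b::fin_dim_normed"
  assumes "msmooth p f" "smooth_at (f p) h"
  shows "msmooth p (\<lambda>x. h (f x))"
  unfolding msmooth_def
proof safe
  fix U c assume U: "(U, c) \<in> A" "p \<in> U"
  show "smooth_at (c p) (\<lambda>y. h (f (inv_into U c y)))"
    by (rule smooth_at_compose[OF msmoothD[OF assms(1) U]]) (simp add: chart_inv[OF U] assms)
qed

lemma msmooth_coord:
  assumes "(U, c) \<in> A" "p \<in> U"
  shows "msmooth p c"
  using transition_smooth assms unfolding msmooth_def by blast

section \<open>Partitions of unity\<close>

text \<open>A bump function in a chart extends by 0 to the whole manifold: its support is compact in the chart,
  hence closed in the manifold because the latter is Hausdorff.\<close>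

lemma manifold_bump:
  assumes "open S" "p \<in> S"
  obtains h :: "'a \<Rightarrow> real" and W C where "\<And>x. msmooth x h" "open W" "p \<in> W" "\<And>x. x \<in> W \<Longrightarrow> h x = 1"
    "closed C" "C \<subseteq> S" "\<And>x. x \<notin> C \<Longrightarrow> h x = 0"
proof -
  obtain U c where U: "(U, c) \<in> A" "p \<in> U" using ex_chart by blast
  have "open (c ` (U \<inter> S))" "c p \<in> c ` (U \<inter> S)"
    using chart_open_image_Int[OF U(1) assms(1)] U assms by auto
  from fin_dim_bump[OF this] obtain h0 :: "'e \<Rightarrow> real" and W0 K where
    h0: "\<And>x. smooth_at x h0" "open W0" "c p \<in> W0" "\<And>x. x \<in> W0 \<Longrightarrow> h0 x = 1"
    and K: "compact K" "K \<subseteq> c ` (U \<inter> S)" "\<And>x. x \<notin> K \<Longrightarrow> h0 x = 0"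
    by blast
  define h where "h x = (if x \<in> U then h0 (c x) else 0)" for x
  define C where "C = inv_into U c ` K"
  have K_sub: "K \<subseteq> c ` U" using K(2) by blast
  have "compact C"
    unfolding C_def
    by (rule compact_continuous_image[OF continuous_on_subset[OF chart_inv_continuous_on[OF U(1)] K_sub] K(1)])
  then have C: "closed C" by (rule compact_imp_closed)
  have C_S: "C \<subseteq> U \<inter> S" using K(2) chart_inv[OF U(1)] by (auto simp: C_def)
  have h_0: "h x = 0" if "x \<notin> C" for x
  proof (cases "x \<in> U")
    case True
    then have "c x \<notin> K" using that chart_inv[OF U(1) True] unfolding C_def by (metis imageI)
    with True show ?thesis by (simp add: h_def K(3))
  qed (simp add: h_def)
  have "msmooth x h" for x
  proof (cases "x \<in> U")
    case True
    have "msmooth x (\<lambda>x. h0 (c x))"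
      by (rule msmooth_compose[OF msmooth_coord[OF U(1) True] h0(1)])
    moreover have "\<forall>\<^sub>F y in nhds x. h0 (c y) = h y"
      using eventually_nhds_in_open[OF chart_open[OF U(1)] True]
      by eventually_elim (simp add: h_def)
    ultimately show ?thesis by (rule msmooth_cong[rotated])
  next
    case False
    then have "x \<in> - C" using C_S by blast
    from eventually_nhds_in_open[OF open_Compl[OF C] this]
    have "\<forall>\<^sub>F y in nhds x. 0 = h y" by eventually_elim (simp add: h_0)
    from msmooth_cong[OF this msmooth_const] show ?thesis .
  qed
  moreover have "open (U \<inter> c -` W0)"
    using continuous_open_preimage[OF chart_continuous_on[OF U(1)] chart_open[OF U(1)] h0(2)] .
  moreover have "p \<in> U \<inter> c -` W0" using U h0 by simp
  moreover have "h x = 1" if "x \<in> U \<inter> c -` W0" for x using that h0(4) by (simp add: h_def)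
  ultimately show thesis using that C C_S h_0 by blast
qed

text \<open>By the Lindelof property countably many bump functions \<open>f\<^sub>n\<close> have the open sets \<open>{f\<^sub>n = 1}\<close>
  as a cover. The functions \<open>g\<^sub>n = f\<^sub>n \<Prod>\<^sub>i\<^sub><\<^sub>n (1 - f\<^sub>i)\<close> have partial sums \<open>1 - \<Prod>\<^sub>i\<^sub><\<^sub>N (1 - f\<^sub>i)\<close>, so where
  \<open>f\<^sub>N = 1\<close> the first \<open>N + 1\<close> of them sum to 1 and all others vanish. Each \<open>g\<^sub>n\<close> comes with a wider
  bump function \<open>h\<^sub>n\<close>, equal to 1 near its support, that is used to extend local sections.\<close>

lemma partition_of_unity:
  fixes U :: "'i \<Rightarrow> 'a set"
  assumes "\<And>i. i \<in> I \<Longrightarrow> open (U i)" "(\<Union>i\<in>I. U i) = UNIV"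
  obtains i :: "nat \<Rightarrow> 'i" and g h :: "nat \<Rightarrow> 'a \<Rightarrow> real" and K C :: "nat \<Rightarrow> 'a set"
    where "\<And>n. i n \<in> I"
    and "\<And>n x. msmooth x (g n)" "\<And>n. closed (K n)" "\<And>n x. x \<notin> K n \<Longrightarrow> g n x = 0"
    and "\<And>n x. msmooth x (h n)" "\<And>n. closed (C n)" "\<And>n. C n \<subseteq> U (i n)" "\<And>n x. x \<notin> C n \<Longrightarrow> h n x = 0"
    and "\<And>n x. x \<in> K n \<Longrightarrow> \<forall>\<^sub>F y in nhds x. h n y = 1"
    and "\<And>x. \<exists>N. \<forall>\<^sub>F y in nhds x. (\<forall>n\<ge>N. g n y = 0) \<and> (\<Sum>n<N. g n y) = 1"
proof -
  \<comment> \<open>a bump function \<open>h\<close> around \<open>p\<close>, a narrower one \<open>f\<close> with support where \<open>h = 1\<close>, and a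
    neighbourhood \<open>V\<close> of \<open>p\<close> where \<open>f = 1\<close>\<close>
  have "\<exists>i f h K C V. i \<in> I \<and> (\<forall>x. msmooth x f) \<and> closed K \<and> (\<forall>x. x \<notin> K \<longrightarrow> f x = 0) \<and>
      (\<forall>x. msmooth x h) \<and> closed C \<and> C \<subseteq> U i \<and> (\<forall>x. x \<notin> C \<longrightarrow> h x = 0) \<and>
      (\<forall>x\<in>K. \<forall>\<^sub>F y in nhds x. h y = (1::real)) \<and> open V \<and> p \<in> V \<and> (\<forall>x\<in>V. f x = (1::real))"
    (is "\<exists>i f h K C V. ?P p i f h K C V") for p
  proof -
    obtain j where j: "j \<in> I" "p \<in> U j" using assms(2) by blast
    obtain h W C where h: "\<And>x. msmooth x h" "open W" "p \<in> W" "\<And>x. x \<in> W \<Longrightarrow> h x = (1::real)"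
      "closed C" "C \<subseteq> U j" "\<And>x. x \<notin> C \<Longrightarrow> h x = 0"
      using manifold_bump[OF assms(1)[OF j(1)] j(2)] by blast
    obtain f V K where f: "\<And>x. msmooth x f" "open V" "p \<in> V" "\<And>x. x \<in> V \<Longrightarrow> f x = (1::real)"
      "closed K" "K \<subseteq> W" "\<And>x. x \<notin> K \<Longrightarrow> f x = 0"
      using manifold_bump[OF h(2,3)] by blast
    have "\<forall>\<^sub>F y in nhds x. h y = 1" if "x \<in> K" for x
    proof -
      have "x \<in> W" using that f(6) by blast
      from eventually_nhds_in_open[OF h(2) this] show ?thesis by eventually_elim (rule h(4))
    qed
    then show ?thesis
      using j h(1,5-7) f(1-5,7)
      by (intro exI[of _ j] exI[of _ f] exI[of _ h] exI[of _ K] exI[of _ C] exI[of _ V] conjI ballI allI impI)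
         simp_all
  qed
  note ex = this
  have "\<forall>p. \<exists>t. ?P p (fst t) (fst (snd t)) (fst (snd (snd t))) (fst (snd (snd (snd t))))
      (fst (snd (snd (snd (snd t))))) (snd (snd (snd (snd (snd t)))))"
  proof
    fix p
    obtain i f h K C V where "?P p i f h K C V" using ex[of p] by (elim exE)
    then show "\<exists>t. ?P p (fst t) (fst (snd t)) (fst (snd (snd t))) (fst (snd (snd (snd t))))
        (fst (snd (snd (snd (snd t))))) (snd (snd (snd (snd (snd t)))))"
      by (intro exI[of _ "(i, f, h, K, C, V)"]) (unfold fst_conv snd_conv)
  qed
  from choice[OF this] obtain t where t: "\<forall>p. ?P p (fst (t p)) (fst (snd (t p))) (fst (snd (snd (t p))))
      (fst (snd (snd (snd (t p))))) (fst (snd (snd (snd (snd (t p)))))) (snd (snd (snd (snd (snd (t p))))))"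
    by (rule exE)
  define ii ff hh KK CC VV where defs: "ii = (\<lambda>p. fst (t p))" "ff = (\<lambda>p. fst (snd (t p)))"
    "hh = (\<lambda>p. fst (snd (snd (t p))))" "KK = (\<lambda>p. fst (snd (snd (snd (t p)))))"
    "CC = (\<lambda>p. fst (snd (snd (snd (snd (t p))))))" "VV = (\<lambda>p. snd (snd (snd (snd (snd (t p))))))"
  have *: "?P p (ii p) (ff p) (hh p) (KK p) (CC p) (VV p)" for p
    unfolding defs using t by (rule spec)
  obtain \<V> where \<V>: "\<V> \<subseteq> range VV" "countable \<V>" "\<Union>\<V> = \<Union>(range VV)"
    using Lindelof[of "range VV"] * by blast
  have UN: "\<Union>\<V> = UNIV" using \<V>(3) * by blast
  then have "\<V> \<noteq> {}" by blast
  define e where "e = from_nat_into \<V>"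
  have e: "range e = \<V>" using \<V>(2) \<open>\<V> \<noteq> {}\<close> by (simp add: e_def)
  then have "\<exists>q. e n = VV q" for n using \<V>(1) by blast
  then obtain q where q: "\<And>n. e n = VV (q n)" by metis
  have cover: "\<exists>n. x \<in> VV (q n)" for x using UN e q by blast
  define f where "f n = ff (q n)" for n
  define g where "g n x = f n x * (\<Prod>i<n. 1 - f i x)" for n x
  have f_smooth: "msmooth x (f n)" for n x using * by (simp add: f_def)
  have prod_smooth: "msmooth x (\<lambda>x. \<Prod>i<n. 1 - f i x)" for n x
  proof (induction n)
    case (Suc n)
    have "msmooth x (\<lambda>x. 1 + - 1 *\<^sub>R f n x)"
      by (intro msmooth_add msmooth_scaleR msmooth_const f_smooth)
    from msmooth_mult[OF Suc this] show ?case by simp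
  qed (simp add: msmooth_const)
  have sum_g: "(\<Sum>n<N. g n x) = 1 - (\<Prod>i<N. 1 - f i x)" for N x
    by (induction N) (auto simp: g_def algebra_simps)
  have prod_0: "(\<Prod>i<n. 1 - f i y) = 0" if "m < n" "f m y = 1" for m n y
    using that by (intro prod_zero) auto
  show thesis
  proof (rule that[of "\<lambda>n. ii (q n)" g "\<lambda>n. KK (q n)" "\<lambda>n. hh (q n)" "\<lambda>n. CC (q n)"])
    show "ii (q n) \<in> I" for n using * by blast
    show "msmooth x (g n)" for n x unfolding g_def by (intro msmooth_mult f_smooth prod_smooth)
    show "closed (KK (q n))" "closed (CC (q n))" "CC (q n) \<subseteq> U (ii (q n))" for n using * by auto
    show "g n x = 0" if "x \<notin> KK (q n)" for n x using that * by (auto simp: g_def f_def)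
    show "msmooth x (hh (q n))" for n x using * by blast
    show "hh (q n) x = 0" if "x \<notin> CC (q n)" for n x using that * by blast
    show "\<forall>\<^sub>F y in nhds x. hh (q n) y = 1" if "x \<in> KK (q n)" for n x using that * by blast
    show "\<exists>N. \<forall>\<^sub>F y in nhds x. (\<forall>n\<ge>N. g n y = 0) \<and> (\<Sum>n<N. g n y) = 1" for x
    proof -
      obtain m where m: "x \<in> VV (q m)" using cover by blast
      have "\<forall>\<^sub>F y in nhds x. y \<in> VV (q m)"
        using m * by (intro eventually_nhds_in_open) auto
      then have "\<forall>\<^sub>F y in nhds x. (\<forall>n\<ge>Suc m. g n y = 0) \<and> (\<Sum>n<Suc m. g n y) = 1"
      proof eventually_elim
        case (elim y)
        then have "f m y = 1" using * by (auto simp: f_def)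
        then show ?case using prod_0[of m _ y] unfolding sum_g by (auto simp: g_def)
      qed
      then show ?thesis by blast
    qed
  qed
qed

section \<open>Tangent vectors and curves\<close>

lemma tangent_eq:
  assumes "X \<in> tangent_space A p" "(U, c) \<in> A" "(W, d) \<in> A" "p \<in> U" "p \<in> W"
  shows "X (W, d) = frechet_derivative (\<lambda>y. d (inv_into U c y)) (at (c p)) (X (U, c))"
proof -
  have "\<forall>(U, c)\<in>A. \<forall>(W, d)\<in>A. p \<in> U \<and> p \<in> W \<longrightarrow>
      X (W, d) = frechet_derivative (d \<circ> inv_into U c) (at (c p)) (X (U, c))"
    using assms(1) unfolding tangent_space_def by simp
  from bspec[OF this assms(2)] have "\<forall>(W, d)\<in>A. p \<in> U \<and> p \<in> W \<longrightarrow>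
      X (W, d) = frechet_derivative (d \<circ> inv_into U c) (at (c p)) (X (U, c))" by simp
  from bspec[OF this assms(3)] show ?thesis using assms(4,5) by (simp add: o_def)
qed

lemma tangent_eqI:
  assumes "X \<in> tangent_space A p" "Y \<in> tangent_space A p" "(U, c) \<in> A" "p \<in> U" "X (U, c) = Y (U, c)"
  shows "X = Y"
proof (rule ext, clarify)
  fix W d
  show "X (W, d) = Y (W, d)"
  proof (cases "(W, d) \<in> A \<and> p \<in> W")
    case True
    then show ?thesis
      using tangent_eq[OF assms(1,3) _ assms(4)] tangent_eq[OF assms(2,3) _ assms(4)] assms(5) by simp
  next
    case False
    then show ?thesis using assms(1,2) by (simp add: tangent_space_def)
  qed
qed

lemma chart_has_derivative:
  assumes "msmooth p f" "(U, c) \<in> A" "p \<in> U"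
  shows "((\<lambda>y. f (inv_into U c y)) has_derivative frechet_derivative (\<lambda>y. f (inv_into U c y)) (at (c p))) (at (c p))"
  by (rule smooth_at_has_derivative[OF msmoothD[OF assms]])

text \<open>The chain rule for a change of charts; it makes derivatives in the direction of a tangent vector
  independent of the chart.\<close>

lemma chart_chain:
  assumes "msmooth p f" "(U, c) \<in> A" "(W, d) \<in> A" "p \<in> U" "p \<in> W"
  shows "frechet_derivative (\<lambda>y. f (inv_into W d y)) (at (d p))
      (frechet_derivative (\<lambda>y. d (inv_into U c y)) (at (c p)) v) =
    frechet_derivative (\<lambda>y. f (inv_into U c y)) (at (c p)) v"
proof -
  have "((\<lambda>y. f (inv_into W d y)) has_derivative frechet_derivative (\<lambda>y. f (inv_into W d y)) (at (d p)))
      (at (d (inv_into U c (c p))))"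
    using chart_has_derivative[OF assms(1,3,5)] by (simp add: chart_inv[OF assms(2,4)])
  from has_derivative_compose[OF smooth_at_has_derivative[OF transition_smooth[OF assms(2-5)]] this]
  have "((\<lambda>y. f (inv_into W d (d (inv_into U c y)))) has_derivative
      (\<lambda>v. frechet_derivative (\<lambda>y. f (inv_into W d y)) (at (d p))
        (frechet_derivative (\<lambda>y. d (inv_into U c y)) (at (c p)) v))) (at (c p))" .
  moreover have "\<forall>\<^sub>F y in nhds (c p). f (inv_into W d (d (inv_into U c y))) = f (inv_into U c y)"
    unfolding nhds_chart[OF assms(2,4), of "\<lambda>x. f (inv_into W d (d x)) = f x"]
    using eventually_nhds_in_open[OF chart_open[OF assms(3)] assms(5)]
    by eventually_elim (simp add: chart_inv[OF assms(3)])
  ultimately have "((\<lambda>y. f (inv_into U c y)) has_derivative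
      (\<lambda>v. frechet_derivative (\<lambda>y. f (inv_into W d y)) (at (d p))
        (frechet_derivative (\<lambda>y. d (inv_into U c y)) (at (c p)) v))) (at (c p))"
    by (rule has_derivative_transform_eventually_nhds)
  from frechet_derivative_eq[OF this] show ?thesis by metis
qed

end

text \<open>Tangent vectors are handled through curves: \<open>velocity A a X\<close> says that the curve \<open>a\<close>, of which
  only the germ at 0 matters, has velocity \<open>X\<close> at time 0. Every tangent vector is a velocity, and
  the rules of calculus for manifolds follow from the one-variable ones along curves.\<close>

definition velocity ::
    "('a::topological_space, 'e::real_normed_vector) chart set \<Rightarrow> (real \<Rightarrow> 'a) \<Rightarrow> ('a, 'e) tangent \<Rightarrow> bool"
  where "velocity A a X \<longleftrightarrow> X \<in> tangent_space A (a 0) \<and> (a \<longlongrightarrow> a 0) (nhds 0) \<and>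
    (\<forall>(U, c)\<in>A. a 0 \<in> U \<longrightarrow> ((\<lambda>t. c (a t)) has_vector_derivative X (U, c)) (at 0))"

text \<open>This is \<^const>\<open>differential_fun\<close> for values in a normed space. It is applied to sections read in a
  trivialization.\<close>

definition dvec ::
    "('a, 'e::real_normed_vector) chart set \<Rightarrow> ('a \<Rightarrow> 'b::real_normed_vector) \<Rightarrow> 'a \<Rightarrow>
     ('a, 'e) tangent \<Rightarrow> 'b"
  where "dvec A f p X = (let (U, c) = chart_at A p
     in frechet_derivative (f \<circ> inv_into U c) (at (c p)) (X (U, c)))"

lemma differential_fun_eq_dvec: "differential_fun A f p X = dvec A f p X"
  unfolding differential_fun_def dvec_def ..

lemma has_vector_derivative_cong_nhds:
  assumes "(f has_vector_derivative D) (at x)" "\<forall>\<^sub>F y in nhds x. f y = g y"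
  shows "(g has_vector_derivative D) (at x)"
  using assms unfolding has_vector_derivative_def
  by (rule has_derivative_transform_eventually_nhds)

lemma has_vector_derivative_compose:
  assumes "(a has_vector_derivative v) (at x)" "(f has_derivative D) (at (a x))"
  shows "((\<lambda>t. f (a t)) has_vector_derivative D v) (at x)"
  using vector_derivative_diff_chain_within[OF assms(1) has_derivative_at_withinI[OF assms(2)]]
  by (simp add: o_def)

lemma linear_betweenD:
  assumes "linear_between S T f"
  shows "\<And>u. u \<in> S \<Longrightarrow> f u \<in> T" "\<And>u v. u \<in> S \<Longrightarrow> v \<in> S \<Longrightarrow> f (u + v) = f u + f v"
    "\<And>r v. v \<in> S \<Longrightarrow> f (r *\<^sub>R v) = r *\<^sub>R f v"
  using assms unfolding linear_between_def by blast+

lemma linear_betweenI: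
  assumes "\<And>u. u \<in> S \<Longrightarrow> f u \<in> T" "\<And>u v. u \<in> S \<Longrightarrow> v \<in> S \<Longrightarrow> f (u + v) = f u + f v"
    "\<And>r v. v \<in> S \<Longrightarrow> f (r *\<^sub>R v) = r *\<^sub>R f v"
  shows "linear_between S T f"
  using assms unfolding linear_between_def by blast

lemma linear_between_0:
  assumes "linear_between S T f" "0 \<in> S"
  shows "f 0 = 0"
  using linear_betweenD(3)[OF assms, of 0] by simp

lemma linear_between_sum:
  assumes "linear_between S T f" "subspace S" "\<And>i. i \<in> I \<Longrightarrow> v i \<in> S"
  shows "f (\<Sum>i\<in>I. v i) = (\<Sum>i\<in>I. f (v i))"
  using assms(3)
proof (induction I rule: infinite_finite_induct)
  case (insert i I)
  then show ?case
    by (simp add: linear_betweenD(2)[OF assms(1)] subspace_sum[OF assms(2)])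
qed (simp_all add: linear_between_0[OF assms(1) subspace_0[OF assms(2)]])

lemma linear_between_diff:
  assumes "linear_between S T f" "subspace S" "u \<in> S" "v \<in> S"
  shows "f (u - v) = f u - f v"
proof -
  have "f (u + (- 1) *\<^sub>R v) = f u + (- 1) *\<^sub>R f v"
    using linear_betweenD(2,3)[OF assms(1)] subspace_scale[OF assms(2)] assms(3,4) by metis
  then show ?thesis by simp
qed

context manifold
begin

lemma velocity_tangent: "velocity A a X \<Longrightarrow> X \<in> tangent_space A (a 0)"
  unfolding velocity_def by blast

lemma velocity_eventually: "velocity A a X \<Longrightarrow> \<forall>\<^sub>F x in nhds (a 0). P x \<Longrightarrow> \<forall>\<^sub>F t in nhds 0. P (a t)"
  unfolding velocity_def filterlim_iff by blast

lemma velocity_chart: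
  "velocity A a X \<Longrightarrow> (U, c) \<in> A \<Longrightarrow> a 0 \<in> U \<Longrightarrow> ((\<lambda>t. c (a t)) has_vector_derivative X (U, c)) (at 0)"
  unfolding velocity_def by blast

lemma has_vector_derivative_in_chart:
  assumes "(a \<longlongrightarrow> a 0) (nhds 0)" "(U, c) \<in> A" "a 0 \<in> U"
    and "((\<lambda>t. c (a t)) has_vector_derivative v) (at 0)" "msmooth (a 0) f"
  shows "((\<lambda>t. f (a t)) has_vector_derivative
    frechet_derivative (\<lambda>y. f (inv_into U c y)) (at (c (a 0))) v) (at 0)"
proof (rule has_vector_derivative_cong_nhds)
  show "((\<lambda>t. f (inv_into U c (c (a t)))) has_vector_derivative
      frechet_derivative (\<lambda>y. f (inv_into U c y)) (at (c (a 0))) v) (at 0)"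
    by (rule has_vector_derivative_compose[OF assms(4) chart_has_derivative[OF assms(5,2,3)]])
  have "\<forall>\<^sub>F t in nhds 0. a t \<in> U"
    using assms(1) eventually_nhds_in_open[OF chart_open[OF assms(2)] assms(3)]
    unfolding filterlim_iff by blast
  then show "\<forall>\<^sub>F t in nhds 0. f (inv_into U c (c (a t))) = f (a t)"
    by eventually_elim (simp add: chart_inv[OF assms(2)])
qed

lemma velocityI:
  assumes "X \<in> tangent_space A (a 0)" "(a \<longlongrightarrow> a 0) (nhds 0)" "(U, c) \<in> A" "a 0 \<in> U"
    and "((\<lambda>t. c (a t)) has_vector_derivative X (U, c)) (at 0)"
  shows "velocity A a X"
  unfolding velocity_def
proof (intro conjI assms(1,2) ballI, clarify)
  fix W d assume W: "(W, d) \<in> A" "a 0 \<in> W"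
  from has_vector_derivative_in_chart[OF assms(2-5) msmooth_coord[OF W]]
  show "((\<lambda>t. d (a t)) has_vector_derivative X (W, d)) (at 0)"
    by (simp add: tangent_eq[OF assms(1,3) W(1) assms(4) W(2)])
qed

text \<open>The coordinate line in a chart works; it is a curve in the chart only for small times.\<close>

lemma velocity_exists:
  assumes "X \<in> tangent_space A p"
  obtains a where "a 0 = p" "velocity A a X"
proof -
  obtain U c where U: "(U, c) \<in> A" "p \<in> U" using ex_chart by blast
  define a where "a t = inv_into U c (c p + t *\<^sub>R X (U, c))" for t
  have a0: "a 0 = p" by (simp add: a_def chart_inv[OF U])
  have lin: "((\<lambda>t. c p + t *\<^sub>R X (U, c)) has_vector_derivative X (U, c)) (at 0)"
    by (auto intro!: derivative_eq_intros)
  have "((\<lambda>t. c p + t *\<^sub>R X (U, c)) \<longlongrightarrow> c p + 0 *\<^sub>R X (U, c)) (nhds 0)"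
    by (intro tendsto_intros filterlim_ident)
  then have lim: "((\<lambda>t. c p + t *\<^sub>R X (U, c)) \<longlongrightarrow> c p) (nhds 0)" by simp
  have cont: "(a \<longlongrightarrow> a 0) (nhds 0)"
    unfolding a0 filterlim_iff
  proof (intro allI impI)
    fix P assume "eventually P (nhds p)"
    then have "\<forall>\<^sub>F y in nhds (c p). P (inv_into U c y)" using nhds_chart[OF U, of P] by blast
    with lim show "\<forall>\<^sub>F t in nhds 0. P (a t)" unfolding filterlim_iff a_def by blast
  qed
  have "\<forall>\<^sub>F t in nhds 0. c p + t *\<^sub>R X (U, c) \<in> c ` U"
    using lim eventually_nhds_in_open[OF chart_open_image[OF U(1)], of "c p"] U(2)
    unfolding filterlim_iff by blast
  then have "\<forall>\<^sub>F t in nhds 0. c p + t *\<^sub>R X (U, c) = c (a t)"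
    by eventually_elim (simp add: a_def f_inv_into_f)
  from has_vector_derivative_cong_nhds[OF lin this]
  have "velocity A a X" using velocityI[OF _ cont U(1)] assms a0 U(2) by simp
  with a0 show thesis by (rule that)
qed

lemma velocity_fun:
  assumes "velocity A a X" "msmooth (a 0) f"
  shows "((\<lambda>t. f (a t)) has_vector_derivative dvec A f (a 0) X) (at 0)"
proof -
  obtain U c where U: "chart_at A (a 0) = (U, c)" "(U, c) \<in> A" "a 0 \<in> U" by (rule chart_at)
  have "(a \<longlongrightarrow> a 0) (nhds 0)" using assms(1) by (simp add: velocity_def)
  from has_vector_derivative_in_chart[OF this U(2,3) velocity_chart[OF assms(1) U(2,3)] assms(2)]
  show ?thesis by (simp add: dvec_def U(1) o_def)
qed

lemma dvec_eqI:
  assumes "velocity A a X" "msmooth (a 0) f" "((\<lambda>t. f (a t)) has_vector_derivative v) (at 0)"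
  shows "dvec A f (a 0) X = v"
  using vector_derivative_unique_at[OF velocity_fun[OF assms(1,2)] assms(3)] .

lemma dvec_chart:
  assumes "X \<in> tangent_space A p" "msmooth p f" "(U, c) \<in> A" "p \<in> U"
  shows "dvec A f p X = frechet_derivative (\<lambda>y. f (inv_into U c y)) (at (c p)) (X (U, c))"
proof -
  obtain a where a: "a 0 = p" "velocity A a X" using velocity_exists[OF assms(1)] .
  have "(a \<longlongrightarrow> a 0) (nhds 0)" using a(2) by (simp add: velocity_def)
  from has_vector_derivative_in_chart[OF this assms(3) _ velocity_chart[OF a(2) assms(3)]] a assms
  show ?thesis using dvec_eqI[OF a(2)] by metis
qed

lemma dvec_const: "X \<in> tangent_space A p \<Longrightarrow> dvec A (\<lambda>_. k) p X = 0"
  by (elim velocity_exists) (auto dest: dvec_eqI[OF _ msmooth_const has_vector_derivative_const])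

lemma dvec_cong:
  assumes "X \<in> tangent_space A p" "msmooth p f" "\<forall>\<^sub>F x in nhds p. f x = g x"
  shows "dvec A g p X = dvec A f p X"
proof -
  obtain a where a: "a 0 = p" "velocity A a X" using velocity_exists[OF assms(1)] .
  have "\<forall>\<^sub>F t in nhds 0. f (a t) = g (a t)"
    using velocity_eventually[OF a(2), of "\<lambda>x. f x = g x"] assms(3) a(1) by simp
  from has_vector_derivative_cong_nhds[OF velocity_fun[OF a(2)] this] a assms
  show ?thesis using dvec_eqI[OF a(2)] msmooth_cong[OF assms(3,2)] by simp
qed

lemma dvec_add:
  assumes "X \<in> tangent_space A p" "msmooth p f" "msmooth p g"
  shows "dvec A (\<lambda>x. f x + g x) p X = dvec A f p X + dvec A g p X"
proof -
  obtain a where a: "a 0 = p" "velocity A a X" using velocity_exists[OF assms(1)] .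
  show ?thesis
    using dvec_eqI[OF a(2) _ has_vector_derivative_add[OF velocity_fun[OF a(2), of f] velocity_fun[OF a(2), of g]]]
      assms(2,3) msmooth_add[OF assms(2,3)] unfolding a(1) by simp
qed

lemma dvec_scaleR:
  fixes f :: "'a \<Rightarrow> real"
  assumes "X \<in> tangent_space A p" "msmooth p f" "msmooth p g"
  shows "dvec A (\<lambda>x. f x *\<^sub>R g x) p X = dvec A f p X *\<^sub>R g p + f p *\<^sub>R dvec A g p X"
proof -
  obtain a where a: "a 0 = p" "velocity A a X" using velocity_exists[OF assms(1)] .
  have f: "((\<lambda>t. f (a t)) has_real_derivative dvec A f (a 0) X) (at 0)"
    using velocity_fun[OF a(2)] assms(2)
    by (simp add: a(1) has_real_derivative_iff_has_vector_derivative)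
  have g: "((\<lambda>t. g (a t)) has_vector_derivative dvec A g (a 0) X) (at 0)"
    using velocity_fun[OF a(2)] assms(3) by (simp add: a(1))
  show ?thesis
    using dvec_eqI[OF a(2) _ has_vector_derivative_scaleR[OF f g]] msmooth_scaleR[OF assms(2,3)]
    unfolding a(1) by (simp add: add.commute)
qed

lemma dvec_bounded_linear:
  assumes "X \<in> tangent_space A p" "msmooth p f" "bounded_linear L"
  shows "dvec A (\<lambda>x. L (f x)) p X = L (dvec A f p X)"
proof -
  obtain a where a: "a 0 = p" "velocity A a X" using velocity_exists[OF assms(1)] .
  show ?thesis
    using dvec_eqI[OF a(2) _ bounded_linear.has_vector_derivative[OF assms(3) velocity_fun[OF a(2), of f]]]
      assms(2) msmooth_bounded_linear[OF assms(3,2)] unfolding a(1) by simp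
qed

lemma dvec_sum:
  assumes "X \<in> tangent_space A p" "\<And>i. i \<in> I \<Longrightarrow> msmooth p (f i)"
  shows "dvec A (\<lambda>x. \<Sum>i\<in>I. f i x) p X = (\<Sum>i\<in>I. dvec A (f i) p X)"
  using assms(2)
  by (induction I rule: infinite_finite_induct)
     (simp_all add: dvec_const[OF assms(1)] dvec_add[OF assms(1)] msmooth_sum)

lemma tangentI:
  assumes "\<And>U c W d. (U, c) \<in> A \<Longrightarrow> (W, d) \<in> A \<Longrightarrow> p \<in> U \<Longrightarrow> p \<in> W \<Longrightarrow>
      X (W, d) = frechet_derivative (\<lambda>y. d (inv_into U c y)) (at (c p)) (X (U, c))"
    and "\<And>U c. \<not> ((U, c) \<in> A \<and> p \<in> U) \<Longrightarrow> X (U, c) = 0"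
  shows "X \<in> tangent_space A p"
  unfolding tangent_space_def
proof (intro CollectI conjI ballI)
  fix C assume C: "C \<in> A"
  obtain U c where Uc: "C = (U, c)" by (metis surj_pair)
  show "case C of (U, c) \<Rightarrow> \<forall>(W, d)\<in>A. p \<in> U \<and> p \<in> W \<longrightarrow>
      X (W, d) = frechet_derivative (d \<circ> inv_into U c) (at (c p)) (X (U, c))"
    unfolding Uc prod.case
  proof
    fix D assume D: "D \<in> A"
    obtain W d where Wd: "D = (W, d)" by (metis surj_pair)
    show "case D of (W, d) \<Rightarrow> p \<in> U \<and> p \<in> W \<longrightarrow>
        X (W, d) = frechet_derivative (d \<circ> inv_into U c) (at (c p)) (X (U, c))"
      unfolding Wd prod.case o_def
      by (intro impI, elim conjE) (rule assms(1)[OF C[unfolded Uc] D[unfolded Wd]])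
  qed
qed (use assms(2) in blast)

lemma tangent_outside:
  "X \<in> tangent_space A p \<Longrightarrow> \<not> ((U, c) \<in> A \<and> p \<in> U) \<Longrightarrow> X (U, c) = 0"
  unfolding tangent_space_def by simp

lemma subspace_tangent_space: "subspace (tangent_space A p)"
proof -
  have lin: "linear (frechet_derivative (\<lambda>y. d (inv_into U c y)) (at (c p)))"
    if "(U, c) \<in> A" "(W, d) \<in> A" "p \<in> U" "p \<in> W" for U c W d
    using has_derivative_linear[OF smooth_at_has_derivative[OF transition_smooth[OF that]]] .
  show ?thesis
  proof (rule subspaceI)
    show "0 \<in> tangent_space A p"
      by (rule tangentI) (simp_all add: linear_0[OF lin])
  next
    fix X Y assume XY: "X \<in> tangent_space A p" "Y \<in> tangent_space A p"
    show "X + Y \<in> tangent_space A p"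
    proof (rule tangentI)
      fix U c W d assume UW: "(U, c) \<in> A" "(W, d) \<in> A" "p \<in> U" "p \<in> W"
      show "(X + Y) (W, d) = frechet_derivative (\<lambda>y. d (inv_into U c y)) (at (c p)) ((X + Y) (U, c))"
        using tangent_eq[OF XY(1) UW] tangent_eq[OF XY(2) UW] by (simp add: linear_add[OF lin[OF UW]])
    qed (simp add: tangent_outside[OF XY(1)] tangent_outside[OF XY(2)])
  next
    fix X and r :: real assume X: "X \<in> tangent_space A p"
    show "r *\<^sub>R X \<in> tangent_space A p"
    proof (rule tangentI)
      fix U c W d assume UW: "(U, c) \<in> A" "(W, d) \<in> A" "p \<in> U" "p \<in> W"
      show "(r *\<^sub>R X) (W, d) = frechet_derivative (\<lambda>y. d (inv_into U c y)) (at (c p)) ((r *\<^sub>R X) (U, c))"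
        using tangent_eq[OF X UW] by (simp add: linear_scale[OF lin[OF UW]])
    qed (simp add: tangent_outside[OF X])
  qed
qed

lemma dvec_linear:
  assumes "msmooth p f"
  shows "linear_between (tangent_space A p) UNIV (dvec A f p)"
proof -
  obtain U c where U: "chart_at A p = (U, c)" "(U, c) \<in> A" "p \<in> U" by (rule chart_at)
  have "linear (frechet_derivative (\<lambda>y. f (inv_into U c y)) (at (c p)))"
    using has_derivative_linear[OF chart_has_derivative[OF assms U(2,3)]] .
  then show ?thesis
    unfolding dvec_def U(1) by (intro linear_betweenI) (simp_all add: o_def linear_add linear_scale)
qed

lemma coord_vector:
  assumes "(U, c) \<in> A" "p \<in> U"
  shows coord_vector_tangent: "coord_vector A (U, c) e p \<in> tangent_space A p"
    and coord_vector_chart: "coord_vector A (U, c) e p (U, c) = e"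
proof -
  have "((\<lambda>y. c (inv_into U c y)) has_derivative (\<lambda>v. v)) (at (c p))"
    by (rule has_derivative_transform_eventually_nhds[OF has_derivative_ident])
       (use eventually_nhds_in_open[OF chart_open_image[OF assms(1)], of "c p"] assms(2) in
        \<open>auto elim!: eventually_mono simp: f_inv_into_f\<close>)
  from frechet_derivative_eq[OF this] show "coord_vector A (U, c) e p (U, c) = e"
    using assms by (simp add: coord_vector_def o_def)
  show "coord_vector A (U, c) e p \<in> tangent_space A p"
  proof (rule tangentI)
    fix U' c' W d assume W: "(U', c') \<in> A" "(W, d) \<in> A" "p \<in> U'" "p \<in> W"
    from chart_chain[OF msmooth_coord[OF W(2,4)] assms(1) W(1) assms(2) W(3)]
    show "coord_vector A (U, c) e p (W, d) =
        frechet_derivative (\<lambda>y. d (inv_into U' c' y)) (at (c' p)) (coord_vector A (U, c) e p (U', c'))"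
      using W by (simp add: coord_vector_def o_def)
  qed (auto simp: coord_vector_def)
qed

text \<open>In the chart in question this is a directional derivative in a constant direction.\<close>

lemma msmooth_dvec_coord_vector:
  assumes "(U, c) \<in> A" "p \<in> U" "msmooth p f"
  shows "msmooth p (\<lambda>x. dvec A f x (coord_vector A (U, c) e x))"
proof (rule msmooth_cong)
  show "msmooth p (\<lambda>x. frechet_derivative (\<lambda>y. f (inv_into U c y)) (at (c x)) e)"
    by (rule msmooth_compose[OF msmooth_coord[OF assms(1,2)]
        smooth_at_frechet_derivative[OF msmoothD[OF assms(3,1,2)]]])
  show "\<forall>\<^sub>F x in nhds p. frechet_derivative (\<lambda>y. f (inv_into U c y)) (at (c x)) e =
      dvec A f x (coord_vector A (U, c) e x)"
    using eventually_msmooth[OF assms(3)] eventually_nhds_in_open[OF chart_open[OF assms(1)] assms(2)]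
    by eventually_elim (simp add: dvec_chart[OF coord_vector_tangent[OF assms(1)] _ assms(1)]
        coord_vector_chart[OF assms(1)])
qed

lemma tangent_expand:
  assumes "X \<in> tangent_space A p" "(U, c) \<in> A" "p \<in> U"
  shows "X = (\<Sum>b\<in>fbasis. fcoord b (X (U, c)) *\<^sub>R coord_vector A (U, c) b p)"
proof (rule tangent_eqI[OF assms(1) _ assms(2,3)])
  show "(\<Sum>b\<in>fbasis. fcoord b (X (U, c)) *\<^sub>R coord_vector A (U, c) b p) \<in> tangent_space A p"
    by (intro subspace_sum[OF subspace_tangent_space] subspace_scale[OF subspace_tangent_space]
        coord_vector_tangent assms(2,3))
  have "(\<Sum>b\<in>B. fcoord b (X (U, c)) *\<^sub>R coord_vector A (U, c) b p) (U, c) =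
      (\<Sum>b\<in>B. fcoord b (X (U, c)) *\<^sub>R b)" for B
    by (induction B rule: infinite_finite_induct) (simp_all add: coord_vector_chart[OF assms(2,3)])
  then show "X (U, c) = (\<Sum>b\<in>fbasis. fcoord b (X (U, c)) *\<^sub>R coord_vector A (U, c) b p) (U, c)"
    by (simp add: fcoord_sum)
qed

lemma velocity_unique:
  assumes "velocity A a X" "velocity A b Y" "\<forall>\<^sub>F t in nhds 0. a t = b t"
  shows "X = Y"
proof -
  have eq: "a 0 = b 0" using eventually_nhds_x_imp_x[OF assms(3)] .
  obtain U c where U: "(U, c) \<in> A" "a 0 \<in> U" using ex_chart by blast
  have "\<forall>\<^sub>F t in nhds 0. c (a t) = c (b t)" using assms(3) by eventually_elim simp
  from has_vector_derivative_cong_nhds[OF velocity_chart[OF assms(1) U] this]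
  have "X (U, c) = Y (U, c)"
    using velocity_chart[OF assms(2) U(1)] U(2) eq vector_derivative_unique_at by metis
  with tangent_eqI[OF velocity_tangent[OF assms(1)] _ U] velocity_tangent[OF assms(2)] eq
  show ?thesis by simp
qed

end

section \<open>Smooth maps between manifolds\<close>

locale manifold_map = A: manifold A + B: manifold B
  for A :: "('a::{t2_space, second_countable_topology}, 'e::fin_dim_normed) chart set"
    and B :: "('b::{t2_space, second_countable_topology}, 'f::fin_dim_normed) chart set" +
  fixes F :: "'a \<Rightarrow> 'b"
  assumes smooth: "smooth_map A B F"
begin

lemma tendsto: "(F \<longlongrightarrow> F p) (nhds p)"
  using smooth unfolding smooth_map_def
  by (simp add: continuous_on_eq_continuous_at continuous_at tendsto_at_iff_tendsto_nhds)

lemma open_vimage: "open S \<Longrightarrow> open (F -` S)"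
  using smooth unfolding smooth_map_def by (simp add: continuous_on_open_vimage)

lemma eventually_map: "\<forall>\<^sub>F y in nhds (F p). P y \<Longrightarrow> \<forall>\<^sub>F x in nhds p. P (F x)"
  using tendsto unfolding filterlim_iff by blast

lemma msmooth_coord:
  assumes "(W, d) \<in> B" "F p \<in> W"
  shows "A.msmooth p (\<lambda>x. d (F x))"
  unfolding A.msmooth_def
proof safe
  fix U c assume U: "(U, c) \<in> A" "p \<in> U"
  have op: "open (c ` (U \<inter> F -` W))"
    by (rule A.chart_open_image_Int[OF U(1) open_vimage[OF B.chart_open[OF assms(1)]]])
  have "smooth_on (c ` (U \<inter> F -` W)) (d \<circ> F \<circ> inv_into U c)"
    using smooth U(1) assms(1) unfolding smooth_map_def by blast
  then show "smooth_at (c p) (\<lambda>y. d (F (inv_into U c y)))"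
    using U assms(2) by (auto simp: smooth_on_iff[OF op] o_def)
qed

lemma msmooth_compose:
  assumes "B.msmooth (F p) f"
  shows "A.msmooth p (\<lambda>x. f (F x))"
proof -
  obtain W d where W: "(W, d) \<in> B" "F p \<in> W" using B.ex_chart by blast
  have "A.msmooth p (\<lambda>x. f (inv_into W d (d (F x))))"
    by (rule A.msmooth_compose[OF msmooth_coord[OF W] B.msmoothD[OF assms W]])
  moreover have "\<forall>\<^sub>F x in nhds p. f (inv_into W d (d (F x))) = f (F x)"
    using eventually_map[OF eventually_nhds_in_open[OF B.chart_open[OF W(1)] W(2)]]
    by eventually_elim (simp add: B.chart_inv[OF W(1)])
  ultimately show ?thesis by (rule A.msmooth_cong[rotated])
qed

lemma differential_chart:
  "(W, d) \<in> B \<Longrightarrow> F p \<in> W \<Longrightarrow> differential A B F p X (W, d) = dvec A (\<lambda>x. d (F x)) p X"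
  unfolding differential_def dvec_def by (simp add: o_def)

lemma differential_tangent:
  assumes "X \<in> tangent_space A p"
  shows "differential A B F p X \<in> tangent_space B (F p)"
proof -
  obtain a where a: "a 0 = p" "velocity A a X" using A.velocity_exists[OF assms] .
  have "differential A B F p X (W', d') =
      frechet_derivative (\<lambda>y. d' (inv_into W d y)) (at (d (F p))) (differential A B F p X (W, d))"
    if W: "(W, d) \<in> B" "(W', d') \<in> B" "F p \<in> W" "F p \<in> W'" for W d W' d'
  proof -
    have "((\<lambda>t. d (F (a t))) has_vector_derivative dvec A (\<lambda>x. d (F x)) p X) (at 0)"
      using A.velocity_fun[OF a(2)] msmooth_coord[OF W(1,3)] a(1) by simp
    moreover have "((\<lambda>t. F (a t)) \<longlongrightarrow> F (a 0)) (nhds 0)"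
      using a by (auto intro!: filterlim_compose[OF tendsto] simp: velocity_def)
    ultimately have "((\<lambda>t. d' (F (a t))) has_vector_derivative
        frechet_derivative (\<lambda>y. d' (inv_into W d y)) (at (d (F p))) (dvec A (\<lambda>x. d (F x)) p X)) (at 0)"
      using B.has_vector_derivative_in_chart[where a = "\<lambda>t. F (a t)", OF _ W(1) _ _ B.msmooth_coord[OF W(2)]]
        W a(1) by simp
    from A.dvec_eqI[OF a(2) _ this] show ?thesis
      using msmooth_coord[OF W(2,4)] a(1) W by (simp add: differential_chart)
  qed
  then show ?thesis by (rule B.tangentI) (auto simp: differential_def)
qed

lemma velocity_map:
  assumes "velocity A a X"
  shows "velocity B (\<lambda>t. F (a t)) (differential A B F (a 0) X)"
proof -
  obtain W d where W: "(W, d) \<in> B" "F (a 0) \<in> W" using B.ex_chart by blast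
  show ?thesis
  proof (rule B.velocityI[where a = "\<lambda>t. F (a t)", OF _ _ W])
    show "differential A B F (a 0) X \<in> tangent_space B (F (a 0))"
      by (rule differential_tangent[OF A.velocity_tangent[OF assms]])
    show "((\<lambda>t. F (a t)) \<longlongrightarrow> F (a 0)) (nhds 0)"
      using assms by (auto intro!: filterlim_compose[OF tendsto] simp: velocity_def)
    show "((\<lambda>t. d (F (a t))) has_vector_derivative differential A B F (a 0) X (W, d)) (at 0)"
      unfolding differential_chart[OF W] by (rule A.velocity_fun[OF assms msmooth_coord[OF W]])
  qed
qed

lemma dvec_compose:
  assumes "X \<in> tangent_space A p" "B.msmooth (F p) f"
  shows "dvec A (\<lambda>x. f (F x)) p X = dvec B f (F p) (differential A B F p X)"
proof -
  obtain a where a: "a 0 = p" "velocity A a X" using A.velocity_exists[OF assms(1)] .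
  from A.dvec_eqI[OF a(2) _ B.velocity_fun[OF velocity_map[OF a(2)], of f]] assms(2) msmooth_compose[OF assms(2)]
  show ?thesis unfolding a(1) by simp
qed

lemma differential_linear:
  "linear_between (tangent_space A p) (tangent_space B (F p)) (differential A B F p)"
proof (rule linear_betweenI)
  fix X Y assume XY: "X \<in> tangent_space A p" "Y \<in> tangent_space A p"
  obtain W d where W: "(W, d) \<in> B" "F p \<in> W" using B.ex_chart by blast
  note lin = A.dvec_linear[OF msmooth_coord[OF W]]
  show "differential A B F p (X + Y) = differential A B F p X + differential A B F p Y"
    by (rule B.tangent_eqI[OF _ _ W])
       (simp_all add: differential_tangent XY subspace_add A.subspace_tangent_space B.subspace_tangent_space
         differential_chart[OF W] linear_betweenD[OF lin])
next
  fix X r assume X: "X \<in> tangent_space A p"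
  obtain W d where W: "(W, d) \<in> B" "F p \<in> W" using B.ex_chart by blast
  note lin = A.dvec_linear[OF msmooth_coord[OF W]]
  show "differential A B F p (r *\<^sub>R X) = r *\<^sub>R differential A B F p X"
    by (rule B.tangent_eqI[OF _ _ W])
       (simp_all add: differential_tangent X subspace_scale A.subspace_tangent_space B.subspace_tangent_space
         differential_chart[OF W] linear_betweenD[OF lin])
qed (rule differential_tangent)

end

section \<open>Vector bundles\<close>

locale vbundle_over = manifold A
  for A :: "('a::{t2_space, second_countable_topology}, 'e::fin_dim_normed) chart set" +
  fixes V :: "('a, 'v::real_vector, 'f::fin_dim_normed) vbundle"
  assumes vector_bundle: "vector_bundle A V"
begin

abbreviation tinv :: "('a \<Rightarrow> 'v \<Rightarrow> 'f) \<Rightarrow> 'a \<Rightarrow> 'f \<Rightarrow> 'v"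
  where "tinv \<psi> x \<equiv> inv_into (fibre V x) (\<psi> x)"

lemma subspace_fibre: "subspace (fibre V x)"
  using vector_bundle unfolding vector_bundle_def by blast

lemma ex_triv: "\<exists>U \<psi>. (U, \<psi>) \<in> trivs V \<and> p \<in> U"
proof -
  have "p \<in> (\<Union>(U, \<psi>)\<in>trivs V. U)" using vector_bundle unfolding vector_bundle_def by simp
  then show ?thesis by auto
qed

lemma triv:
  assumes "(U, \<psi>) \<in> trivs V"
  shows triv_open: "open U"
    and triv_linear: "x \<in> U \<Longrightarrow> linear_between (fibre V x) UNIV (\<psi> x)"
    and triv_bij: "x \<in> U \<Longrightarrow> bij_betw (\<psi> x) (fibre V x) UNIV"
proof -
  have "\<forall>(U, \<psi>)\<in>trivs V. open U \<and>
      (\<forall>x\<in>U. linear_between (fibre V x) UNIV (\<psi> x) \<and> bij_betw (\<psi> x) (fibre V x) UNIV)"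
    using vector_bundle unfolding vector_bundle_def by blast
  from bspec[OF this assms] show "open U"
    "x \<in> U \<Longrightarrow> linear_between (fibre V x) UNIV (\<psi> x)"
    "x \<in> U \<Longrightarrow> bij_betw (\<psi> x) (fibre V x) UNIV" by simp_all
qed

lemma triv_smooth:
  assumes "(U, \<psi>) \<in> trivs V" "(W, \<theta>) \<in> trivs V" "p \<in> U" "p \<in> W"
  shows "msmooth p (\<lambda>x. \<theta> x (tinv \<psi> x e))"
proof -
  have "\<forall>(U, \<psi>)\<in>trivs V. \<forall>(W, \<theta>)\<in>trivs V. \<forall>e.
      smooth_fun_on A (U \<inter> W) (\<lambda>x. \<theta> x (inv_into (fibre V x) (\<psi> x) e))"
    using vector_bundle unfolding vector_bundle_def by blast
  from bspec[OF this assms(1), unfolded prod.case, THEN bspec[OF _ assms(2)], unfolded prod.case]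
  have "smooth_fun_on A (U \<inter> W) (\<lambda>x. \<theta> x (tinv \<psi> x e))" by blast
  then show ?thesis
    using smooth_fun_on_iff[OF open_Int[OF triv_open[OF assms(1)] triv_open[OF assms(2)]]] assms(3,4)
    by blast
qed

lemma tinv:
  assumes "(U, \<psi>) \<in> trivs V" "x \<in> U"
  shows tinv_fibre: "tinv \<psi> x e \<in> fibre V x"
    and triv_tinv: "\<psi> x (tinv \<psi> x e) = e"
    and tinv_triv: "v \<in> fibre V x \<Longrightarrow> tinv \<psi> x (\<psi> x v) = v"
proof -
  have b: "bij_betw (\<psi> x) (fibre V x) UNIV" by (rule triv_bij[OF assms])
  then have im: "\<psi> x ` fibre V x = UNIV" by (simp add: bij_betw_def)
  show "tinv \<psi> x e \<in> fibre V x" by (rule inv_into_into) (simp add: im)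
  show "\<psi> x (tinv \<psi> x e) = e" by (rule f_inv_into_f) (simp add: im)
  show "v \<in> fibre V x \<Longrightarrow> tinv \<psi> x (\<psi> x v) = v"
    using b by (intro inv_into_f_f) (auto simp: bij_betw_def)
qed

lemma triv_inject:
  assumes "(U, \<psi>) \<in> trivs V" "x \<in> U" "u \<in> fibre V x" "v \<in> fibre V x" "\<psi> x u = \<psi> x v"
  shows "u = v"
  by (rule box_equals[OF arg_cong[OF assms(5)] tinv_triv[OF assms(1,2,3)] tinv_triv[OF assms(1,2,4)]])

lemma tinv_linear:
  assumes "(U, \<psi>) \<in> trivs V" "x \<in> U"
  shows "linear_between UNIV (fibre V x) (tinv \<psi> x)"
proof (rule linear_betweenI)
  note lin = linear_betweenD[OF triv_linear[OF assms]]
  note sub = subspace_add[OF subspace_fibre] subspace_scale[OF subspace_fibre] tinv_fibre[OF assms]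
  show "tinv \<psi> x e \<in> fibre V x" for e by (rule tinv_fibre[OF assms])
  show "tinv \<psi> x (e + e') = tinv \<psi> x e + tinv \<psi> x e'" for e e'
    by (rule triv_inject[OF assms]) (simp_all add: sub lin(2) triv_tinv[OF assms])
  show "tinv \<psi> x (r *\<^sub>R e) = r *\<^sub>R tinv \<psi> x e" for r e
    by (rule triv_inject[OF assms]) (simp_all add: sub lin(3) triv_tinv[OF assms])
qed

lemma linear_between_expand:
  assumes "linear_between (fibre V x) T L" "(U, \<psi>) \<in> trivs V" "x \<in> U" "v \<in> fibre V x"
  shows "L v = (\<Sum>b\<in>fbasis. fcoord b (\<psi> x v) *\<^sub>R L (tinv \<psi> x b))"
proof -
  note lin = linear_betweenD[OF tinv_linear[OF assms(2,3)]]
  have "v = tinv \<psi> x (\<Sum>b\<in>fbasis. fcoord b (\<psi> x v) *\<^sub>R b)"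
    by (simp add: fcoord_sum tinv_triv[OF assms(2-4)])
  also have "\<dots> = (\<Sum>b\<in>fbasis. tinv \<psi> x (fcoord b (\<psi> x v) *\<^sub>R b))"
    by (rule linear_between_sum[OF tinv_linear[OF assms(2,3)]]) auto
  also have "\<dots> = (\<Sum>b\<in>fbasis. fcoord b (\<psi> x v) *\<^sub>R tinv \<psi> x b)"
    by (simp add: lin(3))
  finally have "L v = L (\<Sum>b\<in>fbasis. fcoord b (\<psi> x v) *\<^sub>R tinv \<psi> x b)" by simp
  also have "\<dots> = (\<Sum>b\<in>fbasis. L (fcoord b (\<psi> x v) *\<^sub>R tinv \<psi> x b))"
    by (rule linear_between_sum[OF assms(1) subspace_fibre])
       (simp add: subspace_scale[OF subspace_fibre] tinv_fibre[OF assms(2,3)])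
  also have "\<dots> = (\<Sum>b\<in>fbasis. fcoord b (\<psi> x v) *\<^sub>R L (tinv \<psi> x b))"
    by (simp add: linear_betweenD(3)[OF assms(1)] tinv_fibre[OF assms(2,3)])
  finally show ?thesis .
qed

text \<open>Only the transition functions applied to constant vectors are smooth by definition; a varying vector
  is expanded in the basis of the model fibre.\<close>

lemma msmooth_change_triv:
  assumes "(U, \<psi>) \<in> trivs V" "(W, \<theta>) \<in> trivs V" "p \<in> U" "p \<in> W"
    and "\<forall>\<^sub>F x in nhds p. \<xi> x \<in> fibre V x" "msmooth p (\<lambda>x. \<psi> x (\<xi> x))"
  shows "msmooth p (\<lambda>x. \<theta> x (\<xi> x))"
proof (rule msmooth_cong)
  show "msmooth p (\<lambda>x. \<Sum>b\<in>fbasis. fcoord b (\<psi> x (\<xi> x)) *\<^sub>R \<theta> x (tinv \<psi> x b))"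
    by (intro msmooth_sum msmooth_scaleR msmooth_bounded_linear[OF bounded_linear_fcoord assms(6)]
        triv_smooth[OF assms(1-4)])
  show "\<forall>\<^sub>F x in nhds p. (\<Sum>b\<in>fbasis. fcoord b (\<psi> x (\<xi> x)) *\<^sub>R \<theta> x (tinv \<psi> x b)) = \<theta> x (\<xi> x)"
    using assms(5) eventually_nhds_in_open[OF triv_open[OF assms(1)] assms(3)]
      eventually_nhds_in_open[OF triv_open[OF assms(2)] assms(4)]
    by eventually_elim (rule linear_between_expand[OF triv_linear[OF assms(2)] assms(1), symmetric])
qed

subsection \<open>Sections\<close>

lemma section_fibre: "\<xi> \<in> sections A V \<Longrightarrow> \<xi> x \<in> fibre V x"
  unfolding sections_def by blast

lemma section_msmooth:
  assumes "\<xi> \<in> sections A V" "(U, \<psi>) \<in> trivs V" "p \<in> U"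
  shows "msmooth p (\<lambda>x. \<psi> x (\<xi> x))"
proof -
  have "\<forall>(U, \<psi>)\<in>trivs V. smooth_fun_on A U (\<lambda>x. \<psi> x (\<xi> x))"
    using assms(1) unfolding sections_def by blast
  from bspec[OF this assms(2)] show ?thesis
    using assms(3) by (simp add: smooth_fun_on_iff[OF triv_open[OF assms(2)]])
qed

text \<open>Because transition functions are smooth, one trivialization around each point is enough.\<close>

lemma sectionI:
  assumes "\<And>x. \<xi> x \<in> fibre V x"
    and "\<And>p. \<exists>U \<psi>. (U, \<psi>) \<in> trivs V \<and> p \<in> U \<and> msmooth p (\<lambda>x. \<psi> x (\<xi> x))"
  shows "\<xi> \<in> sections A V"
  unfolding sections_def
proof (intro CollectI conjI allI ballI assms(1), clarify)
  fix U \<psi> assume U: "(U, \<psi>) \<in> trivs V"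
  show "smooth_fun_on A U (\<lambda>x. \<psi> x (\<xi> x))"
    unfolding smooth_fun_on_iff[OF triv_open[OF U]]
  proof
    fix p assume p: "p \<in> U"
    obtain W \<theta> where W: "(W, \<theta>) \<in> trivs V" "p \<in> W" "msmooth p (\<lambda>x. \<theta> x (\<xi> x))"
      using assms(2)[of p] by (elim exE conjE)
    show "msmooth p (\<lambda>x. \<psi> x (\<xi> x))"
      by (rule msmooth_change_triv[OF W(1) U W(2) p _ W(3)]) (simp add: assms(1))
  qed
qed

lemma triv_eventually:
  assumes "(U, \<psi>) \<in> trivs V" "p \<in> U"
  shows "\<forall>\<^sub>F x in nhds p. x \<in> U"
  by (rule eventually_nhds_in_open[OF triv_open[OF assms(1)] assms(2)])

lemma section_add:
  assumes "\<xi> \<in> sections A V" "\<eta> \<in> sections A V"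
  shows "(\<lambda>x. \<xi> x + \<eta> x) \<in> sections A V"
proof (rule sectionI)
  show "\<xi> x + \<eta> x \<in> fibre V x" for x
    by (rule subspace_add[OF subspace_fibre section_fibre[OF assms(1)] section_fibre[OF assms(2)]])
  fix p
  obtain U \<psi> where U: "(U, \<psi>) \<in> trivs V" "p \<in> U" using ex_triv by blast
  have "\<forall>\<^sub>F x in nhds p. \<psi> x (\<xi> x) + \<psi> x (\<eta> x) = \<psi> x (\<xi> x + \<eta> x)"
    using triv_eventually[OF U]
    by eventually_elim
       (simp add: linear_betweenD(2)[OF triv_linear[OF U(1)]] section_fibre assms)
  from msmooth_cong[OF this msmooth_add[OF section_msmooth[OF assms(1) U] section_msmooth[OF assms(2) U]]]
  show "\<exists>U \<psi>. (U, \<psi>) \<in> trivs V \<and> p \<in> U \<and> msmooth p (\<lambda>x. \<psi> x (\<xi> x + \<eta> x))"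
    using U by (intro exI conjI)
qed

lemma section_scaleR:
  fixes f :: "'a \<Rightarrow> real"
  assumes "\<And>x. msmooth x f" "\<xi> \<in> sections A V"
  shows "(\<lambda>x. f x *\<^sub>R \<xi> x) \<in> sections A V"
proof (rule sectionI)
  show "f x *\<^sub>R \<xi> x \<in> fibre V x" for x
    by (rule subspace_scale[OF subspace_fibre section_fibre[OF assms(2)]])
  fix p
  obtain U \<psi> where U: "(U, \<psi>) \<in> trivs V" "p \<in> U" using ex_triv by blast
  have "\<forall>\<^sub>F x in nhds p. f x *\<^sub>R \<psi> x (\<xi> x) = \<psi> x (f x *\<^sub>R \<xi> x)"
    using triv_eventually[OF U]
    by eventually_elim
       (simp add: linear_betweenD(3)[OF triv_linear[OF U(1)]] section_fibre assms)
  from msmooth_cong[OF this msmooth_scaleR[OF assms(1) section_msmooth[OF assms(2) U]]]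
  show "\<exists>U \<psi>. (U, \<psi>) \<in> trivs V \<and> p \<in> U \<and> msmooth p (\<lambda>x. \<psi> x (f x *\<^sub>R \<xi> x))"
    using U by (intro exI conjI)
qed

lemma section_0: "(\<lambda>x. 0) \<in> sections A V"
proof (rule sectionI)
  show "0 \<in> fibre V x" for x by (rule subspace_0[OF subspace_fibre])
  fix p
  obtain U \<psi> where U: "(U, \<psi>) \<in> trivs V" "p \<in> U" using ex_triv by blast
  have "\<forall>\<^sub>F x in nhds p. 0 = \<psi> x 0"
    using triv_eventually[OF U]
    by eventually_elim
       (simp add: linear_between_0[OF triv_linear[OF U(1)] subspace_0[OF subspace_fibre]])
  from msmooth_cong[OF this msmooth_const]
  show "\<exists>U \<psi>. (U, \<psi>) \<in> trivs V \<and> p \<in> U \<and> msmooth p (\<lambda>x. \<psi> x 0)"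
    using U by (intro exI conjI)
qed

lemma section_sum:
  assumes "\<And>i. i \<in> I \<Longrightarrow> \<xi> i \<in> sections A V"
  shows "(\<lambda>x. \<Sum>i\<in>I. \<xi> i x) \<in> sections A V"
  using assms
  by (induction I rule: infinite_finite_induct) (simp_all add: section_0 section_add)

text \<open>Local sections extend to global ones after multiplication by a bump function.\<close>

definition lsec :: "('a \<Rightarrow> 'v \<Rightarrow> 'f) \<Rightarrow> ('a \<Rightarrow> real) \<Rightarrow> 'f \<Rightarrow> 'a \<Rightarrow> 'v"
  where "lsec \<psi> h e x = h x *\<^sub>R tinv \<psi> x e"

lemma cutoff_msmooth:
  fixes h :: "'a \<Rightarrow> real"
  assumes "\<And>x. msmooth x h" "closed C" "C \<subseteq> U" "\<And>x. x \<notin> C \<Longrightarrow> h x = 0" "\<And>x. x \<in> U \<Longrightarrow> msmooth x w"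
  shows "msmooth x (\<lambda>x. h x *\<^sub>R w x)"
proof (cases "x \<in> C")
  case True
  then show ?thesis using assms by (intro msmooth_scaleR) auto
next
  case False
  then have "\<forall>\<^sub>F y in nhds x. y \<in> - C"
    using assms(2) by (intro eventually_nhds_in_open) auto
  then have "\<forall>\<^sub>F y in nhds x. 0 = h y *\<^sub>R w y" by eventually_elim (simp add: assms(4))
  from msmooth_cong[OF this msmooth_const] show ?thesis .
qed

lemma lsec_section:
  assumes "(U, \<psi>) \<in> trivs V" "\<And>x. msmooth x h" "closed C" "C \<subseteq> U" "\<And>x. x \<notin> C \<Longrightarrow> h x = 0"
  shows "lsec \<psi> h e \<in> sections A V"
proof (rule sectionI)
  show "lsec \<psi> h e x \<in> fibre V x" for x
    using assms(4,5) tinv_fibre[OF assms(1)] subspace_scale[OF subspace_fibre] subspace_0[OF subspace_fibre]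
    by (cases "x \<in> C") (auto simp: lsec_def)
  fix p
  show "\<exists>U \<psi>'. (U, \<psi>') \<in> trivs V \<and> p \<in> U \<and> msmooth p (\<lambda>x. \<psi>' x (lsec \<psi> h e x))"
  proof (cases "p \<in> C")
    case True
    then have p: "p \<in> U" using assms(4) by blast
    have "\<forall>\<^sub>F x in nhds p. h x *\<^sub>R e = \<psi> x (lsec \<psi> h e x)"
      using triv_eventually[OF assms(1) p]
      by eventually_elim
        (simp add: lsec_def linear_betweenD(3)[OF triv_linear[OF assms(1)]] tinv[OF assms(1)])
    from msmooth_cong[OF this msmooth_scaleR[OF assms(2) msmooth_const]] assms(1) p
    show ?thesis by blast
  next
    case False
    obtain W \<theta> where W: "(W, \<theta>) \<in> trivs V" "p \<in> W" using ex_triv by blast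
    have "\<forall>\<^sub>F y in nhds p. y \<in> - C"
      using assms(3) False by (intro eventually_nhds_in_open) auto
    then have "\<forall>\<^sub>F x in nhds p. 0 = \<theta> x (lsec \<psi> h e x)"
      using triv_eventually[OF W]
      by eventually_elim
         (simp add: lsec_def assms(5) linear_between_0[OF triv_linear[OF W(1)] subspace_0[OF subspace_fibre]])
    from msmooth_cong[OF this msmooth_const] W show ?thesis by blast
  qed
qed

lemma ex_frame:
  assumes "(U, \<psi>) \<in> trivs V" "p \<in> U"
  shows "\<exists>\<xi>. \<xi> \<in> sections A V \<and> (\<forall>\<^sub>F x in nhds p. \<xi> x = tinv \<psi> x e)"
proof -
  obtain h :: "'a \<Rightarrow> real" and W C where h: "\<And>x. msmooth x h" "open W" "p \<in> W" "\<And>x. x \<in> W \<Longrightarrow> h x = 1"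
    "closed C" "C \<subseteq> U" "\<And>x. x \<notin> C \<Longrightarrow> h x = 0"
    using manifold_bump[OF triv_open[OF assms(1)] assms(2)] by blast
  have "\<forall>\<^sub>F x in nhds p. lsec \<psi> h e x = tinv \<psi> x e"
    using eventually_nhds_in_open[OF h(2,3)]
    by eventually_elim (simp add: lsec_def h(4))
  with lsec_section[OF assms(1) h(1,5,6,7)] show ?thesis by blast
qed

text \<open>A global section that is constant near \<open>p\<close> in the trivialization \<open>\<psi>\<close>. Which one is chosen is
  immaterial, since connections will only see its germ at \<open>p\<close>.\<close>

definition frame :: "('a \<Rightarrow> 'v \<Rightarrow> 'f) \<Rightarrow> 'a \<Rightarrow> 'f \<Rightarrow> 'a \<Rightarrow> 'v"
  where "frame \<psi> p e = (SOME \<xi>. \<xi> \<in> sections A V \<and> (\<forall>\<^sub>F x in nhds p. \<xi> x = tinv \<psi> x e))"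

lemma frame:
  assumes "(U, \<psi>) \<in> trivs V" "p \<in> U"
  shows frame_section: "frame \<psi> p e \<in> sections A V"
    and frame_eventually: "\<forall>\<^sub>F x in nhds p. frame \<psi> p e x = tinv \<psi> x e"
  using someI_ex[OF ex_frame[OF assms, of e]] unfolding frame_def by auto

lemma ex_section_through:
  assumes "v \<in> fibre V p"
  shows "\<exists>\<xi>\<in>sections A V. \<xi> p = v"
proof -
  obtain U \<psi> where U: "(U, \<psi>) \<in> trivs V" "p \<in> U" using ex_triv by blast
  have "frame \<psi> p (\<psi> p v) p = v"
    using eventually_nhds_x_imp_x[OF frame_eventually[OF U]] tinv_triv[OF U assms] by metis
  with frame_section[OF U] show ?thesis by blast
qed

subsection \<open>One-forms\<close>

lemma one_form_linear:
  "\<omega> \<in> one_forms A V \<Longrightarrow> linear_between (tangent_space A x) (fibre V x) (\<omega> x)"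
  unfolding one_forms_def by blast

lemma one_form_outside: "\<omega> \<in> one_forms A V \<Longrightarrow> X \<notin> tangent_space A x \<Longrightarrow> \<omega> x X = 0"
  unfolding one_forms_def by blast

lemma one_form_fibre: "\<omega> \<in> one_forms A V \<Longrightarrow> \<omega> x X \<in> fibre V x"
  using linear_betweenD(1)[OF one_form_linear] one_form_outside subspace_0[OF subspace_fibre]
  by metis

lemma one_form_msmooth:
  assumes "\<omega> \<in> one_forms A V" "(U, c) \<in> A" "p \<in> U" "(W, \<psi>) \<in> trivs V" "p \<in> W"
  shows "msmooth p (\<lambda>x. \<psi> x (\<omega> x (coord_vector A (U, c) e x)))"
proof -
  have "\<forall>(U, c)\<in>A. \<forall>(W, \<psi>)\<in>trivs V. \<forall>e.
      smooth_fun_on A (U \<inter> W) (\<lambda>x. \<psi> x (\<omega> x (coord_vector A (U, c) e x)))"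
    using assms(1) unfolding one_forms_def by blast
  from bspec[OF this assms(2), unfolded prod.case, THEN bspec[OF _ assms(4)], unfolded prod.case]
  have "smooth_fun_on A (U \<inter> W) (\<lambda>x. \<psi> x (\<omega> x (coord_vector A (U, c) e x)))" by (rule spec)
  then show ?thesis
    using smooth_fun_on_iff[OF open_Int[OF chart_open[OF assms(2)] triv_open[OF assms(4)]]] assms(3,5)
    by blast
qed

text \<open>As for sections, one trivialization around each point suffices.\<close>

lemma one_formI:
  assumes "\<And>x. linear_between (tangent_space A x) (fibre V x) (\<omega> x)"
    and "\<And>x X. X \<notin> tangent_space A x \<Longrightarrow> \<omega> x X = 0"
    and "\<And>p. \<exists>W \<psi>. (W, \<psi>) \<in> trivs V \<and> p \<in> W \<and> (\<forall>U c e. (U, c) \<in> A \<longrightarrow> p \<in> U \<longrightarrow>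
      msmooth p (\<lambda>x. \<psi> x (\<omega> x (coord_vector A (U, c) e x))))"
  shows "\<omega> \<in> one_forms A V"
  unfolding one_forms_def
proof (intro CollectI conjI allI impI ballI assms(1,2), assumption, clarify)
  fix U c W \<psi> e assume U: "(U, c) \<in> A" and W: "(W, \<psi>) \<in> trivs V"
  show "smooth_fun_on A (U \<inter> W) (\<lambda>x. \<psi> x (\<omega> x (coord_vector A (U, c) e x)))"
    unfolding smooth_fun_on_iff[OF open_Int[OF chart_open[OF U] triv_open[OF W]]]
  proof
    fix p assume p: "p \<in> U \<inter> W"
    obtain W' \<theta> where W': "(W', \<theta>) \<in> trivs V" "p \<in> W'"
      "\<And>U c e. (U, c) \<in> A \<Longrightarrow> p \<in> U \<Longrightarrow> msmooth p (\<lambda>x. \<theta> x (\<omega> x (coord_vector A (U, c) e x)))"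
      using assms(3)[of p] by (elim exE conjE) blast
    show "msmooth p (\<lambda>x. \<psi> x (\<omega> x (coord_vector A (U, c) e x)))"
    proof (rule msmooth_change_triv[OF W'(1) W W'(2) _ _ W'(3)[OF U]])
      show "p \<in> W" "p \<in> U" using p by auto
      have "\<omega> x X \<in> fibre V x" for x X
        using linear_betweenD(1)[OF assms(1)] assms(2) subspace_0[OF subspace_fibre] by metis
      then show "\<forall>\<^sub>F x in nhds p. \<omega> x (coord_vector A (U, c) e x) \<in> fibre V x" by simp
    qed
  qed
qed

lemma one_form_add:
  assumes "\<omega> \<in> one_forms A V" "\<omega>' \<in> one_forms A V"
  shows "\<omega> + \<omega>' \<in> one_forms A V"
proof (rule one_formI)
  show "linear_between (tangent_space A x) (fibre V x) ((\<omega> + \<omega>') x)" for x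
    using linear_betweenD[OF one_form_linear[OF assms(1)]] linear_betweenD[OF one_form_linear[OF assms(2)]]
    by (intro linear_betweenI) (simp_all add: subspace_add[OF subspace_fibre] scaleR_add_right)
  show "(\<omega> + \<omega>') x X = 0" if "X \<notin> tangent_space A x" for x X
    using that by (simp add: one_form_outside assms)
  fix p
  obtain W \<psi> where W: "(W, \<psi>) \<in> trivs V" "p \<in> W" using ex_triv by blast
  have "msmooth p (\<lambda>x. \<psi> x ((\<omega> + \<omega>') x (coord_vector A (U, c) e x)))"
    if U: "(U, c) \<in> A" "p \<in> U" for U c e
  proof -
    have "\<forall>\<^sub>F x in nhds p. \<psi> x (\<omega> x (coord_vector A (U, c) e x)) + \<psi> x (\<omega>' x (coord_vector A (U, c) e x))
        = \<psi> x ((\<omega> + \<omega>') x (coord_vector A (U, c) e x))"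
      using triv_eventually[OF W]
      by eventually_elim
         (simp add: linear_betweenD(2)[OF triv_linear[OF W(1)]] one_form_fibre assms)
    from msmooth_cong[OF this msmooth_add[OF one_form_msmooth[OF assms(1) U W] one_form_msmooth[OF assms(2) U W]]]
    show ?thesis .
  qed
  with W show "\<exists>W \<psi>. (W, \<psi>) \<in> trivs V \<and> p \<in> W \<and> (\<forall>U c e. (U, c) \<in> A \<longrightarrow> p \<in> U \<longrightarrow>
      msmooth p (\<lambda>x. \<psi> x ((\<omega> + \<omega>') x (coord_vector A (U, c) e x))))" by blast
qed

lemma one_form_scaleR:
  assumes "\<omega> \<in> one_forms A V"
  shows "r *\<^sub>R \<omega> \<in> one_forms A V"
proof (rule one_formI)
  show "linear_between (tangent_space A x) (fibre V x) ((r *\<^sub>R \<omega>) x)" for x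
    using linear_betweenD[OF one_form_linear[OF assms(1)]]
    by (intro linear_betweenI) (simp_all add: subspace_scale[OF subspace_fibre] scaleR_add_right)
  show "(r *\<^sub>R \<omega>) x X = 0" if "X \<notin> tangent_space A x" for x X
    using that by (simp add: one_form_outside assms)
  fix p
  obtain W \<psi> where W: "(W, \<psi>) \<in> trivs V" "p \<in> W" using ex_triv by blast
  have "msmooth p (\<lambda>x. \<psi> x ((r *\<^sub>R \<omega>) x (coord_vector A (U, c) e x)))"
    if U: "(U, c) \<in> A" "p \<in> U" for U c e
  proof -
    have "\<forall>\<^sub>F x in nhds p. r *\<^sub>R \<psi> x (\<omega> x (coord_vector A (U, c) e x))
        = \<psi> x ((r *\<^sub>R \<omega>) x (coord_vector A (U, c) e x))"
      using triv_eventually[OF W]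
      by eventually_elim
         (simp add: linear_betweenD(3)[OF triv_linear[OF W(1)]] one_form_fibre assms)
    from msmooth_cong[OF this msmooth_scaleR[OF msmooth_const one_form_msmooth[OF assms(1) U W]]]
    show ?thesis .
  qed
  with W show "\<exists>W \<psi>. (W, \<psi>) \<in> trivs V \<and> p \<in> W \<and> (\<forall>U c e. (U, c) \<in> A \<longrightarrow> p \<in> U \<longrightarrow>
      msmooth p (\<lambda>x. \<psi> x ((r *\<^sub>R \<omega>) x (coord_vector A (U, c) e x))))" by blast
qed

lemma one_form_0: "0 \<in> one_forms A V"
proof (rule one_formI)
  show "linear_between (tangent_space A x) (fibre V x) (0 x)" for x
    by (rule linear_betweenI) (simp_all add: subspace_0[OF subspace_fibre])
  fix p
  obtain W \<psi> where W: "(W, \<psi>) \<in> trivs V" "p \<in> W" using ex_triv by blast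
  have "\<forall>\<^sub>F x in nhds p. 0 = \<psi> x 0"
    using triv_eventually[OF W]
    by eventually_elim
       (simp add: linear_between_0[OF triv_linear[OF W(1)] subspace_0[OF subspace_fibre]])
  from msmooth_cong[OF this msmooth_const] W
  show "\<exists>W \<psi>. (W, \<psi>) \<in> trivs V \<and> p \<in> W \<and> (\<forall>U c e. (U, c) \<in> A \<longrightarrow> p \<in> U \<longrightarrow>
      msmooth p (\<lambda>x. \<psi> x (0 x (coord_vector A (U, c) e x))))" by auto
qed simp

lemma subspace_one_forms: "subspace (one_forms A V)"
  by (rule subspaceI) (simp_all add: one_form_0 one_form_add one_form_scaleR)

end

section \<open>Pullback bundles\<close>

locale bundle_pullback = manifold_map A B F + B: vbundle_over B V
  for A :: "('a::{t2_space, second_countable_topology}, 'e::fin_dim_normed) chart set"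
    and B :: "('b::{t2_space, second_countable_topology}, 'k::fin_dim_normed) chart set"
    and F :: "'a \<Rightarrow> 'b"
    and V :: "('b, 'v::real_vector, 'f::fin_dim_normed) vbundle"
begin

lemma fibre_pullback [simp]: "fibre (pullback F V) x = fibre V (F x)"
  by (simp add: pullback_def)

lemma trivs_pullback: "trivs (pullback F V) = (\<lambda>(U, \<psi>). (F -` U, \<lambda>x. \<psi> (F x))) ` trivs V"
  by (simp add: pullback_def)

lemma pullback_triv: "(U, \<psi>) \<in> trivs V \<Longrightarrow> (F -` U, \<lambda>x. \<psi> (F x)) \<in> trivs (pullback F V)"
  unfolding trivs_pullback by force

lemma vector_bundle_pullback: "vector_bundle A (pullback F V)"
  unfolding vector_bundle_def
proof (intro conjI allI ballI)
  show "subspace (fibre (pullback F V) x)" for x by (simp add: B.subspace_fibre)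
next
  fix T assume "T \<in> trivs (pullback F V)"
  then obtain U \<psi> where U: "(U, \<psi>) \<in> trivs V" "T = (F -` U, \<lambda>x. \<psi> (F x))"
    unfolding trivs_pullback by force
  show "case T of (U, \<psi>) \<Rightarrow> open U \<and> (\<forall>x\<in>U. linear_between (fibre (pullback F V) x) UNIV (\<psi> x) \<and>
      bij_betw (\<psi> x) (fibre (pullback F V) x) UNIV)"
    unfolding U(2) using open_vimage[OF B.triv_open[OF U(1)]] B.triv_linear[OF U(1)] B.triv_bij[OF U(1)]
    by simp
next
  have "x \<in> (\<Union>(U, \<psi>)\<in>trivs (pullback F V). U)" for x
  proof -
    obtain U \<psi> where U: "(U, \<psi>) \<in> trivs V" "F x \<in> U" using B.ex_triv by blast
    show ?thesis by (rule UN_I[OF pullback_triv[OF U(1)]]) (simp add: U(2))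
  qed
  then show "(\<Union>(U, \<psi>)\<in>trivs (pullback F V). U) = UNIV" by blast
next
  fix S assume "S \<in> trivs (pullback F V)"
  then obtain U \<psi> where U: "(U, \<psi>) \<in> trivs V" "S = (F -` U, \<lambda>x. \<psi> (F x))"
    unfolding trivs_pullback by force
  show "case S of (U, \<psi>) \<Rightarrow> \<forall>(W, \<theta>)\<in>trivs (pullback F V). \<forall>e.
      smooth_fun_on A (U \<inter> W) (\<lambda>x. \<theta> x (inv_into (fibre (pullback F V) x) (\<psi> x) e))"
    unfolding U(2) prod.case
  proof
    fix T assume "T \<in> trivs (pullback F V)"
    then obtain W \<theta> where W: "(W, \<theta>) \<in> trivs V" "T = (F -` W, \<lambda>x. \<theta> (F x))"
      unfolding trivs_pullback by force
    have op: "open (F -` U \<inter> F -` W)"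
      by (intro open_Int open_vimage B.triv_open[OF U(1)] B.triv_open[OF W(1)])
    have "A.msmooth p (\<lambda>x. \<theta> (F x) (B.tinv \<psi> (F x) e))" if "F p \<in> U" "F p \<in> W" for p e
      by (rule msmooth_compose[OF B.triv_smooth[OF U(1) W(1) that]])
    then show "case T of (W, \<theta>) \<Rightarrow> \<forall>e. smooth_fun_on A (F -` U \<inter> W)
        (\<lambda>x. \<theta> x (inv_into (fibre (pullback F V) x) (\<psi> (F x)) e))"
      unfolding W(2) prod.case A.smooth_fun_on_iff[OF op] by simp
  qed
qed

sublocale P: vbundle_over A "pullback F V"
  by unfold_locales (rule vector_bundle_pullback)

lemma pullback_section:
  assumes "\<xi> \<in> sections B V"
  shows "(\<lambda>x. \<xi> (F x)) \<in> sections A (pullback F V)"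
proof (rule P.sectionI)
  show "\<xi> (F x) \<in> fibre (pullback F V) x" for x by (simp add: B.section_fibre[OF assms])
  fix p
  obtain U \<psi> where U: "(U, \<psi>) \<in> trivs V" "F p \<in> U" using B.ex_triv by blast
  from pullback_triv[OF U(1)] U(2) msmooth_compose[OF B.section_msmooth[OF assms U]]
  show "\<exists>U \<psi>. (U, \<psi>) \<in> trivs (pullback F V) \<and> p \<in> U \<and> A.msmooth p (\<lambda>x. \<psi> x (\<xi> (F x)))"
    by (intro exI[of _ "F -` U"] exI[of _ "\<lambda>x. \<psi> (F x)"]) simp
qed

text \<open>The differential of \<open>F\<close> maps a coordinate vector field to a combination of coordinate vectors of the
  target with smooth coefficients, which are the partial derivatives of \<open>F\<close>.\<close>

lemma msmooth_pullback_form: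
  assumes "\<beta> \<in> one_forms B V" "(U, c) \<in> A" "p \<in> U" "(W, \<psi>) \<in> trivs V" "F p \<in> W"
  shows "A.msmooth p (\<lambda>x. \<psi> (F x) (\<beta> (F x) (differential A B F x (coord_vector A (U, c) e x))))"
proof -
  obtain O' d where O': "(O', d) \<in> B" "F p \<in> O'" using B.ex_chart by blast
  let ?X = "\<lambda>x. coord_vector A (U, c) e x"
  have "A.msmooth p (\<lambda>x. \<Sum>b\<in>fbasis. fcoord b (dvec A (\<lambda>x. d (F x)) x (?X x)) *\<^sub>R
      \<psi> (F x) (\<beta> (F x) (coord_vector B (O', d) b (F x))))"
    by (intro A.msmooth_sum A.msmooth_scaleR A.msmooth_bounded_linear[OF bounded_linear_fcoord
          A.msmooth_dvec_coord_vector[OF assms(2,3) msmooth_coord[OF O']]]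
        msmooth_compose[OF B.one_form_msmooth[OF assms(1) O' assms(4,5)]])
  moreover have "\<forall>\<^sub>F x in nhds p. (\<Sum>b\<in>fbasis. fcoord b (dvec A (\<lambda>x. d (F x)) x (?X x)) *\<^sub>R
      \<psi> (F x) (\<beta> (F x) (coord_vector B (O', d) b (F x)))) =
      \<psi> (F x) (\<beta> (F x) (differential A B F x (?X x)))"
    using eventually_nhds_in_open[OF A.chart_open[OF assms(2)] assms(3)]
      eventually_map[OF B.triv_eventually[OF assms(4,5)]]
      eventually_map[OF eventually_nhds_in_open[OF B.chart_open[OF O'(1)] O'(2)]]
  proof eventually_elim
    case (elim x)
    have X: "?X x \<in> tangent_space A x" by (rule A.coord_vector_tangent[OF assms(2) elim(1)])
    note lin = B.one_form_linear[OF assms(1), of "F x"]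
    note ct = B.coord_vector_tangent[OF O'(1) elim(3)]
    have "\<beta> (F x) (differential A B F x (?X x)) =
        \<beta> (F x) (\<Sum>b\<in>fbasis. fcoord b (dvec A (\<lambda>x. d (F x)) x (?X x)) *\<^sub>R coord_vector B (O', d) b (F x))"
      using B.tangent_expand[OF differential_tangent[OF X] O'(1) elim(3)]
      unfolding differential_chart[OF O'(1) elim(3)] by simp
    also have "\<dots> = (\<Sum>b\<in>fbasis. \<beta> (F x) (fcoord b (dvec A (\<lambda>x. d (F x)) x (?X x)) *\<^sub>R
        coord_vector B (O', d) b (F x)))"
      by (rule linear_between_sum[OF lin B.subspace_tangent_space])
         (rule subspace_scale[OF B.subspace_tangent_space ct])
    also have "\<dots> = (\<Sum>b\<in>fbasis. fcoord b (dvec A (\<lambda>x. d (F x)) x (?X x)) *\<^sub>R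
        \<beta> (F x) (coord_vector B (O', d) b (F x)))"
      by (simp add: linear_betweenD(3)[OF lin ct])
    finally have "\<psi> (F x) (\<beta> (F x) (differential A B F x (?X x))) = \<psi> (F x) \<dots>" by simp
    also have "\<dots> = (\<Sum>b\<in>fbasis. \<psi> (F x) (fcoord b (dvec A (\<lambda>x. d (F x)) x (?X x)) *\<^sub>R
        \<beta> (F x) (coord_vector B (O', d) b (F x))))"
      by (rule linear_between_sum[OF B.triv_linear[OF assms(4) elim(2)] B.subspace_fibre])
         (rule subspace_scale[OF B.subspace_fibre B.one_form_fibre[OF assms(1)]])
    finally show ?case
      by (simp add: linear_betweenD(3)[OF B.triv_linear[OF assms(4) elim(2)] B.one_form_fibre[OF assms(1)]])
  qed
  ultimately show ?thesis by (rule A.msmooth_cong[rotated])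
qed

lemma pullback_form:
  assumes "\<beta> \<in> one_forms B V"
  shows "(\<lambda>x X. if X \<in> tangent_space A x then \<beta> (F x) (differential A B F x X) else 0)
    \<in> one_forms A (pullback F V)" (is "?\<omega> \<in> _")
proof (rule P.one_formI)
  note lin = linear_betweenD[OF B.one_form_linear[OF assms]]
  note dlin = linear_betweenD[OF differential_linear]
  note sub = subspace_add[OF A.subspace_tangent_space] subspace_scale[OF A.subspace_tangent_space]
  show "linear_between (tangent_space A x) (fibre (pullback F V) x) (?\<omega> x)" for x
    by (rule linear_betweenI) (simp_all add: sub lin dlin)
  show "?\<omega> x X = 0" if "X \<notin> tangent_space A x" for x X using that by simp
  fix p
  obtain W \<psi> where W: "(W, \<psi>) \<in> trivs V" "F p \<in> W" using B.ex_triv by blast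
  have "A.msmooth p (\<lambda>x. \<psi> (F x) (?\<omega> x (coord_vector A (U, c) e x)))"
    if U: "(U, c) \<in> A" "p \<in> U" for U c e
  proof -
    have "\<forall>\<^sub>F x in nhds p. \<psi> (F x) (\<beta> (F x) (differential A B F x (coord_vector A (U, c) e x))) =
        \<psi> (F x) (?\<omega> x (coord_vector A (U, c) e x))"
      using eventually_nhds_in_open[OF A.chart_open[OF U(1)] U(2)]
      by eventually_elim (simp add: A.coord_vector_tangent[OF U(1)])
    from A.msmooth_cong[OF this msmooth_pullback_form[OF assms U W]] show ?thesis .
  qed
  with pullback_triv[OF W(1)] W(2)
  show "\<exists>W \<psi>. (W, \<psi>) \<in> trivs (pullback F V) \<and> p \<in> W \<and> (\<forall>U c e. (U, c) \<in> A \<longrightarrow> p \<in> U \<longrightarrow>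
      A.msmooth p (\<lambda>x. \<psi> x (?\<omega> x (coord_vector A (U, c) e x))))"
    by (intro exI[of _ "F -` W"] exI[of _ "\<lambda>x. \<psi> (F x)"]) simp
qed

end

section \<open>Endomorphism bundles\<close>

lemma blinfun_expand:
  fixes T :: "'f::fin_dim_normed \<Rightarrow>\<^sub>L 'g::real_normed_vector"
  shows "T = (\<Sum>b\<in>fbasis. Blinfun (\<lambda>e. fcoord b e *\<^sub>R T b))"
proof (rule blinfun_eqI)
  fix e
  have bl: "bounded_linear (\<lambda>e. fcoord b e *\<^sub>R w)" for b and w :: 'g
    by (rule bounded_linear_scaleR_const[OF bounded_linear_fcoord])
  have "T e = (\<Sum>b\<in>fbasis. fcoord b e *\<^sub>R T b)"
    by (rule linear_expand[OF bounded_linear.linear[OF blinfun.bounded_linear_right]])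
  then show "T e = (\<Sum>b\<in>fbasis. Blinfun (\<lambda>e. fcoord b e *\<^sub>R T b)) e"
    by (simp add: blinfun.sum_left bounded_linear_Blinfun_apply[OF bl])
qed

context manifold
begin

text \<open>A matrix is smooth if its columns are: it is a sum of fixed linear functions of them.\<close>

lemma msmooth_blinfunI:
  fixes T :: "'a \<Rightarrow> 'f::fin_dim_normed \<Rightarrow>\<^sub>L 'g::fin_dim_normed"
  assumes "\<And>e. msmooth p (\<lambda>x. T x e)"
  shows "msmooth p T"
proof -
  have bl: "bounded_linear (\<lambda>e. fcoord b e *\<^sub>R w)" for b :: 'f and w :: 'g
    by (rule bounded_linear_scaleR_const[OF bounded_linear_fcoord])
  have "linear (\<lambda>w::'g. Blinfun (\<lambda>e. fcoord b e *\<^sub>R w))" for b :: 'f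
    by (rule linearI; rule blinfun_eqI;
        simp only: bounded_linear_Blinfun_apply[OF bl] blinfun.add_left blinfun.scaleR_left)
       (simp_all add: scaleR_add_right mult.commute)
  from fin_dim_bounded_linear[OF this]
  have "msmooth p (\<lambda>x. \<Sum>b\<in>fbasis. Blinfun (\<lambda>e. fcoord b e *\<^sub>R T x b))"
    by (intro msmooth_sum msmooth_bounded_linear[OF _ assms])
  then show ?thesis using blinfun_expand by (rule msmooth_cong[rotated, OF _ always_eventually[OF allI[OF sym]]])
qed

lemma msmooth_blinfun_apply:
  fixes T :: "'a \<Rightarrow> 'f::fin_dim_normed \<Rightarrow>\<^sub>L 'g::real_normed_vector"
  assumes "msmooth p T" "msmooth p w"
  shows "msmooth p (\<lambda>x. T x (w x))"
proof (rule msmooth_cong)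
  show "msmooth p (\<lambda>x. \<Sum>b\<in>fbasis. fcoord b (w x) *\<^sub>R T x b)"
    by (intro msmooth_sum msmooth_scaleR msmooth_bounded_linear[OF bounded_linear_fcoord assms(2)]
        msmooth_bounded_linear[OF blinfun.bounded_linear_left assms(1)])
  show "\<forall>\<^sub>F x in nhds p. (\<Sum>b\<in>fbasis. fcoord b (w x) *\<^sub>R T x b) = T x (w x)"
    by (rule always_eventually, rule allI, rule sym,
        rule linear_expand[OF bounded_linear.linear[OF blinfun.bounded_linear_right]])
qed

end

context vbundle_over
begin

text \<open>The trivialization of the endomorphism bundle that \<open>\<psi>\<close> induces by conjugation.\<close>

definition etriv :: "('a \<Rightarrow> 'v \<Rightarrow> 'f) \<Rightarrow> 'a \<Rightarrow> ('v \<Rightarrow> 'v) \<Rightarrow> 'f \<Rightarrow>\<^sub>L 'f"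
  where "etriv \<psi> x T = Blinfun (\<lambda>e. \<psi> x (T (tinv \<psi> x e)))"

lemma trivs_End: "trivs (End_bundle V) = (\<lambda>(U, \<psi>). (U, etriv \<psi>)) ` trivs V"
  unfolding End_bundle_def etriv_def[abs_def] by simp

lemma fibre_End:
  "T \<in> fibre (End_bundle V) x \<longleftrightarrow>
    linear_between (fibre V x) (fibre V x) T \<and> (\<forall>v. v \<notin> fibre V x \<longrightarrow> T v = 0)"
  unfolding End_bundle_def by simp

lemma End_apply_fibre: "T \<in> fibre (End_bundle V) x \<Longrightarrow> T v \<in> fibre V x"
  unfolding fibre_End linear_between_def using subspace_0[OF subspace_fibre] by (cases "v \<in> fibre V x") auto

lemma End_eqI:
  assumes "S \<in> fibre (End_bundle V) x" "T \<in> fibre (End_bundle V) x" "\<And>v. v \<in> fibre V x \<Longrightarrow> S v = T v"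
  shows "S = T"
proof
  fix v
  show "S v = T v" using assms by (cases "v \<in> fibre V x") (simp_all add: fibre_End)
qed

lemma etriv_apply:
  assumes "(U, \<psi>) \<in> trivs V" "x \<in> U" "T \<in> fibre (End_bundle V) x"
  shows "etriv \<psi> x T e = \<psi> x (T (tinv \<psi> x e))"
proof -
  have T: "linear_between (fibre V x) (fibre V x) T" using assms(3) by (simp add: fibre_End)
  note lin = linear_betweenD[OF tinv_linear[OF assms(1,2)]] linear_betweenD[OF T]
    linear_betweenD[OF triv_linear[OF assms(1,2)]]
  have "linear (\<lambda>e. \<psi> x (T (tinv \<psi> x e)))"
    by (rule linearI) (simp_all add: lin)
  then show ?thesis
    unfolding etriv_def by (simp add: bounded_linear_Blinfun_apply[OF fin_dim_bounded_linear])
qed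

lemma etriv_surj:
  assumes "(U, \<psi>) \<in> trivs V" "x \<in> U"
  obtains T where "T \<in> fibre (End_bundle V) x" "etriv \<psi> x T = S"
    "\<And>v. v \<in> fibre V x \<Longrightarrow> T v = tinv \<psi> x (S (\<psi> x v))"
proof -
  define T where "T v = (if v \<in> fibre V x then tinv \<psi> x (S (\<psi> x v)) else 0)" for v
  note lin = linear_betweenD[OF tinv_linear[OF assms]] linear_betweenD[OF triv_linear[OF assms]]
  have T: "T \<in> fibre (End_bundle V) x"
    unfolding fibre_End
    by (auto intro!: linear_betweenI simp: T_def lin subspace_add[OF subspace_fibre]
        subspace_scale[OF subspace_fibre] blinfun.add_right blinfun.scaleR_right)
  moreover have "etriv \<psi> x T = S"
    by (rule blinfun_eqI) (simp add: etriv_apply[OF assms T], simp add: T_def tinv[OF assms])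
  ultimately show thesis using that by (simp add: T_def)
qed

lemma subspace_End: "subspace (fibre (End_bundle V) x)"
proof (rule subspaceI)
  note sub = subspace_add[OF subspace_fibre] subspace_scale[OF subspace_fibre] subspace_0[OF subspace_fibre]
  show "0 \<in> fibre (End_bundle V) x"
    unfolding fibre_End by (auto intro!: linear_betweenI simp: sub)
  show "S + T \<in> fibre (End_bundle V) x"
    if "S \<in> fibre (End_bundle V) x" "T \<in> fibre (End_bundle V) x" for S T
    using that unfolding fibre_End
    by (auto intro!: linear_betweenI simp: sub linear_betweenD scaleR_add_right)
  show "r *\<^sub>R S \<in> fibre (End_bundle V) x" if "S \<in> fibre (End_bundle V) x" for S r
    using that unfolding fibre_End
    by (auto intro!: linear_betweenI simp: sub linear_betweenD scaleR_add_right)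
qed

lemma etriv_linear_bij:
  assumes "(U, \<psi>) \<in> trivs V" "x \<in> U"
  shows "linear_between (fibre (End_bundle V) x) UNIV (etriv \<psi> x)"
    and "bij_betw (etriv \<psi> x) (fibre (End_bundle V) x) UNIV"
proof -
  note lin = linear_betweenD[OF triv_linear[OF assms]]
  note E = End_apply_fibre subspace_add[OF subspace_End] subspace_scale[OF subspace_End]
  show "linear_between (fibre (End_bundle V) x) UNIV (etriv \<psi> x)"
    by (rule linear_betweenI)
       (simp, (rule blinfun_eqI, simp add: etriv_apply[OF assms] E lin blinfun.add_left blinfun.scaleR_left)+)
  have "inj_on (etriv \<psi> x) (fibre (End_bundle V) x)"
  proof (rule inj_onI)
    fix S T assume ST: "S \<in> fibre (End_bundle V) x" "T \<in> fibre (End_bundle V) x" "etriv \<psi> x S = etriv \<psi> x T"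
    show "S = T"
    proof (rule End_eqI[OF ST(1,2)])
      fix v assume v: "v \<in> fibre V x"
      have "\<psi> x (S (tinv \<psi> x (\<psi> x v))) = \<psi> x (T (tinv \<psi> x (\<psi> x v)))"
        using ST(3) by (simp flip: etriv_apply[OF assms ST(1)] etriv_apply[OF assms ST(2)])
      then show "S v = T v"
        unfolding tinv_triv[OF assms v]
        by (rule triv_inject[OF assms End_apply_fibre[OF ST(1)] End_apply_fibre[OF ST(2)]])
    qed
  qed
  moreover have "S \<in> etriv \<psi> x ` fibre (End_bundle V) x" for S
    using etriv_surj[OF assms, of S] by blast
  ultimately show "bij_betw (etriv \<psi> x) (fibre (End_bundle V) x) UNIV"
    unfolding bij_betw_def by blast
qed

lemma vector_bundle_End: "vector_bundle A (End_bundle V)"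
  unfolding vector_bundle_def
proof (intro conjI allI ballI)
  show "subspace (fibre (End_bundle V) x)" for x by (rule subspace_End)
next
  fix T assume "T \<in> trivs (End_bundle V)"
  then obtain U \<psi> where U: "(U, \<psi>) \<in> trivs V" "T = (U, etriv \<psi>)"
    unfolding trivs_End by force
  show "case T of (U, \<psi>) \<Rightarrow> open U \<and> (\<forall>x\<in>U. linear_between (fibre (End_bundle V) x) UNIV (\<psi> x) \<and>
      bij_betw (\<psi> x) (fibre (End_bundle V) x) UNIV)"
    unfolding U(2) using triv_open[OF U(1)] etriv_linear_bij[OF U(1)] by simp
next
  have "x \<in> (\<Union>(U, \<psi>)\<in>trivs (End_bundle V). U)" for x
  proof -
    obtain U \<psi> where U: "(U, \<psi>) \<in> trivs V" "x \<in> U" using ex_triv by blast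
    have "(U, etriv \<psi>) \<in> trivs (End_bundle V)" unfolding trivs_End using U(1) by force
    then show ?thesis by (rule UN_I) (simp add: U(2))
  qed
  then show "(\<Union>(U, \<psi>)\<in>trivs (End_bundle V). U) = UNIV" by blast
next
  fix S assume "S \<in> trivs (End_bundle V)"
  then obtain U \<psi> where U: "(U, \<psi>) \<in> trivs V" "S = (U, etriv \<psi>)"
    unfolding trivs_End by force
  show "case S of (U, \<psi>) \<Rightarrow> \<forall>(W, \<theta>)\<in>trivs (End_bundle V). \<forall>e.
      smooth_fun_on A (U \<inter> W) (\<lambda>x. \<theta> x (inv_into (fibre (End_bundle V) x) (\<psi> x) e))"
    unfolding U(2) prod.case
  proof
    fix T assume "T \<in> trivs (End_bundle V)"
    then obtain W \<theta> where W: "(W, \<theta>) \<in> trivs V" "T = (W, etriv \<theta>)"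
      unfolding trivs_End by force
    have op: "open (U \<inter> W)" by (intro open_Int triv_open[OF U(1)] triv_open[OF W(1)])
    have "msmooth p (\<lambda>x. etriv \<theta> x (inv_into (fibre (End_bundle V) x) (etriv \<psi> x) S))"
      if p: "p \<in> U" "p \<in> W" for p S
    proof (rule msmooth_blinfunI)
      fix e
      have "msmooth p (\<lambda>x. S (\<psi> x (tinv \<theta> x e)))"
        by (rule msmooth_bounded_linear[OF blinfun.bounded_linear_right triv_smooth[OF W(1) U(1) p(2,1)]])
      then have *: "msmooth p (\<lambda>x. \<psi> x (tinv \<psi> x (S (\<psi> x (tinv \<theta> x e)))))"
        by (rule msmooth_cong[rotated])
           (use triv_eventually[OF U(1) p(1)] in \<open>eventually_elim, simp add: triv_tinv[OF U(1)]\<close>)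
      have "msmooth p (\<lambda>x. \<theta> x (tinv \<psi> x (S (\<psi> x (tinv \<theta> x e)))))"
        by (rule msmooth_change_triv[OF U(1) W(1) p _ *])
           (rule eventually_mono[OF triv_eventually[OF U(1) p(1)] tinv_fibre[OF U(1)]])
      moreover have "\<forall>\<^sub>F x in nhds p. \<theta> x (tinv \<psi> x (S (\<psi> x (tinv \<theta> x e)))) =
          etriv \<theta> x (inv_into (fibre (End_bundle V) x) (etriv \<psi> x) S) e"
        using triv_eventually[OF U(1) p(1)] triv_eventually[OF W(1) p(2)]
      proof eventually_elim
        case (elim x)
        obtain T where T: "T \<in> fibre (End_bundle V) x" "etriv \<psi> x T = S"
          "\<And>v. v \<in> fibre V x \<Longrightarrow> T v = tinv \<psi> x (S (\<psi> x v))"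
          using etriv_surj[OF U(1) elim(1), of S] by blast
        have "inv_into (fibre (End_bundle V) x) (etriv \<psi> x) S = T"
          using etriv_linear_bij(2)[OF U(1) elim(1)] T(1,2) unfolding bij_betw_def
          by (intro inv_into_f_eq) auto
        then show ?case
          by (simp add: etriv_apply[OF W(1) elim(2) T(1)] T(3)[OF tinv_fibre[OF W(1) elim(2)]])
      qed
      ultimately show "msmooth p (\<lambda>x. etriv \<theta> x (inv_into (fibre (End_bundle V) x) (etriv \<psi> x) S) e)"
        by (rule msmooth_cong[rotated])
    qed
    then show "case T of (W, \<theta>) \<Rightarrow> \<forall>e. smooth_fun_on A (U \<inter> W)
        (\<lambda>x. \<theta> x (inv_into (fibre (End_bundle V) x) (etriv \<psi> x) e))"
      unfolding W(2) prod.case smooth_fun_on_iff[OF op] by simp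
  qed
qed

lemma vbundle_over_End: "vbundle_over A (End_bundle V)"
  by unfold_locales (rule vector_bundle_End)

lemma End_form_msmooth:
  assumes "\<gamma> \<in> one_forms A (End_bundle V)" "(U, c) \<in> A" "p \<in> U" "(W, \<psi>) \<in> trivs V" "p \<in> W"
  shows "msmooth p (\<lambda>x. etriv \<psi> x (\<gamma> x (coord_vector A (U, c) e x)))"
proof (rule vbundle_over.one_form_msmooth[OF vbundle_over_End assms(1-3) _ assms(5)])
  show "(W, etriv \<psi>) \<in> trivs (End_bundle V)" unfolding trivs_End using assms(4) by force
qed

section \<open>Linear connections\<close>

lemma connectionD:
  assumes "D \<in> connections A V"
  shows conn_form: "\<And>\<xi>. \<xi> \<in> sections A V \<Longrightarrow> D \<xi> \<in> one_forms A V"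
    and conn_outside: "\<And>\<xi>. \<xi> \<notin> sections A V \<Longrightarrow> D \<xi> = 0"
    and conn_linear: "linear_between (sections A V) (one_forms A V) D"
    and conn_leibniz: "\<And>f \<xi> x X. (\<And>x. msmooth x f) \<Longrightarrow> \<xi> \<in> sections A V \<Longrightarrow> X \<in> tangent_space A x \<Longrightarrow>
      D (\<lambda>y. f y *\<^sub>R \<xi> y) x X = dvec A f x X *\<^sub>R \<xi> x + f x *\<^sub>R D \<xi> x X"
proof -
  show "\<xi> \<in> sections A V \<Longrightarrow> D \<xi> \<in> one_forms A V" "\<xi> \<notin> sections A V \<Longrightarrow> D \<xi> = 0" for \<xi>
    using assms unfolding connections_def by blast+
  show "linear_between (sections A V) (one_forms A V) D"
    using assms unfolding connections_def by blast
  have "\<forall>f. \<forall>\<xi>\<in>sections A V. smooth_fun_on A UNIV f \<longrightarrow> (\<forall>x. \<forall>X\<in>tangent_space A x.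
      D (\<lambda>y. f y *\<^sub>R \<xi> y) x X = differential_fun A f x X *\<^sub>R \<xi> x + f x *\<^sub>R D \<xi> x X)"
    using assms unfolding connections_def by blast
  then show "D (\<lambda>y. f y *\<^sub>R \<xi> y) x X = dvec A f x X *\<^sub>R \<xi> x + f x *\<^sub>R D \<xi> x X"
    if "\<And>x. msmooth x f" "\<xi> \<in> sections A V" "X \<in> tangent_space A x" for f \<xi> x X
    using that smooth_fun_on_iff[OF open_UNIV, of f] by (simp add: differential_fun_eq_dvec)
qed

lemma connectionI:
  assumes "\<And>\<xi>. \<xi> \<in> sections A V \<Longrightarrow> D \<xi> \<in> one_forms A V"
    and "\<And>\<xi>. \<xi> \<notin> sections A V \<Longrightarrow> D \<xi> = 0"
    and "\<And>\<xi> \<eta> x X. \<xi> \<in> sections A V \<Longrightarrow> \<eta> \<in> sections A V \<Longrightarrow> X \<in> tangent_space A x \<Longrightarrow>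
      D (\<lambda>x. \<xi> x + \<eta> x) x X = D \<xi> x X + D \<eta> x X"
    and "\<And>f \<xi> x X. (\<And>x. msmooth x f) \<Longrightarrow> \<xi> \<in> sections A V \<Longrightarrow> X \<in> tangent_space A x \<Longrightarrow>
      D (\<lambda>y. f y *\<^sub>R \<xi> y) x X = dvec A f x X *\<^sub>R \<xi> x + f x *\<^sub>R D \<xi> x X"
  shows "D \<in> connections A V"
proof -
  have "linear_between (sections A V) (one_forms A V) D"
  proof (rule linear_betweenI[OF assms(1)])
    fix \<xi> \<eta> assume s: "\<xi> \<in> sections A V" "\<eta> \<in> sections A V"
    have f: "D (\<lambda>x. \<xi> x + \<eta> x) \<in> one_forms A V" by (intro assms(1) section_add s)
    have "D (\<lambda>x. \<xi> x + \<eta> x) x X = D \<xi> x X + D \<eta> x X" for x X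
      using assms(3)[OF s, of X x] one_form_outside[OF f] one_form_outside[OF assms(1)[OF s(1)]]
        one_form_outside[OF assms(1)[OF s(2)]]
      by (cases "X \<in> tangent_space A x") simp_all
    then show "D (\<xi> + \<eta>) = D \<xi> + D \<eta>" by (simp add: fun_eq_iff plus_fun_def)
  next
    fix r :: real and \<xi> assume s: "\<xi> \<in> sections A V"
    have f: "D (\<lambda>x. r *\<^sub>R \<xi> x) \<in> one_forms A V" by (intro assms(1) section_scaleR msmooth_const s)
    have "D (\<lambda>x. r *\<^sub>R \<xi> x) x X = r *\<^sub>R D \<xi> x X" for x X
    proof (cases "X \<in> tangent_space A x")
      case True
      have "D (\<lambda>x. r *\<^sub>R \<xi> x) x X = dvec A (\<lambda>_. r) x X *\<^sub>R \<xi> x + r *\<^sub>R D \<xi> x X"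
        by (rule assms(4)[OF msmooth_const s True])
      then show ?thesis by (simp add: dvec_const[OF True])
    next
      case False
      then show ?thesis by (simp add: one_form_outside[OF f] one_form_outside[OF assms(1)[OF s]])
    qed
    then show "D (r *\<^sub>R \<xi>) = r *\<^sub>R D \<xi>" by (simp add: fun_eq_iff scaleR_fun_def)
  qed
  moreover have "D (\<lambda>y. f y *\<^sub>R \<xi> y) x X = differential_fun A f x X *\<^sub>R \<xi> x + f x *\<^sub>R D \<xi> x X"
    if "smooth_fun_on A UNIV f" "\<xi> \<in> sections A V" "X \<in> tangent_space A x" for f \<xi> x X
    using assms(4)[OF _ that(2,3)] that(1) smooth_fun_on_iff[OF open_UNIV, of f]
    by (simp add: differential_fun_eq_dvec)
  ultimately show ?thesis unfolding connections_def using assms(1,2) by blast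
qed

context
  fixes D assumes D: "D \<in> connections A V"
begin

lemma conn_add:
  assumes "\<xi> \<in> sections A V" "\<eta> \<in> sections A V"
  shows "D (\<lambda>x. \<xi> x + \<eta> x) x X = D \<xi> x X + D \<eta> x X"
proof -
  have "D (\<xi> + \<eta>) = D \<xi> + D \<eta>" by (rule linear_betweenD(2)[OF conn_linear[OF D] assms])
  moreover have "\<xi> + \<eta> = (\<lambda>x. \<xi> x + \<eta> x)" by (simp add: fun_eq_iff)
  ultimately show ?thesis by simp
qed

lemma conn_scaleR:
  assumes "\<xi> \<in> sections A V"
  shows "D (\<lambda>x. r *\<^sub>R \<xi> x) x X = r *\<^sub>R D \<xi> x X"
proof -
  have "D (r *\<^sub>R \<xi>) = r *\<^sub>R D \<xi>" by (rule linear_betweenD(3)[OF conn_linear[OF D] assms])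
  moreover have "r *\<^sub>R \<xi> = (\<lambda>x. r *\<^sub>R \<xi> x)" by (simp add: fun_eq_iff)
  ultimately show ?thesis by simp
qed

lemma conn_0: "D (\<lambda>x. 0) x X = 0"
  using conn_scaleR[OF section_0, of 0 x X] by simp

lemma conn_sum:
  assumes "\<And>i. i \<in> I \<Longrightarrow> \<xi> i \<in> sections A V"
  shows "D (\<lambda>x. \<Sum>i\<in>I. \<xi> i x) x X = (\<Sum>i\<in>I. D (\<xi> i) x X)"
  using assms
  by (induction I rule: infinite_finite_induct) (simp_all add: conn_0 conn_add section_sum)

text \<open>Connections are local operators: sections agreeing near a point agree everywhere after
  multiplication by a suitable bump function, and the Leibniz rule undoes the multiplication.\<close>

lemma conn_local:
  assumes "\<xi> \<in> sections A V" "\<eta> \<in> sections A V" "\<forall>\<^sub>F y in nhds x. \<xi> y = \<eta> y" "X \<in> tangent_space A x"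
  shows "D \<xi> x X = D \<eta> x X"
proof -
  obtain S where S: "open S" "x \<in> S" "\<And>y. y \<in> S \<Longrightarrow> \<xi> y = \<eta> y"
    using assms(3) unfolding eventually_nhds by blast
  obtain h :: "'a \<Rightarrow> real" and W C where h: "\<And>x. msmooth x h" "open W" "x \<in> W" "\<And>x. x \<in> W \<Longrightarrow> h x = 1"
    "closed C" "C \<subseteq> S" "\<And>x. x \<notin> C \<Longrightarrow> h x = 0"
    using manifold_bump[OF S(1,2)] by blast
  have "h y *\<^sub>R \<xi> y = h y *\<^sub>R \<eta> y" for y
    using S(3)[of y] h(6,7) by (cases "y \<in> C") auto
  then have "(\<lambda>y. h y *\<^sub>R \<xi> y) = (\<lambda>y. h y *\<^sub>R \<eta> y)" by (rule ext)
  then have "D (\<lambda>y. h y *\<^sub>R \<xi> y) x X = D (\<lambda>y. h y *\<^sub>R \<eta> y) x X" by simp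
  then show ?thesis
    using conn_leibniz[OF D h(1) assms(1,4)] conn_leibniz[OF D h(1) assms(2,4)] S(2) S(3)[OF S(2)] h(4)[OF h(3)]
    by simp
qed

text \<open>By locality every section that is constant with coordinates \<open>e\<close> near \<open>p\<close> gives the same value
  (\<open>christoffel_eqI\<close>).\<close>

definition christoffel :: "('a \<Rightarrow> 'v \<Rightarrow> 'f) \<Rightarrow> 'a \<Rightarrow> ('a, 'e) tangent \<Rightarrow> 'f \<Rightarrow> 'f"
  where "christoffel \<psi> p X e = \<psi> p (D (frame \<psi> p e) p X)"

lemma christoffel_eqI:
  assumes "(U, \<psi>) \<in> trivs V" "p \<in> U" "X \<in> tangent_space A p" "\<xi> \<in> sections A V"
    "\<forall>\<^sub>F x in nhds p. \<xi> x = tinv \<psi> x e"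
  shows "\<psi> p (D \<xi> p X) = christoffel \<psi> p X e"
proof -
  have "\<forall>\<^sub>F x in nhds p. \<xi> x = frame \<psi> p e x"
    using assms(5) frame_eventually[OF assms(1,2), of e] by eventually_elim simp
  from conn_local[OF assms(4) frame_section[OF assms(1,2)] this assms(3)]
  show ?thesis by (simp add: christoffel_def)
qed

lemma linear_christoffel:
  assumes "(U, \<psi>) \<in> trivs V" "p \<in> U" "X \<in> tangent_space A p"
  shows "linear (christoffel \<psi> p X)"
proof (rule linearI)
  note lin = linear_betweenD[OF tinv_linear[OF assms(1)]]
  note tl = linear_betweenD[OF triv_linear[OF assms(1,2)]]
  note fs = frame_section[OF assms(1,2)]
  note ff = one_form_fibre[OF conn_form[OF D fs]]
  fix e e' :: 'f and r :: real
  have "\<forall>\<^sub>F x in nhds p. frame \<psi> p e x + frame \<psi> p e' x = tinv \<psi> x (e + e')"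
    using frame_eventually[OF assms(1,2), of e] frame_eventually[OF assms(1,2), of e']
      triv_eventually[OF assms(1,2)]
    by eventually_elim (simp add: lin)
  from christoffel_eqI[OF assms section_add[OF fs fs] this]
  show "christoffel \<psi> p X (e + e') = christoffel \<psi> p X e + christoffel \<psi> p X e'"
    by (simp add: conn_add[OF fs fs] tl ff christoffel_def)
  have "\<forall>\<^sub>F x in nhds p. r *\<^sub>R frame \<psi> p e x = tinv \<psi> x (r *\<^sub>R e)"
    using frame_eventually[OF assms(1,2), of e] triv_eventually[OF assms(1,2)]
    by eventually_elim (simp add: lin)
  from christoffel_eqI[OF assms section_scaleR[OF msmooth_const fs] this]
  show "christoffel \<psi> p X (r *\<^sub>R e) = r *\<^sub>R christoffel \<psi> p X e"
    by (simp add: conn_scaleR[OF fs] tl ff christoffel_def)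
qed

text \<open>In a trivialization a connection is the ordinary derivative plus the Christoffel symbols: near
  \<open>p\<close> a section is the sum of its coordinates, cut off by a bump function, times the frame sections.\<close>

lemma conn_formula:
  assumes "(U, \<psi>) \<in> trivs V" "p \<in> U" "X \<in> tangent_space A p" "\<xi> \<in> sections A V"
  shows "\<psi> p (D \<xi> p X) = dvec A (\<lambda>x. \<psi> x (\<xi> x)) p X + christoffel \<psi> p X (\<psi> p (\<xi> p))"
proof -
  note tl = triv_linear[OF assms(1,2)]
  note fs = frame_section[OF assms(1,2)]
  note ff = one_form_fibre[OF conn_form[OF D]]
  obtain h :: "'a \<Rightarrow> real" and W C where h: "\<And>x. msmooth x h" "open W" "p \<in> W" "\<And>x. x \<in> W \<Longrightarrow> h x = 1"
    "closed C" "C \<subseteq> U" "\<And>x. x \<notin> C \<Longrightarrow> h x = 0"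
    using manifold_bump[OF triv_open[OF assms(1)] assms(2)] by blast
  define u where "u b x = h x *\<^sub>R fcoord b (\<psi> x (\<xi> x))" for b x
  have w: "msmooth x (\<lambda>x. fcoord b (\<psi> x (\<xi> x)))" if "x \<in> U" for x b
    by (rule msmooth_bounded_linear[OF bounded_linear_fcoord section_msmooth[OF assms(4,1) that]])
  have u_smooth: "msmooth x (u b)" for x b
    unfolding u_def[abs_def] by (rule cutoff_msmooth[OF h(1,5,6,7) w])
  have us: "(\<lambda>x. u b x *\<^sub>R frame \<psi> p b x) \<in> sections A V" for b
    by (rule section_scaleR[OF u_smooth fs])
  have fp: "frame \<psi> p b p = tinv \<psi> p b" for b
    by (rule eventually_nhds_x_imp_x[OF frame_eventually[OF assms(1,2)]])
  have "\<forall>\<^sub>F x in nhds p. \<forall>b\<in>fbasis. frame \<psi> p b x = tinv \<psi> x b"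
    by (intro eventually_ball_finite fbasis ballI frame_eventually[OF assms(1,2)])
  then have "\<forall>\<^sub>F x in nhds p. \<xi> x = (\<Sum>b\<in>fbasis. u b x *\<^sub>R frame \<psi> p b x)"
    using triv_eventually[OF assms(1,2)] eventually_nhds_in_open[OF h(2,3)]
  proof eventually_elim
    case (elim x)
    have "linear_between (fibre V x) (fibre V x) (\<lambda>v. v)" by (rule linear_betweenI) auto
    from linear_between_expand[OF this assms(1) elim(2) section_fibre[OF assms(4)]]
    show ?case using elim(1) by (simp add: u_def h(4)[OF elim(3)])
  qed
  from conn_local[OF assms(4) section_sum[OF us] this assms(3)]
  have "D \<xi> p X = (\<Sum>b\<in>fbasis. dvec A (u b) p X *\<^sub>R frame \<psi> p b p + u b p *\<^sub>R D (frame \<psi> p b) p X)"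
    by (simp add: conn_sum[OF us] conn_leibniz[OF D u_smooth fs assms(3)])
  then have "\<psi> p (D \<xi> p X) = \<psi> p \<dots>" by simp
  also have "\<dots> = (\<Sum>b\<in>fbasis. \<psi> p (dvec A (u b) p X *\<^sub>R frame \<psi> p b p + u b p *\<^sub>R D (frame \<psi> p b) p X))"
    by (rule linear_between_sum[OF tl subspace_fibre])
       (intro subspace_add[OF subspace_fibre] subspace_scale[OF subspace_fibre] section_fibre fs ff)
  also have "\<dots> = (\<Sum>b\<in>fbasis. dvec A (u b) p X *\<^sub>R b + u b p *\<^sub>R christoffel \<psi> p X b)"
  proof (rule sum.cong[OF refl])
    fix b :: 'f
    have "\<psi> p (dvec A (u b) p X *\<^sub>R frame \<psi> p b p + u b p *\<^sub>R D (frame \<psi> p b) p X) =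
        dvec A (u b) p X *\<^sub>R \<psi> p (frame \<psi> p b p) + u b p *\<^sub>R \<psi> p (D (frame \<psi> p b) p X)"
      by (simp only: linear_betweenD(2,3)[OF tl] subspace_scale[OF subspace_fibre] section_fibre[OF fs]
          ff[OF fs])
    then show "\<psi> p (dvec A (u b) p X *\<^sub>R frame \<psi> p b p + u b p *\<^sub>R D (frame \<psi> p b) p X) =
        dvec A (u b) p X *\<^sub>R b + u b p *\<^sub>R christoffel \<psi> p X b"
      unfolding fp triv_tinv[OF assms(1,2)] christoffel_def .
  qed
  also have "\<dots> = (\<Sum>b\<in>fbasis. fcoord b (dvec A (\<lambda>x. \<psi> x (\<xi> x)) p X) *\<^sub>R b +
      fcoord b (\<psi> p (\<xi> p)) *\<^sub>R christoffel \<psi> p X b)"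
  proof (rule sum.cong[OF refl])
    fix b :: 'f
    have "\<forall>\<^sub>F x in nhds p. fcoord b (\<psi> x (\<xi> x)) = u b x"
      using eventually_nhds_in_open[OF h(2,3)] by eventually_elim (simp add: u_def h(4))
    then have "dvec A (u b) p X = dvec A (\<lambda>x. fcoord b (\<psi> x (\<xi> x))) p X"
      by (rule dvec_cong[OF assms(3) w[OF assms(2)]])
    also have "\<dots> = fcoord b (dvec A (\<lambda>x. \<psi> x (\<xi> x)) p X)"
      by (rule dvec_bounded_linear[OF assms(3) section_msmooth[OF assms(4,1,2)] bounded_linear_fcoord])
    finally show "dvec A (u b) p X *\<^sub>R b + u b p *\<^sub>R christoffel \<psi> p X b =
        fcoord b (dvec A (\<lambda>x. \<psi> x (\<xi> x)) p X) *\<^sub>R b + fcoord b (\<psi> p (\<xi> p)) *\<^sub>R christoffel \<psi> p X b"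
      by (simp add: u_def h(3,4))
  qed
  also have "\<dots> = dvec A (\<lambda>x. \<psi> x (\<xi> x)) p X + christoffel \<psi> p X (\<psi> p (\<xi> p))"
    using linear_expand[OF linear_christoffel[OF assms(1-3)], of "\<psi> p (\<xi> p)"]
    by (simp add: sum.distrib fcoord_sum)
  finally show ?thesis .
qed

end

text \<open>By \<open>conn_formula\<close> a connection is determined by its Christoffel symbols.\<close>

lemma conn_eqI:
  assumes "D \<in> connections A V" "D' \<in> connections A V"
    and "\<And>p. \<exists>U \<psi>. (U, \<psi>) \<in> trivs V \<and> p \<in> U \<and>
      (\<forall>X\<in>tangent_space A p. \<forall>e. christoffel D \<psi> p X e = christoffel D' \<psi> p X e)"
  shows "D = D'"
proof (intro ext)
  fix \<xi> p X
  show "D \<xi> p X = D' \<xi> p X"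
  proof (cases "\<xi> \<in> sections A V \<and> X \<in> tangent_space A p")
    case True
    then have s: "\<xi> \<in> sections A V" and X: "X \<in> tangent_space A p" by auto
    obtain U \<psi> where U: "(U, \<psi>) \<in> trivs V" "p \<in> U"
      "\<And>X e. X \<in> tangent_space A p \<Longrightarrow> christoffel D \<psi> p X e = christoffel D' \<psi> p X e"
      using assms(3)[of p] by blast
    show ?thesis
      by (rule triv_inject[OF U(1,2) one_form_fibre[OF conn_form[OF assms(1) s]]
            one_form_fibre[OF conn_form[OF assms(2) s]]])
         (simp add: conn_formula[OF assms(1) U(1,2) X s] conn_formula[OF assms(2) U(1,2) X s] U(3)[OF X])
  next
    case False
    show ?thesis
    proof (cases "\<xi> \<in> sections A V")
      case True
      with False have X: "X \<notin> tangent_space A p" by simp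
      show ?thesis
        by (simp add: one_form_outside[OF conn_form[OF assms(1) True] X]
            one_form_outside[OF conn_form[OF assms(2) True] X])
    next
      case False
      then show ?thesis by (simp add: conn_outside[OF assms(1)] conn_outside[OF assms(2)])
    qed
  qed
qed

text \<open>The derivative terms of two connections cancel, so their difference at a point only depends on
  the value of the section there.\<close>

lemma conn_difference_tensorial:
  assumes "D \<in> connections A V" "D' \<in> connections A V"
    and "\<xi> \<in> sections A V" "\<eta> \<in> sections A V" "\<xi> p = \<eta> p" "X \<in> tangent_space A p"
  shows "D' \<xi> p X - D \<xi> p X = D' \<eta> p X - D \<eta> p X"
proof -
  obtain U \<psi> where U: "(U, \<psi>) \<in> trivs V" "p \<in> U" using ex_triv by blast
  note fib = one_form_fibre[OF conn_form[OF assms(1)]] one_form_fibre[OF conn_form[OF assms(2)]]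
  note diff = linear_between_diff[OF triv_linear[OF U] subspace_fibre]
  show ?thesis
  proof (rule triv_inject[OF U])
    show "D' \<xi> p X - D \<xi> p X \<in> fibre V p" "D' \<eta> p X - D \<eta> p X \<in> fibre V p"
      using assms by (auto intro!: subspace_diff[OF subspace_fibre] fib)
    show "\<psi> p (D' \<xi> p X - D \<xi> p X) = \<psi> p (D' \<eta> p X - D \<eta> p X)"
      by (simp add: diff fib assms(3,4) conn_formula[OF assms(1) U assms(6)]
          conn_formula[OF assms(2) U assms(6)] assms(5))
  qed
qed

text \<open>The tensor \<open>D' - D\<close>, evaluated on some section through \<open>v\<close>; the choice does not matter by
  \<open>conn_difference_tensorial\<close>.\<close>

definition conn_diff :: "('a, 'e, 'v) operator \<Rightarrow> ('a, 'e, 'v) operator \<Rightarrow> 'a \<Rightarrow> ('a, 'e) tangent \<Rightarrow> 'v \<Rightarrow> 'v"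
  where "conn_diff D D' x X v = (if X \<in> tangent_space A x \<and> v \<in> fibre V x
    then let \<xi> = (SOME \<xi>. \<xi> \<in> sections A V \<and> \<xi> x = v) in D' \<xi> x X - D \<xi> x X else 0)"

lemma conn_diff_apply:
  assumes "D \<in> connections A V" "D' \<in> connections A V" "\<xi> \<in> sections A V" "X \<in> tangent_space A x"
  shows "conn_diff D D' x X (\<xi> x) = D' \<xi> x X - D \<xi> x X"
proof -
  have "\<exists>\<eta>. \<eta> \<in> sections A V \<and> \<eta> x = \<xi> x" using assms(3) by blast
  from someI_ex[OF this] have s: "(SOME \<eta>. \<eta> \<in> sections A V \<and> \<eta> x = \<xi> x) \<in> sections A V"
    "(SOME \<eta>. \<eta> \<in> sections A V \<and> \<eta> x = \<xi> x) x = \<xi> x" by auto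
  show ?thesis
    unfolding conn_diff_def Let_def
    using conn_difference_tensorial[OF assms(1,2) s(1) assms(3) s(2) assms(4)] assms(4)
      section_fibre[OF assms(3)] by simp
qed

text \<open>Smoothness is tested on the columns of the matrix of the difference. They are obtained by applying it to
  the frame sections, that is, from the one-forms that both connections assign to these sections.\<close>

lemma conn_diff_form:
  assumes "D \<in> connections A V" "D' \<in> connections A V"
  shows "conn_diff D D' \<in> one_forms A (End_bundle V)"
proof (rule vbundle_over.one_formI[OF vbundle_over_End])
  note cd = conn_diff_apply[OF assms]
  note cf = conn_form[OF assms(1)] conn_form[OF assms(2)]
  note fib = cf[THEN one_form_fibre]
  show "conn_diff D D' x X = 0" if "X \<notin> tangent_space A x" for x X
    using that by (simp add: conn_diff_def fun_eq_iff)
  have E: "conn_diff D D' x X \<in> fibre (End_bundle V) x" if X: "X \<in> tangent_space A x" for x X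
    unfolding fibre_End
  proof (intro conjI linear_betweenI allI impI)
    fix u v assume u: "u \<in> fibre V x" and v: "v \<in> fibre V x"
    obtain \<xi> where s: "\<xi> \<in> sections A V" "\<xi> x = u" using ex_section_through[OF u] by blast
    obtain \<eta> where t: "\<eta> \<in> sections A V" "\<eta> x = v" using ex_section_through[OF v] by blast
    show "conn_diff D D' x X (u + v) = conn_diff D D' x X u + conn_diff D D' x X v"
      using cd[OF section_add[OF s(1) t(1)] X] cd[OF s(1) X] cd[OF t(1) X] s(2) t(2)
      by (simp add: conn_add[OF assms(1) s(1) t(1)] conn_add[OF assms(2) s(1) t(1)])
  next
    fix u assume u: "u \<in> fibre V x"
    obtain \<xi> where s: "\<xi> \<in> sections A V" "\<xi> x = u" using ex_section_through[OF u] by blast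
    show "conn_diff D D' x X u \<in> fibre V x"
      unfolding s(2)[symmetric] cd[OF s(1) X] by (intro subspace_diff[OF subspace_fibre] fib s)
  next
    fix u and r :: real assume u: "u \<in> fibre V x"
    obtain \<xi> where s: "\<xi> \<in> sections A V" "\<xi> x = u" using ex_section_through[OF u] by blast
    show "conn_diff D D' x X (r *\<^sub>R u) = r *\<^sub>R conn_diff D D' x X u"
      using cd[OF section_scaleR[OF msmooth_const s(1)] X, of r] cd[OF s(1) X] s(2)
      by (simp add: conn_scaleR[OF assms(1) s(1)] conn_scaleR[OF assms(2) s(1)] scaleR_diff_right)
  next
    fix u assume "u \<notin> fibre V x"
    then show "conn_diff D D' x X u = 0" by (simp add: conn_diff_def)
  qed
  show "linear_between (tangent_space A x) (fibre (End_bundle V) x) (conn_diff D D' x)" for x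
  proof (rule linear_betweenI[OF E])
    fix X Y assume XY: "X \<in> tangent_space A x" "Y \<in> tangent_space A x"
    show "conn_diff D D' x (X + Y) = conn_diff D D' x X + conn_diff D D' x Y"
    proof (rule End_eqI[OF E[OF subspace_add[OF subspace_tangent_space XY]] subspace_add[OF subspace_End E[OF XY(1)] E[OF XY(2)]]])
      fix v assume "v \<in> fibre V x"
      then obtain \<xi> where s: "\<xi> \<in> sections A V" "v = \<xi> x" using ex_section_through by blast
      show "conn_diff D D' x (X + Y) v = (conn_diff D D' x X + conn_diff D D' x Y) v"
        using XY by (simp add: s(2) cd[OF s(1)] subspace_add[OF subspace_tangent_space]
          linear_betweenD(2)[OF one_form_linear[OF cf(1)[OF s(1)]]]
          linear_betweenD(2)[OF one_form_linear[OF cf(2)[OF s(1)]]])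
    qed
  next
    fix X and r :: real assume X: "X \<in> tangent_space A x"
    show "conn_diff D D' x (r *\<^sub>R X) = r *\<^sub>R conn_diff D D' x X"
    proof (rule End_eqI[OF E[OF subspace_scale[OF subspace_tangent_space X]] subspace_scale[OF subspace_End E[OF X]]])
      fix v assume "v \<in> fibre V x"
      then obtain \<xi> where s: "\<xi> \<in> sections A V" "v = \<xi> x" using ex_section_through by blast
      show "conn_diff D D' x (r *\<^sub>R X) v = (r *\<^sub>R conn_diff D D' x X) v"
        using X by (simp add: s(2) cd[OF s(1)] subspace_scale[OF subspace_tangent_space] scaleR_diff_right
          linear_betweenD(3)[OF one_form_linear[OF cf(1)[OF s(1)]]]
          linear_betweenD(3)[OF one_form_linear[OF cf(2)[OF s(1)]]])
    qed
  qed
  fix p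
  obtain W \<psi> where W: "(W, \<psi>) \<in> trivs V" "p \<in> W" using ex_triv by blast
  have "msmooth p (\<lambda>x. etriv \<psi> x (conn_diff D D' x (coord_vector A (U, c) e x)))"
    if U: "(U, c) \<in> A" "p \<in> U" for U c e
  proof (rule msmooth_blinfunI)
    fix b
    note fs = frame_section[OF W, of b]
    have \<omega>: "D' (frame \<psi> p b) - D (frame \<psi> p b) \<in> one_forms A V"
      by (intro subspace_diff[OF subspace_one_forms] cf fs)
    have "\<forall>\<^sub>F x in nhds p. \<psi> x ((D' (frame \<psi> p b) - D (frame \<psi> p b)) x (coord_vector A (U, c) e x)) =
        etriv \<psi> x (conn_diff D D' x (coord_vector A (U, c) e x)) b"
      using triv_eventually[OF W] eventually_nhds_in_open[OF chart_open[OF U(1)] U(2)]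
        frame_eventually[OF W, of b]
    proof eventually_elim
      case (elim x)
      note X = coord_vector_tangent[OF U(1) elim(2), of e]
      show ?case
        using cd[OF fs X] by (simp add: etriv_apply[OF W(1) elim(1) E[OF X]] elim(3))
    qed
    from msmooth_cong[OF this one_form_msmooth[OF \<omega> U W]]
    show "msmooth p (\<lambda>x. etriv \<psi> x (conn_diff D D' x (coord_vector A (U, c) e x)) b)" .
  qed
  moreover have "(W, etriv \<psi>) \<in> trivs (End_bundle V)" unfolding trivs_End using W(1) by force
  ultimately show "\<exists>W \<psi>. (W, \<psi>) \<in> trivs (End_bundle V) \<and> p \<in> W \<and> (\<forall>U c e. (U, c) \<in> A \<longrightarrow> p \<in> U \<longrightarrow>
      msmooth p (\<lambda>x. \<psi> x (conn_diff D D' x (coord_vector A (U, c) e x))))"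
    using W(2) by blast
qed

lemma End_form_eqI:
  assumes "\<gamma> \<in> one_forms A (End_bundle V)" "\<gamma>' \<in> one_forms A (End_bundle V)"
    and "\<And>\<xi> x X. \<xi> \<in> sections A V \<Longrightarrow> X \<in> tangent_space A x \<Longrightarrow> \<gamma> x X (\<xi> x) = \<gamma>' x X (\<xi> x)"
  shows "\<gamma> = \<gamma>'"
proof (intro ext)
  fix x X v
  note fib = vbundle_over.one_form_fibre[OF vbundle_over_End]
  have "\<gamma> x X = \<gamma>' x X"
  proof (cases "X \<in> tangent_space A x")
    case True
    show ?thesis
    proof (rule End_eqI[OF fib[OF assms(1)] fib[OF assms(2)]])
      fix v assume "v \<in> fibre V x"
      then obtain \<xi> where "\<xi> \<in> sections A V" "v = \<xi> x" using ex_section_through by blast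
      with assms(3)[OF _ True] show "\<gamma> x X v = \<gamma>' x X v" by simp
    qed
  next
    case False
    then show ?thesis
      by (simp add: vbundle_over.one_form_outside[OF vbundle_over_End assms(1)]
          vbundle_over.one_form_outside[OF vbundle_over_End assms(2)])
  qed
  then show "\<gamma> x X v = \<gamma>' x X v" by simp
qed

lemma translate_connection:
  assumes "D \<in> connections A V" "\<gamma> \<in> one_forms A (End_bundle V)"
  shows "translate A V D \<gamma> \<in> connections A V"
proof (rule connectionI)
  note E = vbundle_over.one_form_fibre[OF vbundle_over_End assms(2)]
  have Elin: "linear_between (fibre V x) (fibre V x) (\<gamma> x X)" for x X
    using E[of x X] by (simp add: fibre_End)
  have \<gamma>lin: "linear_between (tangent_space A x) (fibre (End_bundle V) x) (\<gamma> x)" for x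
    by (rule vbundle_over.one_form_linear[OF vbundle_over_End assms(2)])
  have eq: "translate A V D \<gamma> \<xi> x X = D \<xi> x X + \<gamma> x X (\<xi> x)" if "\<xi> \<in> sections A V" for \<xi> x X
    using that by (simp add: translate_def)
  show "translate A V D \<gamma> \<xi> = 0" if "\<xi> \<notin> sections A V" for \<xi>
    using that by (simp add: translate_def)
  show "translate A V D \<gamma> (\<lambda>x. \<xi> x + \<eta> x) x X = translate A V D \<gamma> \<xi> x X + translate A V D \<gamma> \<eta> x X"
    if "\<xi> \<in> sections A V" "\<eta> \<in> sections A V" for \<xi> \<eta> x X
    using that by (simp add: eq section_add conn_add[OF assms(1)] linear_betweenD(2)[OF Elin] section_fibre)
  show "translate A V D \<gamma> (\<lambda>y. f y *\<^sub>R \<xi> y) x X = dvec A f x X *\<^sub>R \<xi> x + f x *\<^sub>R translate A V D \<gamma> \<xi> x X"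
    if "\<And>x. msmooth x f" "\<xi> \<in> sections A V" "X \<in> tangent_space A x" for f \<xi> x X
    using that(3) by (simp add: eq[OF that(2)] eq[OF section_scaleR[OF that(1,2)]]
        conn_leibniz[OF assms(1) that] linear_betweenD(3)[OF Elin section_fibre[OF that(2)]] scaleR_add_right)
  fix \<xi> assume s: "\<xi> \<in> sections A V"
  have "(\<lambda>x X. \<gamma> x X (\<xi> x)) \<in> one_forms A V"
  proof (rule one_formI)
    show "linear_between (tangent_space A x) (fibre V x) (\<lambda>X. \<gamma> x X (\<xi> x))" for x
      by (rule linear_betweenI)
         (simp_all add: linear_betweenD[OF \<gamma>lin] End_apply_fibre[OF E])
    show "\<gamma> x X (\<xi> x) = 0" if "X \<notin> tangent_space A x" for x X
      using vbundle_over.one_form_outside[OF vbundle_over_End assms(2) that] by simp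
    fix p
    obtain W \<psi> where W: "(W, \<psi>) \<in> trivs V" "p \<in> W" using ex_triv by blast
    have "msmooth p (\<lambda>x. \<psi> x (\<gamma> x (coord_vector A (U, c) e x) (\<xi> x)))"
      if U: "(U, c) \<in> A" "p \<in> U" for U c e
    proof (rule msmooth_cong)
      show "msmooth p (\<lambda>x. etriv \<psi> x (\<gamma> x (coord_vector A (U, c) e x)) (\<psi> x (\<xi> x)))"
        by (rule msmooth_blinfun_apply[OF End_form_msmooth[OF assms(2) U W] section_msmooth[OF s W]])
      show "\<forall>\<^sub>F x in nhds p. etriv \<psi> x (\<gamma> x (coord_vector A (U, c) e x)) (\<psi> x (\<xi> x)) =
          \<psi> x (\<gamma> x (coord_vector A (U, c) e x) (\<xi> x))"
        using triv_eventually[OF W]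
        by eventually_elim (simp add: etriv_apply[OF W(1) _ E] tinv_triv[OF W(1) _ section_fibre[OF s]])
    qed
    with W show "\<exists>W \<psi>. (W, \<psi>) \<in> trivs V \<and> p \<in> W \<and> (\<forall>U c e. (U, c) \<in> A \<longrightarrow> p \<in> U \<longrightarrow>
        msmooth p (\<lambda>x. \<psi> x (\<gamma> x (coord_vector A (U, c) e x) (\<xi> x))))" by blast
  qed
  from one_form_add[OF conn_form[OF assms(1) s] this]
  show "translate A V D \<gamma> \<xi> \<in> one_forms A V"
    using s by (simp add: translate_def plus_fun_def)
qed

lemma translate_conn_diff:
  assumes "D \<in> connections A V" "D' \<in> connections A V"
  shows "translate A V D (conn_diff D D') = D'"
proof (intro ext)
  fix \<xi> x X
  show "translate A V D (conn_diff D D') \<xi> x X = D' \<xi> x X"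
  proof (cases "\<xi> \<in> sections A V")
    case True
    note cf = conn_form[OF assms(1) True] conn_form[OF assms(2) True]
    show ?thesis
    proof (cases "X \<in> tangent_space A x")
      case X: True
      then show ?thesis using True by (simp add: translate_def conn_diff_apply[OF assms True X])
    next
      case False
      then show ?thesis
        using True by (simp add: translate_def conn_diff_def one_form_outside[OF cf(1)] one_form_outside[OF cf(2)])
    qed
  next
    case False
    then show ?thesis by (simp add: translate_def conn_outside[OF assms(2)])
  qed
qed

lemma translate_unique:
  assumes "D \<in> connections A V" "\<gamma> \<in> one_forms A (End_bundle V)" "\<gamma>' \<in> one_forms A (End_bundle V)"
    "translate A V D \<gamma> = translate A V D \<gamma>'"
  shows "\<gamma> = \<gamma>'"
proof (rule End_form_eqI[OF assms(2,3)])
  fix \<xi> x X assume "\<xi> \<in> sections A V"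
  then show "\<gamma> x X (\<xi> x) = \<gamma>' x X (\<xi> x)"
    using fun_cong[OF fun_cong[OF fun_cong[OF assms(4)]], of \<xi> x X] by (simp add: translate_def)
qed

lemma christoffel_translate:
  assumes "D \<in> connections A V" "\<gamma> \<in> one_forms A (End_bundle V)" "(U, \<psi>) \<in> trivs V" "p \<in> U"
  shows "christoffel (translate A V D \<gamma>) \<psi> p X e = christoffel D \<psi> p X e + \<psi> p (\<gamma> p X (tinv \<psi> p e))"
proof -
  note fs = frame_section[OF assms(3,4)]
  have "frame \<psi> p e p = tinv \<psi> p e"
    by (rule eventually_nhds_x_imp_x[OF frame_eventually[OF assms(3,4)]])
  moreover have "\<gamma> p X v \<in> fibre V p" for v
    by (rule End_apply_fibre[OF vbundle_over.one_form_fibre[OF vbundle_over_End assms(2)]])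
  ultimately show ?thesis
    unfolding christoffel_def[OF assms(1)] christoffel_def[OF translate_connection[OF assms(1,2)]]
    by (simp add: translate_def fs linear_betweenD(2)[OF triv_linear[OF assms(3,4)]]
        one_form_fibre[OF conn_form[OF assms(1) fs]])
qed

end

section \<open>Pullback connections\<close>

context bundle_pullback
begin

definition is_pullback :: "('b, 'k, 'v) operator \<Rightarrow> ('a, 'e, 'v) operator \<Rightarrow> bool"
  where "is_pullback nabla D \<longleftrightarrow> D \<in> connections A (pullback F V) \<and>
    (\<forall>\<xi>\<in>sections B V. \<forall>x. \<forall>X\<in>tangent_space A x.
      D (\<xi> \<circ> F) x X = nabla \<xi> (F x) (differential A B F x X))"

text \<open>Frames of \<open>F\<^sup>*V\<close> may be pulled back from \<open>V\<close>, and on those a pullback connection is prescribed.\<close>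

lemma is_pullback_christoffel:
  assumes "nabla \<in> connections B V" "is_pullback nabla D" "(U, \<psi>) \<in> trivs V" "F p \<in> U" "X \<in> tangent_space A p"
  shows "P.christoffel D (\<lambda>x. \<psi> (F x)) p X e = B.christoffel nabla \<psi> (F p) (differential A B F p X) e"
proof -
  have D: "D \<in> connections A (pullback F V)" using assms(2) by (simp add: is_pullback_def)
  note fs = B.frame_section[OF assms(3,4), of e]
  have "\<forall>\<^sub>F x in nhds p. B.frame \<psi> (F p) e (F x) = P.tinv (\<lambda>x. \<psi> (F x)) x e"
    using eventually_map[OF B.frame_eventually[OF assms(3,4), of e]] by simp
  from P.christoffel_eqI[OF D pullback_triv[OF assms(3)] _ assms(5) pullback_section[OF fs] this] assms(4)
  have "P.christoffel D (\<lambda>x. \<psi> (F x)) p X e = \<psi> (F p) (D (\<lambda>x. B.frame \<psi> (F p) e (F x)) p X)" by simp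
  also have "\<dots> = \<psi> (F p) (nabla (B.frame \<psi> (F p) e) (F p) (differential A B F p X))"
    using assms(2,5) fs by (simp add: is_pullback_def o_def)
  finally show ?thesis by (simp add: B.christoffel_def[OF assms(1)])
qed

lemma is_pullback_formula:
  assumes "nabla \<in> connections B V" "is_pullback nabla D" "(U, \<psi>) \<in> trivs V" "F p \<in> U" "X \<in> tangent_space A p"
    and "\<xi> \<in> sections A (pullback F V)"
  shows "\<psi> (F p) (D \<xi> p X) = dvec A (\<lambda>x. \<psi> (F x) (\<xi> x)) p X +
    B.christoffel nabla \<psi> (F p) (differential A B F p X) (\<psi> (F p) (\<xi> p))"
proof -
  have D: "D \<in> connections A (pullback F V)" using assms(2) by (simp add: is_pullback_def)
  show ?thesis
    using P.conn_formula[OF D pullback_triv[OF assms(3)] _ assms(5,6)] assms(4)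
    by (simp add: is_pullback_christoffel[OF assms(1-5)])
qed

lemma is_pullback_unique:
  assumes "nabla \<in> connections B V" "is_pullback nabla D" "is_pullback nabla D'"
  shows "D = D'"
proof (rule P.conn_eqI)
  show "D \<in> connections A (pullback F V)" "D' \<in> connections A (pullback F V)"
    using assms(2,3) by (simp_all add: is_pullback_def)
  fix p
  obtain U \<psi> where U: "(U, \<psi>) \<in> trivs V" "F p \<in> U" using B.ex_triv by blast
  show "\<exists>U \<psi>. (U, \<psi>) \<in> trivs (pullback F V) \<and> p \<in> U \<and>
      (\<forall>X\<in>tangent_space A p. \<forall>e. P.christoffel D \<psi> p X e = P.christoffel D' \<psi> p X e)"
    using pullback_triv[OF U(1)] U(2)
    by (intro exI[of _ "F -` U"] exI[of _ "\<lambda>x. \<psi> (F x)"])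
       (simp add: is_pullback_christoffel[OF assms(1,2) U] is_pullback_christoffel[OF assms(1,3) U])
qed

lemma is_pullback_translate:
  assumes "nabla \<in> connections B V" "\<gamma> \<in> one_forms B (End_bundle V)"
    and "is_pullback nabla D" "is_pullback (translate B V nabla \<gamma>) D'"
    and "\<xi> \<in> sections A (pullback F V)" "X \<in> tangent_space A p"
  shows "D' \<xi> p X = D \<xi> p X + \<gamma> (F p) (differential A B F p X) (\<xi> p)"
proof -
  obtain U \<psi> where U: "(U, \<psi>) \<in> trivs V" "F p \<in> U" using B.ex_triv by blast
  note tr = B.translate_connection[OF assms(1,2)]
  have D: "D \<in> connections A (pullback F V)" "D' \<in> connections A (pullback F V)"
    using assms(3,4) by (simp_all add: is_pullback_def)
  have fib: "D \<xi> p X \<in> fibre V (F p)" "D' \<xi> p X \<in> fibre V (F p)" "\<xi> p \<in> fibre V (F p)"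
    "\<gamma> (F p) (differential A B F p X) (\<xi> p) \<in> fibre V (F p)"
    using P.one_form_fibre[OF P.conn_form[OF D(1) assms(5)]] P.one_form_fibre[OF P.conn_form[OF D(2) assms(5)]]
      P.section_fibre[OF assms(5)]
      B.End_apply_fibre[OF vbundle_over.one_form_fibre[OF B.vbundle_over_End assms(2)]] by simp_all
  show ?thesis
  proof (rule B.triv_inject[OF U])
    show "D' \<xi> p X \<in> fibre V (F p)" by (rule fib)
    show "D \<xi> p X + \<gamma> (F p) (differential A B F p X) (\<xi> p) \<in> fibre V (F p)"
      by (rule subspace_add[OF B.subspace_fibre fib(1,4)])
    show "\<psi> (F p) (D' \<xi> p X) = \<psi> (F p) (D \<xi> p X + \<gamma> (F p) (differential A B F p X) (\<xi> p))"
      unfolding linear_betweenD(2)[OF B.triv_linear[OF U] fib(1,4)]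
        is_pullback_formula[OF assms(1,3) U assms(6,5)] is_pullback_formula[OF tr assms(4) U assms(6,5)]
        B.christoffel_translate[OF assms(1,2) U] B.tinv_triv[OF U fib(3)] by simp
  qed
qed

lemma End_bundle_pullback: "End_bundle (pullback F V) = pullback F (End_bundle V)"
  unfolding End_bundle_def pullback_def by (simp add: image_image case_prod_beta)

text \<open>A connection on the restriction of \<open>F\<^sup>*V\<close> to the domain of a trivialization; \<open>\<beta> e\<close> plays the role of the
  covariant derivative of the frame section with coordinates \<open>e\<close>.\<close>

definition local_conn :: "('b \<Rightarrow> 'v \<Rightarrow> 'f) \<Rightarrow> ('f \<Rightarrow> 'a \<Rightarrow> ('a, 'e) tangent \<Rightarrow> 'v) \<Rightarrow> ('a, 'e, 'v) operator"
  where "local_conn \<psi> \<beta> \<xi> x X =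
    B.tinv \<psi> (F x) (dvec A (\<lambda>y. \<psi> (F y) (\<xi> y)) x X) + \<beta> (\<psi> (F x) (\<xi> x)) x X"

context
  fixes U :: "'b set" and \<psi> :: "'b \<Rightarrow> 'v \<Rightarrow> 'f" and \<beta> :: "'f \<Rightarrow> 'a \<Rightarrow> ('a, 'e) tangent \<Rightarrow> 'v"
  assumes U: "(U, \<psi>) \<in> trivs V"
    and \<beta>: "\<And>e. \<beta> e \<in> one_forms A (pullback F V)"
    and \<beta>_linear: "\<And>x X. linear (\<lambda>e. \<beta> e x X)"
begin

lemma local_conn_fibre: "F x \<in> U \<Longrightarrow> local_conn \<psi> \<beta> \<xi> x X \<in> fibre V (F x)"
  unfolding local_conn_def
  using P.one_form_fibre[OF \<beta>] B.tinv_fibre[OF U] by (simp add: subspace_add[OF B.subspace_fibre])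

lemma triv_local_conn:
  assumes "F x \<in> U"
  shows "\<psi> (F x) (local_conn \<psi> \<beta> \<xi> x X) = dvec A (\<lambda>y. \<psi> (F y) (\<xi> y)) x X +
    \<psi> (F x) (\<beta> (\<psi> (F x) (\<xi> x)) x X)"
  unfolding local_conn_def
  using P.one_form_fibre[OF \<beta>, of _ x X]
  by (simp add: linear_betweenD(2)[OF B.triv_linear[OF U assms]] B.tinv[OF U assms])

lemma local_conn_linear_form:
  assumes "F x \<in> U" "\<xi> \<in> sections A (pullback F V)"
  shows "linear_between (tangent_space A x) (fibre V (F x)) (local_conn \<psi> \<beta> \<xi> x)"
proof (rule linear_betweenI[OF local_conn_fibre[OF assms(1)]])
  have "A.msmooth x (\<lambda>y. \<psi> (F y) (\<xi> y))"
    using P.section_msmooth[OF assms(2) pullback_triv[OF U]] assms(1) by simp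
  note lin = linear_betweenD[OF A.dvec_linear[OF this]] linear_betweenD[OF P.one_form_linear[OF \<beta>]]
    linear_betweenD[OF B.tinv_linear[OF U assms(1)]]
  show "local_conn \<psi> \<beta> \<xi> x (X + Y) = local_conn \<psi> \<beta> \<xi> x X + local_conn \<psi> \<beta> \<xi> x Y"
    if "X \<in> tangent_space A x" "Y \<in> tangent_space A x" for X Y
    using that by (simp add: local_conn_def lin)
  show "local_conn \<psi> \<beta> \<xi> x (r *\<^sub>R X) = r *\<^sub>R local_conn \<psi> \<beta> \<xi> x X"
    if "X \<in> tangent_space A x" for r X
    using that by (simp add: local_conn_def lin scaleR_add_right)
qed

lemma local_conn_add:
  assumes "F x \<in> U" "\<xi> \<in> sections A (pullback F V)" "\<eta> \<in> sections A (pullback F V)" "X \<in> tangent_space A x"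
  shows "local_conn \<psi> \<beta> (\<lambda>x. \<xi> x + \<eta> x) x X = local_conn \<psi> \<beta> \<xi> x X + local_conn \<psi> \<beta> \<eta> x X"
proof -
  have sm: "A.msmooth x (\<lambda>y. \<psi> (F y) (\<xi> y))" "A.msmooth x (\<lambda>y. \<psi> (F y) (\<eta> y))"
    using P.section_msmooth[OF assms(2) pullback_triv[OF U]] P.section_msmooth[OF assms(3) pullback_triv[OF U]]
      assms(1) by simp_all
  have fib: "\<xi> y \<in> fibre V (F y)" "\<eta> y \<in> fibre V (F y)" for y
    using P.section_fibre[OF assms(2)] P.section_fibre[OF assms(3)] by simp_all
  have "\<forall>\<^sub>F y in nhds x. \<psi> (F y) (\<xi> y) + \<psi> (F y) (\<eta> y) = \<psi> (F y) (\<xi> y + \<eta> y)"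
    using eventually_map[OF B.triv_eventually[OF U assms(1)]]
    by eventually_elim (simp add: linear_betweenD(2)[OF B.triv_linear[OF U]] fib)
  from A.dvec_cong[OF assms(4) A.msmooth_add[OF sm] this]
  have "dvec A (\<lambda>y. \<psi> (F y) (\<xi> y + \<eta> y)) x X =
      dvec A (\<lambda>y. \<psi> (F y) (\<xi> y)) x X + dvec A (\<lambda>y. \<psi> (F y) (\<eta> y)) x X"
    by (simp add: A.dvec_add[OF assms(4) sm])
  then show ?thesis
    by (simp add: local_conn_def linear_betweenD(2)[OF B.tinv_linear[OF U assms(1)]]
        linear_betweenD(2)[OF B.triv_linear[OF U assms(1)]] fib linear_add[OF \<beta>_linear])
qed

lemma local_conn_leibniz:
  fixes f :: "'a \<Rightarrow> real"
  assumes "F x \<in> U" "\<And>x. A.msmooth x f" "\<xi> \<in> sections A (pullback F V)" "X \<in> tangent_space A x"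
  shows "local_conn \<psi> \<beta> (\<lambda>y. f y *\<^sub>R \<xi> y) x X = dvec A f x X *\<^sub>R \<xi> x + f x *\<^sub>R local_conn \<psi> \<beta> \<xi> x X"
proof -
  have sm: "A.msmooth x (\<lambda>y. \<psi> (F y) (\<xi> y))"
    using P.section_msmooth[OF assms(3) pullback_triv[OF U]] assms(1) by simp
  have fib: "\<xi> y \<in> fibre V (F y)" for y using P.section_fibre[OF assms(3)] by simp
  have "\<forall>\<^sub>F y in nhds x. f y *\<^sub>R \<psi> (F y) (\<xi> y) = \<psi> (F y) (f y *\<^sub>R \<xi> y)"
    using eventually_map[OF B.triv_eventually[OF U assms(1)]]
    by eventually_elim (simp add: linear_betweenD(3)[OF B.triv_linear[OF U]] fib)
  from A.dvec_cong[OF assms(4) A.msmooth_scaleR[OF assms(2) sm] this]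
  have "dvec A (\<lambda>y. \<psi> (F y) (f y *\<^sub>R \<xi> y)) x X =
      dvec A f x X *\<^sub>R \<psi> (F x) (\<xi> x) + f x *\<^sub>R dvec A (\<lambda>y. \<psi> (F y) (\<xi> y)) x X"
    by (simp add: A.dvec_scaleR[OF assms(4,2) sm])
  then show ?thesis
    by (simp add: local_conn_def linear_betweenD(2,3)[OF B.tinv_linear[OF U assms(1)]] B.tinv_triv[OF U assms(1) fib]
        linear_betweenD(3)[OF B.triv_linear[OF U assms(1)]] fib linear_scale[OF \<beta>_linear] scaleR_add_right)
qed

text \<open>It is enough to look at \<open>\<psi>\<close> itself instead of \<open>\<theta>\<close>, where the expression is explicit.\<close>

lemma local_conn_msmooth:
  assumes "(U', c) \<in> A" "p \<in> U'" "F p \<in> U" "(W, \<theta>) \<in> trivs V" "F p \<in> W" "\<xi> \<in> sections A (pullback F V)"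
  shows "A.msmooth p (\<lambda>x. \<theta> (F x) (local_conn \<psi> \<beta> \<xi> x (coord_vector A (U', c) e x)))"
proof -
  let ?X = "coord_vector A (U', c) e"
  have pt: "p \<in> F -` U" "p \<in> F -` W" using assms(3,5) by auto
  have sm: "A.msmooth p (\<lambda>y. \<psi> (F y) (\<xi> y))"
    by (rule P.section_msmooth[OF assms(6) pullback_triv[OF U] pt(1)])
  have "A.msmooth p (\<lambda>x. dvec A (\<lambda>y. \<psi> (F y) (\<xi> y)) x (?X x) +
      (\<Sum>b\<in>fbasis. fcoord b (\<psi> (F x) (\<xi> x)) *\<^sub>R \<psi> (F x) (\<beta> b x (?X x))))"
    by (intro A.msmooth_add A.msmooth_sum A.msmooth_scaleR A.msmooth_bounded_linear[OF bounded_linear_fcoord sm]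
        A.msmooth_dvec_coord_vector[OF assms(1,2) sm]
        P.one_form_msmooth[OF \<beta> assms(1,2) pullback_triv[OF U] pt(1)])
  moreover have "\<forall>\<^sub>F x in nhds p. dvec A (\<lambda>y. \<psi> (F y) (\<xi> y)) x (?X x) +
      (\<Sum>b\<in>fbasis. fcoord b (\<psi> (F x) (\<xi> x)) *\<^sub>R \<psi> (F x) (\<beta> b x (?X x))) =
      \<psi> (F x) (local_conn \<psi> \<beta> \<xi> x (?X x))"
    using eventually_map[OF B.triv_eventually[OF U assms(3)]]
  proof eventually_elim
    case (elim x)
    have fib: "\<beta> b x (?X x) \<in> fibre V (F x)" for b using P.one_form_fibre[OF \<beta>] by simp
    note tl = B.triv_linear[OF U elim]
    have "\<beta> (\<psi> (F x) (\<xi> x)) x (?X x) = (\<Sum>b\<in>fbasis. fcoord b (\<psi> (F x) (\<xi> x)) *\<^sub>R \<beta> b x (?X x))"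
      by (rule linear_expand[OF \<beta>_linear])
    then have "\<psi> (F x) (\<beta> (\<psi> (F x) (\<xi> x)) x (?X x)) = \<psi> (F x) \<dots>" by simp
    also have "\<dots> = (\<Sum>b\<in>fbasis. \<psi> (F x) (fcoord b (\<psi> (F x) (\<xi> x)) *\<^sub>R \<beta> b x (?X x)))"
      by (rule linear_between_sum[OF tl B.subspace_fibre]) (rule subspace_scale[OF B.subspace_fibre fib])
    also have "\<dots> = (\<Sum>b\<in>fbasis. fcoord b (\<psi> (F x) (\<xi> x)) *\<^sub>R \<psi> (F x) (\<beta> b x (?X x)))"
      by (simp add: linear_betweenD(3)[OF tl fib])
    finally show ?case by (simp add: triv_local_conn[OF elim])
  qed
  ultimately have sm': "A.msmooth p (\<lambda>x. \<psi> (F x) (local_conn \<psi> \<beta> \<xi> x (?X x)))"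
    by (rule A.msmooth_cong[rotated])
  have "\<forall>\<^sub>F x in nhds p. local_conn \<psi> \<beta> \<xi> x (?X x) \<in> fibre (pullback F V) x"
    using eventually_map[OF B.triv_eventually[OF U assms(3)]]
    by eventually_elim (simp add: local_conn_fibre)
  from P.msmooth_change_triv[OF pullback_triv[OF U] pullback_triv[OF assms(4)] pt this sm']
  show ?thesis .
qed

end

text \<open>Local connections are glued with a partition of unity \<open>g\<close> of the base of \<open>V\<close>. The Leibniz rule
  survives because the \<open>g\<^sub>n\<close> add up to 1.\<close>

definition glue ::
    "(nat \<Rightarrow> 'b \<Rightarrow> real) \<Rightarrow> (nat \<Rightarrow> 'b \<Rightarrow> 'v \<Rightarrow> 'f) \<Rightarrow> (nat \<Rightarrow> 'f \<Rightarrow> 'a \<Rightarrow> ('a, 'e) tangent \<Rightarrow> 'v) \<Rightarrow>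
     ('a, 'e, 'v) operator"
  where "glue g \<psi> \<beta> \<xi> x X = (if \<xi> \<in> sections A (pullback F V) \<and> X \<in> tangent_space A x
    then \<Sum>n | g n (F x) \<noteq> 0. g n (F x) *\<^sub>R local_conn (\<psi> n) (\<beta> n) \<xi> x X else 0)"

context
  fixes U :: "nat \<Rightarrow> 'b set" and \<psi> :: "nat \<Rightarrow> 'b \<Rightarrow> 'v \<Rightarrow> 'f"
    and g :: "nat \<Rightarrow> 'b \<Rightarrow> real" and K :: "nat \<Rightarrow> 'b set"
  assumes U: "\<And>n. (U n, \<psi> n) \<in> trivs V"
    and g: "\<And>n x. B.msmooth x (g n)" "\<And>n. closed (K n)" "\<And>n x. x \<notin> K n \<Longrightarrow> g n x = 0" "\<And>n. K n \<subseteq> U n"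
    and loc_fin: "\<And>x. \<exists>N. \<forall>\<^sub>F y in nhds x. (\<forall>n\<ge>N. g n y = 0) \<and> (\<Sum>n<N. g n y) = (1::real)"
begin

lemma partition_support: "g n x \<noteq> 0 \<Longrightarrow> x \<in> U n"
  using g(3,4) by blast

lemma partition_finite_sum:
  fixes G :: "nat \<Rightarrow> 'w::real_vector"
  obtains N where "\<forall>\<^sub>F y in nhds x. \<forall>G::nat \<Rightarrow> 'w. (\<Sum>n | g n y \<noteq> 0. g n y *\<^sub>R G n) = (\<Sum>n<N. g n y *\<^sub>R G n)"
proof -
  obtain N where "\<forall>\<^sub>F y in nhds x. (\<forall>n\<ge>N. g n y = 0) \<and> (\<Sum>n<N. g n y) = 1" using loc_fin by blast
  then have "\<forall>\<^sub>F y in nhds x. \<forall>G::nat \<Rightarrow> 'w. (\<Sum>n | g n y \<noteq> 0. g n y *\<^sub>R G n) = (\<Sum>n<N. g n y *\<^sub>R G n)"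
  proof eventually_elim
    case (elim y)
    then have "{n. g n y \<noteq> 0} \<subseteq> {..<N}" by (auto simp: not_le[symmetric])
    then show ?case by (intro allI sum.mono_neutral_left) auto
  qed
  then show thesis by (rule that)
qed

lemma partition_sum: "(\<Sum>n | g n x \<noteq> 0. g n x *\<^sub>R v) = (v::'w::real_vector)"
proof -
  obtain N where "\<forall>\<^sub>F y in nhds x. (\<forall>n\<ge>N. g n y = 0) \<and> (\<Sum>n<N. g n y) = 1" using loc_fin by blast
  then have N: "\<forall>n\<ge>N. g n x = 0" "(\<Sum>n<N. g n x) = 1" using eventually_nhds_x_imp_x by blast+
  then have "{n. g n x \<noteq> 0} \<subseteq> {..<N}" by (auto simp: not_le[symmetric])
  then have "(\<Sum>n | g n x \<noteq> 0. g n x *\<^sub>R v) = (\<Sum>n<N. g n x *\<^sub>R v)"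
    by (intro sum.mono_neutral_left) auto
  also have "\<dots> = v" by (simp add: N(2) flip: scaleR_left.sum)
  finally show ?thesis .
qed

lemma glue_connection:
  assumes \<beta>: "\<And>n e. \<beta> n e \<in> one_forms A (pullback F V)"
    and \<beta>_linear: "\<And>n x X. linear (\<lambda>e. \<beta> n e x X)"
  shows "glue g \<psi> \<beta> \<in> connections A (pullback F V)"
proof (rule P.connectionI)
  note lc = U \<beta> \<beta>_linear
  show "glue g \<psi> \<beta> \<xi> = 0" if "\<xi> \<notin> sections A (pullback F V)" for \<xi>
    using that by (simp add: glue_def fun_eq_iff)
  show "glue g \<psi> \<beta> (\<lambda>x. \<xi> x + \<eta> x) x X = glue g \<psi> \<beta> \<xi> x X + glue g \<psi> \<beta> \<eta> x X"
    if s: "\<xi> \<in> sections A (pullback F V)" "\<eta> \<in> sections A (pullback F V)" "X \<in> tangent_space A x"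
    for \<xi> \<eta> x X
    using s by (auto simp: glue_def P.section_add local_conn_add[OF lc partition_support s]
        scaleR_add_right sum.distrib[symmetric] intro!: sum.cong)
  show "glue g \<psi> \<beta> (\<lambda>y. f y *\<^sub>R \<xi> y) x X = dvec A f x X *\<^sub>R \<xi> x + f x *\<^sub>R glue g \<psi> \<beta> \<xi> x X"
    if s: "\<And>x. A.msmooth x f" "\<xi> \<in> sections A (pullback F V)" "X \<in> tangent_space A x" for f \<xi> x X
  proof -
    have "(\<Sum>n | g n (F x) \<noteq> 0. g n (F x) *\<^sub>R local_conn (\<psi> n) (\<beta> n) (\<lambda>y. f y *\<^sub>R \<xi> y) x X) =
        (\<Sum>n | g n (F x) \<noteq> 0. g n (F x) *\<^sub>R (dvec A f x X *\<^sub>R \<xi> x) +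
          f x *\<^sub>R (g n (F x) *\<^sub>R local_conn (\<psi> n) (\<beta> n) \<xi> x X))"
      by (intro sum.cong refl)
         (simp add: local_conn_leibniz[OF lc partition_support s] scaleR_add_right mult.commute)
    then show ?thesis
      using s P.section_scaleR[OF s(1,2)]
      by (simp only: glue_def sum.distrib partition_sum simp_thms if_True scaleR_right.sum[symmetric])
  qed
  fix \<xi> assume s: "\<xi> \<in> sections A (pullback F V)"
  show "glue g \<psi> \<beta> \<xi> \<in> one_forms A (pullback F V)"
  proof (rule P.one_formI)
    show "glue g \<psi> \<beta> \<xi> x X = 0" if "X \<notin> tangent_space A x" for x X using that by (simp add: glue_def)
    show "linear_between (tangent_space A x) (fibre (pullback F V) x) (glue g \<psi> \<beta> \<xi> x)" for x
    proof (rule linear_betweenI)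
      note lin = linear_betweenD[OF local_conn_linear_form[OF lc partition_support s]]
      note sub = subspace_add[OF A.subspace_tangent_space] subspace_scale[OF A.subspace_tangent_space]
      show "glue g \<psi> \<beta> \<xi> x X \<in> fibre (pullback F V) x" if "X \<in> tangent_space A x" for X
        using that s
        by (auto simp: glue_def intro!: subspace_sum[OF B.subspace_fibre] subspace_scale[OF B.subspace_fibre] lin(1))
      show "glue g \<psi> \<beta> \<xi> x (X + Y) = glue g \<psi> \<beta> \<xi> x X + glue g \<psi> \<beta> \<xi> x Y"
        if "X \<in> tangent_space A x" "Y \<in> tangent_space A x" for X Y
        using that s by (auto simp: glue_def sub lin(2) scaleR_add_right sum.distrib[symmetric] intro!: sum.cong)
      show "glue g \<psi> \<beta> \<xi> x (r *\<^sub>R X) = r *\<^sub>R glue g \<psi> \<beta> \<xi> x X"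
        if "X \<in> tangent_space A x" for X r
        using that s by (auto simp: glue_def sub lin(3) scaleR_right.sum mult.commute intro!: sum.cong)
    qed
    fix p
    obtain W \<theta> where W: "(W, \<theta>) \<in> trivs V" "F p \<in> W" using B.ex_triv by blast
    have "A.msmooth p (\<lambda>x. \<theta> (F x) (glue g \<psi> \<beta> \<xi> x (coord_vector A (U', c) e x)))"
      if U': "(U', c) \<in> A" "p \<in> U'" for U' c e
    proof -
      let ?X = "coord_vector A (U', c) e"
      obtain N where N: "\<forall>\<^sub>F y in nhds (F p). \<forall>G::nat \<Rightarrow> 'f.
          (\<Sum>n | g n y \<noteq> 0. g n y *\<^sub>R G n) = (\<Sum>n<N. g n y *\<^sub>R G n)"
        using partition_finite_sum by blast
      have "A.msmooth p (\<lambda>x. g n (F x) *\<^sub>R \<theta> (F x) (local_conn (\<psi> n) (\<beta> n) \<xi> x (?X x)))" for n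
      proof (cases "F p \<in> U n")
        case True
        then show ?thesis
          by (intro A.msmooth_scaleR msmooth_compose[OF g(1)] local_conn_msmooth[OF lc U' _ W s])
      next
        case False
        then have "\<forall>\<^sub>F y in nhds (F p). y \<in> - K n"
          using g(2,4) by (intro eventually_nhds_in_open) auto
        from eventually_map[OF this]
        have "\<forall>\<^sub>F x in nhds p. 0 = g n (F x) *\<^sub>R \<theta> (F x) (local_conn (\<psi> n) (\<beta> n) \<xi> x (?X x))"
          by eventually_elim (simp add: g(3))
        from A.msmooth_cong[OF this A.msmooth_const] show ?thesis .
      qed
      then have "A.msmooth p (\<lambda>x. \<Sum>n<N. g n (F x) *\<^sub>R \<theta> (F x) (local_conn (\<psi> n) (\<beta> n) \<xi> x (?X x)))"
        by (rule A.msmooth_sum)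
      moreover have "\<forall>\<^sub>F x in nhds p.
          (\<Sum>n<N. g n (F x) *\<^sub>R \<theta> (F x) (local_conn (\<psi> n) (\<beta> n) \<xi> x (?X x))) =
          \<theta> (F x) (glue g \<psi> \<beta> \<xi> x (?X x))"
        using eventually_map[OF N] eventually_map[OF B.triv_eventually[OF W]]
          eventually_nhds_in_open[OF A.chart_open[OF U'(1)] U'(2)]
      proof eventually_elim
        case (elim x)
        note tl = B.triv_linear[OF W(1) elim(2)]
        note fib = local_conn_fibre[OF lc partition_support]
        have "\<theta> (F x) (glue g \<psi> \<beta> \<xi> x (?X x)) =
            \<theta> (F x) (\<Sum>n | g n (F x) \<noteq> 0. g n (F x) *\<^sub>R local_conn (\<psi> n) (\<beta> n) \<xi> x (?X x))"
          using s A.coord_vector_tangent[OF U'(1) elim(3)] by (simp add: glue_def)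
        also have "\<dots> = (\<Sum>n | g n (F x) \<noteq> 0. \<theta> (F x) (g n (F x) *\<^sub>R local_conn (\<psi> n) (\<beta> n) \<xi> x (?X x)))"
          by (rule linear_between_sum[OF tl B.subspace_fibre])
             (auto intro!: subspace_scale[OF B.subspace_fibre] fib)
        also have "\<dots> = (\<Sum>n | g n (F x) \<noteq> 0. g n (F x) *\<^sub>R \<theta> (F x) (local_conn (\<psi> n) (\<beta> n) \<xi> x (?X x)))"
          by (intro sum.cong refl) (auto intro!: linear_betweenD(3)[OF tl] fib)
        finally show ?case using elim(1) by simp
      qed
      ultimately show ?thesis by (rule A.msmooth_cong[rotated])
    qed
    with pullback_triv[OF W(1)] W(2)
    show "\<exists>W \<theta>. (W, \<theta>) \<in> trivs (pullback F V) \<and> p \<in> W \<and> (\<forall>U c e. (U, c) \<in> A \<longrightarrow> p \<in> U \<longrightarrow>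
        A.msmooth p (\<lambda>x. \<theta> x (glue g \<psi> \<beta> \<xi> x (coord_vector A (U, c) e x))))"
      by (intro exI[of _ "F -` W"] exI[of _ "\<lambda>x. \<theta> (F x)"]) simp
  qed
qed

end

lemma triv_partition:
  obtains U :: "nat \<Rightarrow> 'b set" and \<psi> and g h :: "nat \<Rightarrow> 'b \<Rightarrow> real" and K C where "\<And>n. (U n, \<psi> n) \<in> trivs V"
    and "\<And>n x. B.msmooth x (g n)" "\<And>n. closed (K n)" "\<And>n x. x \<notin> K n \<Longrightarrow> g n x = 0" "\<And>n. K n \<subseteq> U n"
    and "\<And>x. \<exists>N. \<forall>\<^sub>F y in nhds x. (\<forall>n\<ge>N. g n y = 0) \<and> (\<Sum>n<N. g n y) = (1::real)"
    and "\<And>n x. B.msmooth x (h n)" "\<And>n. closed (C n)" "\<And>n. C n \<subseteq> U n" "\<And>n x. x \<notin> C n \<Longrightarrow> h n x = (0::real)"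
    and "\<And>n x. x \<in> K n \<Longrightarrow> \<forall>\<^sub>F y in nhds x. h n y = 1"
proof -
  have cover: "(\<Union>T\<in>trivs V. fst T) = UNIV"
  proof -
    have "x \<in> (\<Union>T\<in>trivs V. fst T)" for x using B.ex_triv[of x] by force
    then show ?thesis by blast
  qed
  have op: "open (fst T)" if "T \<in> trivs V" for T
    using B.triv_open[of "fst T" "snd T"] that by simp
  show thesis
  proof (rule B.partition_of_unity[of "trivs V" fst, OF op cover])
    fix i and g h :: "nat \<Rightarrow> 'b \<Rightarrow> real" and K C
    assume *: "\<And>n. i n \<in> trivs V"
      "\<And>n x. B.msmooth x (g n)" "\<And>n. closed (K n)" "\<And>n x. x \<notin> K n \<Longrightarrow> g n x = 0"
      "\<And>n x. B.msmooth x (h n)" "\<And>n. closed (C n)" "\<And>n. C n \<subseteq> fst (i n)" "\<And>n x. x \<notin> C n \<Longrightarrow> h n x = 0"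
      "\<And>n x. x \<in> K n \<Longrightarrow> \<forall>\<^sub>F y in nhds x. h n y = 1"
      "\<And>x. \<exists>N. \<forall>\<^sub>F y in nhds x. (\<forall>n\<ge>N. g n y = 0) \<and> (\<Sum>n<N. g n y) = 1"
    have K: "K n \<subseteq> fst (i n)" for n
    proof
      fix x assume "x \<in> K n"
      from eventually_nhds_x_imp_x[OF *(9)[OF this]] have "x \<in> C n" using *(8)[of x n] by auto
      then show "x \<in> fst (i n)" using *(7) by blast
    qed
    show thesis
      by (rule that[of "\<lambda>n. fst (i n)" "\<lambda>n. snd (i n)" g K h C])
         (simp_all add: * K)
  qed
qed

text \<open>The local connections are defined by the Christoffel symbols of \<open>nabla\<close>. On the support of \<open>g\<^sub>n\<close> the
  \<open>n\<close>-th one has the required values on pulled back sections by \<open>conn_formula\<close>, and so has the average.\<close>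

lemma ex_pullback_connection:
  assumes nabla: "nabla \<in> connections B V"
  shows "\<exists>D. is_pullback nabla D"
proof -
  show ?thesis
  proof (rule triv_partition)
    fix U :: "nat \<Rightarrow> 'b set" and \<psi> and g h :: "nat \<Rightarrow> 'b \<Rightarrow> real" and K C
    assume U: "\<And>n. (U n, \<psi> n) \<in> trivs V"
      and g: "\<And>n x. B.msmooth x (g n)" "\<And>n. closed (K n)" "\<And>n x. x \<notin> K n \<Longrightarrow> g n x = 0" "\<And>n. K n \<subseteq> U n"
      "\<And>x. \<exists>N. \<forall>\<^sub>F y in nhds x. (\<forall>n\<ge>N. g n y = 0) \<and> (\<Sum>n<N. g n y) = 1"
      and h: "\<And>n x. B.msmooth x (h n)" "\<And>n. closed (C n)" "\<And>n. C n \<subseteq> U n" "\<And>n x. x \<notin> C n \<Longrightarrow> h n x = 0"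
      "\<And>n x. x \<in> K n \<Longrightarrow> \<forall>\<^sub>F y in nhds x. h n y = 1"
    define \<beta> where "\<beta> n e = (\<lambda>x X. if X \<in> tangent_space A x
      then nabla (B.lsec (\<psi> n) (h n) e) (F x) (differential A B F x X) else 0)" for n e
    have ls: "B.lsec (\<psi> n) (h n) e \<in> sections B V" for n e
      by (rule B.lsec_section[OF U h(1-4)])
    have \<beta>: "\<beta> n e \<in> one_forms A (pullback F V)" for n e
      unfolding \<beta>_def by (rule pullback_form[OF B.conn_form[OF nabla ls]])
    have ls_add: "B.lsec (\<psi> n) (h n) (e + e') = (\<lambda>x. B.lsec (\<psi> n) (h n) e x + B.lsec (\<psi> n) (h n) e' x)"
      and ls_scale: "B.lsec (\<psi> n) (h n) (r *\<^sub>R e) = (\<lambda>x. r *\<^sub>R B.lsec (\<psi> n) (h n) e x)" for n e e' r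
    proof -
      have "h n x *\<^sub>R B.tinv (\<psi> n) x (e + e') = h n x *\<^sub>R B.tinv (\<psi> n) x e + h n x *\<^sub>R B.tinv (\<psi> n) x e' \<and>
        h n x *\<^sub>R B.tinv (\<psi> n) x (r *\<^sub>R e) = r *\<^sub>R h n x *\<^sub>R B.tinv (\<psi> n) x e" for x
      proof (cases "x \<in> C n")
        case True
        then have "x \<in> U n" using h(3) by blast
        from linear_betweenD(2,3)[OF B.tinv_linear[OF U this]] show ?thesis by (simp add: scaleR_add_right)
      qed (simp add: h(4))
      then show "B.lsec (\<psi> n) (h n) (e + e') = (\<lambda>x. B.lsec (\<psi> n) (h n) e x + B.lsec (\<psi> n) (h n) e' x)"
        "B.lsec (\<psi> n) (h n) (r *\<^sub>R e) = (\<lambda>x. r *\<^sub>R B.lsec (\<psi> n) (h n) e x)"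
        unfolding B.lsec_def[abs_def] by auto
    qed
    have \<beta>_linear: "linear (\<lambda>e. \<beta> n e x X)" for n x X
      by (rule linearI)
         (simp_all add: \<beta>_def ls_add ls_scale B.conn_add[OF nabla ls ls] B.conn_scaleR[OF nabla ls])
    note glue = glue_connection[OF U g \<beta> \<beta>_linear]
    have "glue g \<psi> \<beta> (\<eta> \<circ> F) x X = nabla \<eta> (F x) (differential A B F x X)"
      if s: "\<eta> \<in> sections B V" and X: "X \<in> tangent_space A x" for \<eta> x X
    proof -
      let ?Y = "differential A B F x X"
      note Y = differential_tangent[OF X]
      have s': "\<eta> \<circ> F \<in> sections A (pullback F V)" using pullback_section[OF s] by (simp add: o_def)
      have "local_conn (\<psi> n) (\<beta> n) (\<eta> \<circ> F) x X = nabla \<eta> (F x) ?Y" if n: "g n (F x) \<noteq> 0" for n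
      proof -
        have k: "F x \<in> K n" "F x \<in> U n" using n g(3,4) by auto
        have "\<forall>\<^sub>F y in nhds (F x). B.lsec (\<psi> n) (h n) e y = B.tinv (\<psi> n) y e" for e
          using h(5)[OF k(1)] by eventually_elim (simp add: B.lsec_def)
        from B.christoffel_eqI[OF nabla U k(2) Y ls this]
        have c: "\<psi> n (F x) (\<beta> n e x X) = B.christoffel nabla (\<psi> n) (F x) ?Y e" for e
          using X by (simp add: \<beta>_def)
        show ?thesis
        proof (rule B.triv_inject[OF U k(2) local_conn_fibre[OF U \<beta> \<beta>_linear k(2)]])
          show "nabla \<eta> (F x) ?Y \<in> fibre V (F x)" by (rule B.one_form_fibre[OF B.conn_form[OF nabla s]])
          show "\<psi> n (F x) (local_conn (\<psi> n) (\<beta> n) (\<eta> \<circ> F) x X) = \<psi> n (F x) (nabla \<eta> (F x) ?Y)"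
            using dvec_compose[OF X B.section_msmooth[OF s U k(2)]]
            by (simp add: triv_local_conn[OF U \<beta> \<beta>_linear k(2)] c B.conn_formula[OF nabla U k(2) Y s])
        qed
      qed
      then have "(\<Sum>n | g n (F x) \<noteq> 0. g n (F x) *\<^sub>R local_conn (\<psi> n) (\<beta> n) (\<eta> \<circ> F) x X) =
          (\<Sum>n | g n (F x) \<noteq> 0. g n (F x) *\<^sub>R nabla \<eta> (F x) ?Y)"
        by (intro sum.cong) auto
      then show ?thesis using s' X by (simp add: glue_def partition_sum[OF U g])
    qed
    with glue have "is_pullback nabla (glue g \<psi> \<beta>)" by (simp add: is_pullback_def)
    then show "\<exists>D. is_pullback nabla D" by (rule exI[where x = "glue g \<psi> \<beta>"])
  qed
qed

lemma is_pullback_pullback_connection: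
  assumes "nabla \<in> connections B V"
  shows "is_pullback nabla (pullback_connection A B F V nabla)"
proof -
  obtain D where D: "is_pullback nabla D" using ex_pullback_connection[OF assms] by blast
  have "pullback_connection A B F V nabla = (THE D. is_pullback nabla D)"
    by (simp add: pullback_connection_def is_pullback_def)
  also have "\<dots> = D"
    using D is_pullback_unique[OF assms] by (intro the_equality) auto
  finally show ?thesis using D by simp
qed

end

lemma (in manifold) smooth_map_ident: "smooth_map A A (\<lambda>x. x)"
proof -
  have "smooth_on (c ` (U \<inter> W)) (d \<circ> inv_into U c)" if "(U, c) \<in> A" "(W, d) \<in> A" for U c W d
    using atlas that unfolding smooth_atlas_def by blast
  then show ?thesis unfolding smooth_map_def by (auto simp: comp_def continuous_on_id)
qed

context vbundle_over
begin

text \<open>Average the flat connections of local trivializations; this is the gluing construction for the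
  identity map and \<open>\<beta> = 0\<close>.\<close>

lemma ex_connection: "\<exists>D. D \<in> connections A V"
proof -
  interpret id: bundle_pullback A A "\<lambda>x. x" V
    by unfold_locales (rule smooth_map_ident)
  have V: "pullback (\<lambda>x. x) V = V" by (simp add: pullback_def case_prod_beta)
  show ?thesis
  proof (rule id.triv_partition)
    fix U :: "nat \<Rightarrow> 'a set" and \<psi> and g h :: "nat \<Rightarrow> 'a \<Rightarrow> real" and K C
    assume U: "\<And>n. (U n, \<psi> n) \<in> trivs V"
      and g: "\<And>n x. msmooth x (g n)" "\<And>n. closed (K n)" "\<And>n x. x \<notin> K n \<Longrightarrow> g n x = 0" "\<And>n. K n \<subseteq> U n"
      "\<And>x. \<exists>N. \<forall>\<^sub>F y in nhds x. (\<forall>n\<ge>N. g n y = 0) \<and> (\<Sum>n<N. g n y) = 1"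
    have "id.glue g \<psi> (\<lambda>n e. 0) \<in> connections A (pullback (\<lambda>x. x) V)"
      by (rule id.glue_connection[OF U g id.P.one_form_0]) (assumption, rule linearI, simp_all)
    then show ?thesis unfolding V by (rule exI[where x = "id.glue g \<psi> (\<lambda>n e. 0)"])
  qed
qed

end

section \<open>Curves of composable arrows\<close>

lemma eventually_nhds_ball:
  fixes x :: "'a::metric_space"
  assumes "\<forall>\<^sub>F y in nhds x. P y"
  obtains \<delta> where "\<delta> > 0" "\<And>y. dist y x < \<delta> \<Longrightarrow> P y"
  using assms unfolding eventually_nhds_metric by blast

text \<open>The mean value estimate for \<open>f\<close> minus its derivative at \<open>x\<close>. Near \<open>x\<close> the derivative of this difference
  has small operator norm, because the finitely many directional derivatives along the basis are
  continuous.\<close>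

lemma smooth_at_strict_derivative:
  fixes f :: "'a::fin_dim_normed \<Rightarrow> 'b::fin_dim_normed"
  assumes "smooth_at x f" "\<epsilon> > 0"
  obtains \<delta> where "\<delta> > 0" "\<And>y z. dist y x < \<delta> \<Longrightarrow> dist z x < \<delta> \<Longrightarrow>
    norm (f y - f z - frechet_derivative f (at x) (y - z)) \<le> \<epsilon> * norm (y - z)"
proof -
  let ?D = "\<lambda>y. frechet_derivative f (at y)"
  obtain C where C: "C > 0" "\<forall>x::'a. (\<Sum>b\<in>fbasis. \<bar>fcoord b x\<bar>) \<le> C * norm x"
    using fcoord_norm_bound by blast
  have "\<forall>\<^sub>F y in nhds x. norm (?D y b - ?D x b) < \<epsilon> / C" for b
  proof -
    have "((\<lambda>y. ?D y b) \<longlongrightarrow> ?D x b) (nhds x)"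
      using smooth_at_isCont[OF smooth_at_frechet_derivative[OF assms(1), of b]]
      unfolding continuous_at by (rule tendsto_at_iff_tendsto_nhds[where g = "\<lambda>y. ?D y b", THEN iffD1])
    then show ?thesis
      using tendstoD[of "\<lambda>y. ?D y b" "?D x b" "nhds x" "\<epsilon> / C"] assms(2) C(1) by (simp add: dist_norm)
  qed
  then have "\<forall>\<^sub>F y in nhds x. \<forall>b\<in>fbasis. norm (?D y b - ?D x b) < \<epsilon> / C"
    by (intro eventually_ball_finite fbasis) auto
  from eventually_conj[OF this eventually_smooth_at[OF assms(1)]]
  obtain \<delta> where \<delta>: "\<delta> > 0" and
    \<delta>': "\<And>y. dist y x < \<delta> \<Longrightarrow> (\<forall>b\<in>fbasis. norm (?D y b - ?D x b) < \<epsilon> / C) \<and> smooth_at y f"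
    by (rule eventually_nhds_ball) blast
  have lin: "linear (?D y)" if "smooth_at y f" for y
    by (rule has_derivative_linear[OF smooth_at_has_derivative[OF that]])
  have bound: "norm (?D y w - ?D x w) \<le> \<epsilon> * norm w" if "dist y x < \<delta>" for y w
  proof -
    have "?D y w - ?D x w = (\<Sum>b\<in>fbasis. fcoord b w *\<^sub>R (?D y b - ?D x b))"
      using linear_expand[OF lin[OF conjunct2[OF \<delta>'[OF that]]], of w] linear_expand[OF lin[OF assms(1)], of w]
      by (simp add: scaleR_diff_right sum_subtractf)
    also have "norm \<dots> \<le> (\<Sum>b\<in>fbasis. \<bar>fcoord b w\<bar> * (\<epsilon> / C))"
    proof (rule sum_norm_le)
      fix b :: 'a assume "b \<in> fbasis"
      then have "norm (?D y b - ?D x b) \<le> \<epsilon> / C" using \<delta>'[OF that] by (auto intro: less_imp_le)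
      then show "norm (fcoord b w *\<^sub>R (?D y b - ?D x b)) \<le> \<bar>fcoord b w\<bar> * (\<epsilon> / C)"
        unfolding norm_scaleR by (rule mult_left_mono) simp
    qed
    also have "\<dots> = (\<Sum>b\<in>fbasis. \<bar>fcoord b w\<bar>) * (\<epsilon> / C)" by (simp only: sum_distrib_right)
    also have "\<dots> \<le> C * norm w * (\<epsilon> / C)"
      using C assms(2) by (intro mult_right_mono) auto
    also have "\<dots> = \<epsilon> * norm w" using C(1) by simp
    finally show ?thesis .
  qed
  show thesis
  proof (rule that[OF \<delta>])
    fix y z assume yz: "dist y x < \<delta>" "dist z x < \<delta>"
    have "norm ((f y - ?D x y) - (f z - ?D x z)) \<le> \<epsilon> * norm (y - z)"
    proof (rule differentiable_bound[where S = "ball x \<delta>" and f' = "\<lambda>y w. ?D y w - ?D x w"])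
      fix w assume "w \<in> ball x \<delta>"
      then have w: "dist w x < \<delta>" by (simp add: dist_commute)
      show "((\<lambda>y. f y - ?D x y) has_derivative (\<lambda>v. ?D w v - ?D x v)) (at w within ball x \<delta>)"
        using \<delta>'[OF w] lin[OF assms(1)]
        by (intro has_derivative_diff has_derivative_at_withinI[OF smooth_at_has_derivative]
            bounded_linear_imp_has_derivative fin_dim_bounded_linear) auto
      show "onorm (\<lambda>v. ?D w v - ?D x v) \<le> \<epsilon>"
        using assms(2) by (intro onorm_bound bound[OF w]) simp
    qed (use yz in \<open>auto simp: dist_commute\<close>)
    then show "norm (f y - f z - ?D x (y - z)) \<le> \<epsilon> * norm (y - z)"
      by (simp add: linear_diff[OF lin[OF assms(1)]] algebra_simps)
  qed
qed

lemma has_vector_derivative_zero_bound: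
  assumes "(q has_vector_derivative 0) (at 0)" "q 0 = 0" "u 0 = 0"
    and "\<forall>\<^sub>F t in nhds 0. norm (u t) \<le> K * norm (q t)"
  shows "(u has_vector_derivative 0) (at 0)"
proof -
  have "((\<lambda>h. norm (q h) / norm h) \<longlongrightarrow> 0) (at 0)"
    using assms(1,2) unfolding has_vector_derivative_def has_derivative_at by simp
  then have "((\<lambda>h. norm (u h) / norm h) \<longlongrightarrow> 0) (at 0)"
  proof (rule tendsto_0_le[where K = K])
    have "\<forall>\<^sub>F t in at 0. norm (u t) \<le> K * norm (q t)"
      using assms(4) unfolding eventually_at_filter by (rule eventually_mono) simp
    then show "\<forall>\<^sub>F t in at 0. norm (norm (u t) / norm t) \<le> norm (norm (q t) / norm t) * K"
      by eventually_elim (simp add: field_simps divide_right_mono)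
  qed
  then show ?thesis
    using assms(3) unfolding has_vector_derivative_def has_derivative_at by simp
qed

text \<open>Curves lift through a submersion with prescribed velocity. With \<open>R\<close> a right inverse of the
  derivative \<open>L\<close>, the lift is \<open>x(t) = x\<^sub>0 + t v + R u(t)\<close>, where \<open>u(t)\<close> is the fixed point of the
  contraction \<open>u \<mapsto> u - f(x\<^sub>0 + t v + R u) + y(t)\<close>. Its size is at most twice that of the image of 0,
  which is \<open>o(t)\<close>, so \<open>u\<close> does not contribute to the velocity.\<close>

lemma submersion_lift:
  fixes f :: "'a::fin_dim_normed \<Rightarrow> 'b::fin_dim_normed"
  assumes f: "smooth_at x0 f" and surj: "\<And>w. \<exists>v. frechet_derivative f (at x0) v = w"
    and y: "(y has_vector_derivative frechet_derivative f (at x0) v) (at 0)" "y 0 = f x0"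
  obtains x where "x 0 = x0" "(x has_vector_derivative v) (at 0)" "\<forall>\<^sub>F t in nhds 0. f (x t) = y t"
proof -
  define L where "L = frechet_derivative f (at x0)"
  have L: "linear L" "(f has_derivative L) (at x0)"
    unfolding L_def using smooth_at_has_derivative[OF f] has_derivative_linear by blast+
  obtain r where r: "\<And>w. L (r w) = w" using surj unfolding L_def by metis
  define R where "R u = (\<Sum>b\<in>fbasis. fcoord b u *\<^sub>R r b)" for u
  have R_bl: "bounded_linear R"
    unfolding R_def by (intro bounded_linear_sum bounded_linear_scaleR_const[OF bounded_linear_fcoord])
  have LR: "L (R u) = u" for u
    unfolding R_def by (simp add: linear_sum[OF L(1)] linear_scale[OF L(1)] r fcoord_sum)
  obtain M where M: "M > 0" "\<And>u. norm (R u) \<le> norm u * M"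
    using bounded_linear.pos_bounded[OF R_bl] by blast
  have "1 / (2 * M) > 0" using M(1) by simp
  from smooth_at_strict_derivative[OF f this] obtain \<delta> where \<delta>: "\<delta> > 0"
    and strict: "\<And>a b. dist a x0 < \<delta> \<Longrightarrow> dist b x0 < \<delta> \<Longrightarrow>
      norm (f a - f b - L (a - b)) \<le> 1 / (2 * M) * norm (a - b)"
    unfolding L_def by blast
  define q where "q t = f (x0 + t *\<^sub>R v) - y t" for t
  have line: "((\<lambda>t. x0 + t *\<^sub>R v) has_vector_derivative v) (at 0)"
    by (auto intro!: derivative_eq_intros)
  have "((\<lambda>t. f (x0 + t *\<^sub>R v)) has_vector_derivative L v) (at 0)"
    by (rule has_vector_derivative_compose[OF line]) (simp add: L(2))
  from has_vector_derivative_diff[OF this y(1)]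
  have q': "(q has_vector_derivative 0) (at 0)" unfolding q_def[abs_def] L_def by simp
  have q0: "q 0 = 0" by (simp add: q_def y(2))
  \<comment> \<open>at these times all candidates for the lift stay within \<open>\<delta>\<close> of \<open>x0\<close>\<close>
  define good where "good t \<longleftrightarrow> \<bar>t\<bar> * norm v + 2 * norm (q t) * M < \<delta>" for t
  have "((\<lambda>t. \<bar>t\<bar> * norm v + 2 * norm (q t) * M) \<longlongrightarrow> \<bar>0\<bar> * norm v + 2 * norm (q 0) * M) (nhds 0)"
  proof (intro tendsto_intros filterlim_ident)
    have "isCont q 0" using q' by (rule has_vector_derivative_continuous)
    then show "(q \<longlongrightarrow> q 0) (nhds 0)"
      unfolding continuous_at by (rule tendsto_at_iff_tendsto_nhds[THEN iffD1])
  qed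
  then have good: "\<forall>\<^sub>F t in nhds 0. good t"
    using order_tendstoD(2)[of _ _ "nhds 0" \<delta>] \<delta> unfolding good_def q0 by simp
  have "\<exists>u. norm u \<le> 2 * norm (q t) \<and> f (x0 + t *\<^sub>R v + R u) = y t" if "good t" for t
  proof -
    define S where "S = cball (0::'b) (2 * norm (q t))"
    define \<Phi> where "\<Phi> u = u - (f (x0 + t *\<^sub>R v + R u) - y t)" for u
    have near: "dist (x0 + t *\<^sub>R v + R u) x0 < \<delta>" if "u \<in> S" for u
    proof -
      have "norm u \<le> 2 * norm (q t)" using that by (simp add: S_def)
      then have "norm (R u) \<le> 2 * norm (q t) * M"
        using M order_trans[OF M(2) mult_right_mono] by simp
      then have "norm (t *\<^sub>R v + R u) \<le> \<bar>t\<bar> * norm v + 2 * norm (q t) * M"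
        by (intro order_trans[OF norm_triangle_ineq] add_mono) simp_all
      also have "\<dots> < \<delta>" using \<open>good t\<close> by (simp add: good_def)
      finally show ?thesis by (simp add: dist_norm add.assoc)
    qed
    have contr: "norm (\<Phi> u - \<Phi> w) \<le> 1 / 2 * norm (u - w)" if "u \<in> S" "w \<in> S" for u w
    proof -
      have "norm (\<Phi> u - \<Phi> w) = norm (f (x0 + t *\<^sub>R v + R u) - f (x0 + t *\<^sub>R v + R w) - L (R (u - w)))"
        unfolding LR by (subst norm_minus_commute) (simp add: \<Phi>_def algebra_simps)
      also have "\<dots> \<le> 1 / (2 * M) * norm (R (u - w))"
        using strict[OF near[OF that(1)] near[OF that(2)]]
        by (simp add: bounded_linear.linear[OF R_bl, THEN linear_diff])
      also have "\<dots> \<le> 1 / (2 * M) * (norm (u - w) * M)"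
        using M by (intro mult_left_mono) auto
      also have "\<dots> = 1 / 2 * norm (u - w)" using M(1) by simp
      finally show ?thesis .
    qed
    have "\<exists>!u\<in>S. \<Phi> u = u"
    proof (rule Banach_fix[where c = "1 / 2"])
      show "complete S" unfolding S_def by (intro compact_imp_complete fin_dim_compact) auto
      show "S \<noteq> {}" by (simp add: S_def)
      show "\<Phi> ` S \<subseteq> S"
      proof safe
        fix u assume u: "u \<in> S"
        have z: "0 \<in> S" by (simp add: S_def)
        have "norm (\<Phi> 0) = norm (q t)"
          by (simp add: \<Phi>_def q_def linear_0[OF bounded_linear.linear[OF R_bl]] norm_minus_commute)
        then have "norm (\<Phi> u) \<le> norm (q t) + 1 / 2 * norm u"
          using contr[OF u z] norm_triangle_sub[of "\<Phi> u" "\<Phi> 0"] by simp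
        also have "\<dots> \<le> 2 * norm (q t)" using u by (simp add: S_def)
        finally show "\<Phi> u \<in> S" by (simp add: S_def)
      qed
      show "dist (\<Phi> u) (\<Phi> w) \<le> 1 / 2 * dist u w" if "u \<in> S" "w \<in> S" for u w
        using contr[OF that] by (simp add: dist_norm)
    qed auto
    then obtain u where "u \<in> S" "\<Phi> u = u" by blast
    then show ?thesis by (intro exI[of _ u]) (simp add: S_def \<Phi>_def)
  qed
  then have "\<forall>t. \<exists>u. good t \<longrightarrow> norm u \<le> 2 * norm (q t) \<and> f (x0 + t *\<^sub>R v + R u) = y t" by blast
  from choice[OF this] obtain u where
    u: "\<And>t. good t \<Longrightarrow> norm (u t) \<le> 2 * norm (q t) \<and> f (x0 + t *\<^sub>R v + R (u t)) = y t" by blast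
  have "good 0" by (rule eventually_nhds_x_imp_x[OF good])
  with u[of 0] have u0: "u 0 = 0" by (simp add: q0)
  have ev: "\<forall>\<^sub>F t in nhds 0. norm (u t) \<le> 2 * norm (q t)"
    using good by eventually_elim (use u in blast)
  have "(u has_vector_derivative 0) (at 0)"
    by (rule has_vector_derivative_zero_bound[OF q' q0 u0 ev])
  from has_vector_derivative_add[OF line bounded_linear.has_vector_derivative[OF R_bl this]]
  have "((\<lambda>t. x0 + t *\<^sub>R v + R (u t)) has_vector_derivative v) (at 0)"
    by (simp add: linear_0[OF bounded_linear.linear[OF R_bl]])
  moreover have "\<forall>\<^sub>F t in nhds 0. f (x0 + t *\<^sub>R v + R (u t)) = y t"
    using good by eventually_elim (use u in blast)
  ultimately show thesis
    using that[of "\<lambda>t. x0 + t *\<^sub>R v + R (u t)"] u0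
    by (simp add: linear_0[OF bounded_linear.linear[OF R_bl]])
qed

locale Lie_groupoid =
  fixes G :: "('m::{t2_space, second_countable_topology}, 'e::fin_dim_normed,
               'g::{t2_space, second_countable_topology}, 'k::fin_dim_normed) groupoid"
  assumes lie: "lie_groupoid G"
begin

abbreviation "s \<equiv> src G"
abbreviation "t \<equiv> tgt G"
abbreviation "ds \<equiv> differential (arrs G) (objs G) (src G)"
abbreviation "dt \<equiv> differential (arrs G) (objs G) (tgt G)"
abbreviation "TG \<equiv> tangent_space (arrs G)"

lemma laws: "groupoid_laws G"
  using lie unfolding lie_groupoid_def by blast

sublocale M: manifold "objs G"
  using lie unfolding lie_groupoid_def by unfold_locales blast

sublocale G: manifold "arrs G"
  using lie unfolding lie_groupoid_def by unfold_locales blast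

sublocale S: manifold_map "arrs G" "objs G" "src G"
  using lie unfolding lie_groupoid_def submersion_def by unfold_locales blast

sublocale T: manifold_map "arrs G" "objs G" "tgt G"
  using lie unfolding lie_groupoid_def submersion_def by unfold_locales blast

sublocale I: manifold_map "arrs G" "arrs G" "ginv G"
  using lie unfolding lie_groupoid_def by unfold_locales blast

lemma src_ginv [simp]: "s (ginv G g) = t g" and tgt_ginv [simp]: "t (ginv G g) = s g"
  using laws unfolding groupoid_laws_def by blast+

lemma tgt_idt [simp]: "t (idt G x) = x"
  using laws unfolding groupoid_laws_def by blast

lemma src_mult: "s g = t h \<Longrightarrow> s (mult G g h) = s h"
  and tgt_mult: "s g = t h \<Longrightarrow> t (mult G g h) = t g"
  using laws unfolding groupoid_laws_def by blast+

lemma mult_ginv_left: "mult G (ginv G g) g = idt G (s g)"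
  using laws unfolding groupoid_laws_def by blast

lemma mult_assoc: "s g = t h \<Longrightarrow> s h = t k \<Longrightarrow> mult G (mult G g h) k = mult G g (mult G h k)"
  using laws unfolding groupoid_laws_def by blast

lemma mult_idt: "mult G g (idt G (s g)) = g" "mult G (idt G (t g)) g = g"
  using laws unfolding groupoid_laws_def by blast+

lemma ginv_ginv: "ginv G (ginv G g) = g"
proof -
  let ?i = "ginv G g"
  have "ginv G ?i = mult G (ginv G ?i) (mult G ?i g)"
    using mult_idt(1)[of "ginv G ?i"] by (simp add: mult_ginv_left)
  also have "\<dots> = mult G (mult G (ginv G ?i) ?i) g" by (rule mult_assoc[symmetric]) simp_all
  also have "\<dots> = g" using mult_idt(2)[of g] by (simp add: mult_ginv_left)
  finally show ?thesis .
qed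

lemma ds_surj:
  assumes "Y \<in> tangent_space (objs G) (s g)"
  shows "\<exists>X\<in>TG g. ds g X = Y"
proof -
  have "ds g ` TG g = tangent_space (objs G) (s g)"
    using lie unfolding lie_groupoid_def submersion_def by blast
  with assms have "Y \<in> ds g ` TG g" by simp
  then show ?thesis by (elim imageE) (rule bexI, simp_all)
qed

text \<open>The composable pairs form the fibre product of \<open>s\<close> and \<open>t\<close>. Start with any curve \<open>b\<close> with velocity
  \<open>Y\<close> and lift its target curve through the submersion \<open>s\<close> to a curve with velocity \<open>X\<close>.\<close>

lemma composable_curves:
  assumes "s g = t h" "(X, Y) \<in> composable_tangents G g h"
  obtains a b where "a 0 = g" "b 0 = h" "velocity (arrs G) a X" "velocity (arrs G) b Y"
    "\<forall>\<^sub>F \<tau> in nhds 0. s (a \<tau>) = t (b \<tau>)"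
proof -
  have X: "X \<in> TG g" and Y: "Y \<in> TG h" and XY: "ds g X = dt h Y"
    using assms(2) by (auto simp: composable_tangents_def)
  obtain b where b: "b 0 = h" "velocity (arrs G) b Y" using G.velocity_exists[OF Y] .
  obtain U c where U: "(U, c) \<in> arrs G" "g \<in> U" using G.ex_chart by blast
  obtain W e where W: "(W, e) \<in> objs G" "s g \<in> W" using M.ex_chart by blast
  note W' = W(2)[unfolded assms(1)]
  define f where "f = (\<lambda>y. e (s (inv_into U c y)))"
  have es: "G.msmooth g (\<lambda>x. e (s x))" by (rule S.msmooth_coord[OF W])
  have f: "smooth_at (c g) f" unfolding f_def by (rule G.msmoothD[OF es U])
  have Df: "frechet_derivative f (at (c g)) (Z (U, c)) = ds g Z (W, e)" if "Z \<in> TG g" for Z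
    unfolding S.differential_chart[OF W] G.dvec_chart[OF that es U] f_def ..
  have surj: "\<exists>v. frechet_derivative f (at (c g)) v = w" for w
  proof -
    obtain Z where "Z \<in> TG g" "ds g Z = coord_vector (objs G) (W, e) w (s g)"
      using ds_surj[OF M.coord_vector_tangent[OF W]] by blast
    with Df[of Z] M.coord_vector_chart[OF W] show ?thesis by metis
  qed
  have et: "G.msmooth (b 0) (\<lambda>x. e (t x))" unfolding b(1) by (rule T.msmooth_coord[OF W(1) W'])
  have "((\<lambda>\<tau>. e (t (b \<tau>))) has_vector_derivative dt h Y (W, e)) (at 0)"
    using G.velocity_fun[OF b(2) et] unfolding b(1) T.differential_chart[OF W(1) W'] .
  then have y: "((\<lambda>\<tau>. e (t (b \<tau>))) has_vector_derivative frechet_derivative f (at (c g)) (X (U, c))) (at 0)"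
    unfolding Df[OF X] XY .
  have y0: "e (t (b 0)) = f (c g)" by (simp add: f_def G.chart_inv[OF U] b(1) assms(1))
  from submersion_lift[OF f surj y y0] obtain x where x: "x 0 = c g"
    "(x has_vector_derivative X (U, c)) (at 0)" "\<forall>\<^sub>F \<tau> in nhds 0. f (x \<tau>) = e (t (b \<tau>))" by blast
  define a where "a \<tau> = inv_into U c (x \<tau>)" for \<tau>
  have a0: "a 0 = g" by (simp add: a_def x(1) G.chart_inv[OF U])
  have "isCont x 0" using x(2) by (rule has_vector_derivative_continuous)
  then have "(x \<longlongrightarrow> x 0) (nhds 0)"
    unfolding continuous_at by (rule tendsto_at_iff_tendsto_nhds[THEN iffD1])
  then have x_lim: "(x \<longlongrightarrow> c g) (nhds 0)" by (simp add: x(1))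
  have x_ev: "\<forall>\<^sub>F \<tau> in nhds 0. P (x \<tau>)" if "\<forall>\<^sub>F y in nhds (c g). P y" for P
    using x_lim that unfolding filterlim_iff by blast
  have a_lim: "(a \<longlongrightarrow> g) (nhds 0)"
    unfolding filterlim_iff
  proof (intro allI impI)
    fix P assume "eventually P (nhds g)"
    then have "\<forall>\<^sub>F y in nhds (c g). P (inv_into U c y)" using G.nhds_chart[OF U, of P] by blast
    from x_ev[OF this] show "\<forall>\<^sub>F \<tau> in nhds 0. P (a \<tau>)" unfolding a_def .
  qed
  have "\<forall>\<^sub>F \<tau> in nhds 0. x \<tau> \<in> c ` U"
    using U(2) by (intro x_ev eventually_nhds_in_open G.chart_open_image[OF U(1)]) auto
  then have "\<forall>\<^sub>F \<tau> in nhds 0. x \<tau> = c (a \<tau>)"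
    by eventually_elim (simp add: a_def f_inv_into_f)
  from has_vector_derivative_cong_nhds[OF x(2) this]
  have a_vel: "velocity (arrs G) a X" using G.velocityI[OF _ _ U(1)] X a_lim U(2) a0 by simp
  have "\<forall>\<^sub>F \<tau> in nhds 0. s (a \<tau>) \<in> W"
    by (rule G.velocity_eventually[OF a_vel])
       (simp add: a0 S.eventually_map[OF eventually_nhds_in_open[OF M.chart_open[OF W(1)] W(2)]])
  moreover have "\<forall>\<^sub>F \<tau> in nhds 0. t (b \<tau>) \<in> W"
    by (rule G.velocity_eventually[OF b(2)])
       (simp add: b(1) T.eventually_map[OF eventually_nhds_in_open[OF M.chart_open[OF W(1)] W']])
  ultimately have "\<forall>\<^sub>F \<tau> in nhds 0. s (a \<tau>) = t (b \<tau>)"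
    using x(3)
  proof eventually_elim
    case (elim \<tau>)
    then have "e (s (a \<tau>)) = e (t (b \<tau>))" by (simp add: f_def a_def)
    then show ?case using M.chart_inv[OF W(1)] elim(1,2) by metis
  qed
  with a0 b a_vel show thesis using that by blast
qed

text \<open>Along curves of composable arrows the product has velocity \<^const>\<open>dmult\<close>: any derivative of the
  multiplication within the set of composable pairs obeys the chain rule for curves in that set.\<close>

lemma velocity_mult:
  assumes a: "a 0 = g" "velocity (arrs G) a X" and b: "b 0 = h" "velocity (arrs G) b Y"
    and comp: "\<forall>\<^sub>F \<tau> in nhds 0. s (a \<tau>) = t (b \<tau>)"
  shows "velocity (arrs G) (\<lambda>\<tau>. mult G (a \<tau>) (b \<tau>)) (dmult G g h X Y)"
proof -
  let ?m = "\<lambda>\<tau>. mult G (a \<tau>) (b \<tau>)"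
  have gh: "s g = t h" using eventually_nhds_x_imp_x[OF comp] a(1) b(1) by simp
  obtain U c where U: "chart_at (arrs G) g = (U, c)" "(U, c) \<in> arrs G" "g \<in> U" by (rule G.chart_at)
  obtain W d where W: "chart_at (arrs G) h = (W, d)" "(W, d) \<in> arrs G" "h \<in> W" by (rule G.chart_at)
  let ?C = "composable_coords G (U, c) (W, d)"
  let ?z = "\<lambda>\<tau>. (c (a \<tau>), d (b \<tau>))"
  have aU: "\<forall>\<^sub>F \<tau> in nhds 0. a \<tau> \<in> U"
    by (rule G.velocity_eventually[OF a(2)])
       (simp add: a(1) eventually_nhds_in_open[OF G.chart_open[OF U(2)] U(3)])
  have bW: "\<forall>\<^sub>F \<tau> in nhds 0. b \<tau> \<in> W"
    by (rule G.velocity_eventually[OF b(2)])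
       (simp add: b(1) eventually_nhds_in_open[OF G.chart_open[OF W(2)] W(3)])
  have z': "(?z has_vector_derivative (X (U, c), Y (W, d))) (at 0)"
    using G.velocity_chart[OF a(2) U(2)] G.velocity_chart[OF b(2) W(2)] U(3) W(3) a(1) b(1)
    by (intro has_vector_derivative_Pair) auto
  have "isCont ?z 0" using z' by (rule has_vector_derivative_continuous)
  then have "(?z \<longlongrightarrow> ?z 0) (nhds 0)"
    unfolding continuous_at by (rule tendsto_at_iff_tendsto_nhds[where g = ?z, THEN iffD1])
  then have z_lim: "(?z \<longlongrightarrow> (c g, d h)) (nhds 0)" by (simp add: a(1) b(1))
  have zC: "\<forall>\<^sub>F \<tau> in nhds 0. ?z \<tau> \<in> ?C \<and> inv_into U c (c (a \<tau>)) = a \<tau> \<and> inv_into W d (d (b \<tau>)) = b \<tau>"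
    using aU bW comp
    by eventually_elim (auto simp: composable_coords_def G.chart_inv[OF U(2)] G.chart_inv[OF W(2)])
  have main: "((\<lambda>\<tau>. c' (?m \<tau>)) has_vector_derivative dmult G g h X Y (U', c')) (at 0) \<and>
      (\<forall>\<^sub>F \<tau> in nhds 0. ?m \<tau> \<in> U')"
    if U': "(U', c') \<in> arrs G" "mult G g h \<in> U'" for U' c'
  proof -
    let ?\<mu> = "mult_coords G (U, c) (W, d) (U', c')"
    have "\<forall>(U, c)\<in>arrs G. \<forall>(W, d)\<in>arrs G. \<forall>(U', c')\<in>arrs G. \<forall>g\<in>U. \<forall>h\<in>W.
      s g = t h \<and> mult G g h \<in> U' \<longrightarrow>
      (\<exists>N F. open N \<and> (c g, d h) \<in> N \<and> smooth_on N F \<and>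
        (\<forall>(y, z)\<in>N \<inter> composable_coords G (U, c) (W, d).
          mult G (inv_into U c y) (inv_into W d z) \<in> U' \<and>
          F (y, z) = mult_coords G (U, c) (W, d) (U', c') (y, z)))"
      using lie unfolding lie_groupoid_def smooth_mult_def by blast
    from bspec[OF this U(2), unfolded prod.case, THEN bspec[OF _ W(2)], unfolded prod.case,
        THEN bspec[OF _ U'(1)], unfolded prod.case, THEN bspec[OF _ U(3)], THEN bspec[OF _ W(3)]] gh U'(2)
    obtain N F where N: "open N" "(c g, d h) \<in> N" "smooth_on N F"
      and F: "\<forall>(y, z)\<in>N \<inter> ?C. mult G (inv_into U c y) (inv_into W d z) \<in> U' \<and> F (y, z) = ?\<mu> (y, z)"
      by blast
    have F1: "mult G (inv_into U c y) (inv_into W d z) \<in> U'" "F (y, z) = ?\<mu> (y, z)"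
      if "(y, z) \<in> N" "(y, z) \<in> ?C" for y z
      using bspec[OF F IntI[OF that]] by simp_all
    have F2: "F p = ?\<mu> p" if "p \<in> N" "p \<in> ?C" for p
      using F1(2)[of "fst p" "snd p"] that by simp
    have pC: "(c g, d h) \<in> ?C" using eventually_nhds_x_imp_x[OF zC] a(1) b(1) by simp
    have sm: "smooth_at (c g, d h) F"
      using N(3) unfolding smooth_on_iff[OF N(1)] by (rule bspec[OF _ N(2)])
    have F': "(F has_derivative frechet_derivative F (at (c g, d h))) (at (c g, d h) within ?C)"
      by (rule has_derivative_at_withinI[OF smooth_at_has_derivative[OF sm]])
    obtain \<epsilon> where \<epsilon>: "\<epsilon> > 0" "ball (c g, d h) \<epsilon> \<subseteq> N"
      using N(1,2) open_contains_ball by blast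
    have "(?\<mu> has_derivative frechet_derivative F (at (c g, d h))) (at (c g, d h) within ?C)"
    proof (rule has_derivative_transform_within[OF F' \<epsilon>(1) pC])
      fix p assume p: "p \<in> ?C" "dist p (c g, d h) < \<epsilon>"
      then have "p \<in> ball (c g, d h) \<epsilon>" by (simp add: dist_commute)
      then have "p \<in> N" using \<epsilon>(2) by blast
      then show "F p = ?\<mu> p" using p(1) by (rule F2)
    qed
    then have \<mu>': "(?\<mu> has_derivative frechet_derivative ?\<mu> (at (c g, d h) within ?C)) (at (c g, d h) within ?C)"
      by (rule iffD1[OF frechet_derivative_works differentiableI])
    obtain O' where O': "open O'" "0 \<in> O'" "\<And>\<tau>. \<tau> \<in> O' \<Longrightarrow> ?z \<tau> \<in> ?C"
      using zC unfolding eventually_nhds by blast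
    have "?z ` O' \<subseteq> ?C" using O'(3) by blast
    from has_derivative_subset[OF \<mu>' this]
    have "(?\<mu> has_derivative frechet_derivative ?\<mu> (at (c g, d h) within ?C)) (at (?z 0) within ?z ` O')"
      by (simp add: a(1) b(1))
    from vector_derivative_diff_chain_within[OF has_vector_derivative_at_within[OF z'] this]
    have "((?\<mu> \<circ> ?z) has_vector_derivative
        frechet_derivative ?\<mu> (at (c g, d h) within ?C) (X (U, c), Y (W, d))) (at 0)"
      by (simp add: at_within_open[OF O'(2,1)])
    moreover have "\<forall>\<^sub>F \<tau> in nhds 0. (?\<mu> \<circ> ?z) \<tau> = c' (?m \<tau>)"
      using zC by eventually_elim (simp add: mult_coords_def)
    moreover have "frechet_derivative ?\<mu> (at (c g, d h) within ?C) (X (U, c), Y (W, d)) =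
        dmult G g h X Y (U', c')"
      using U' by (simp add: dmult_def U(1) W(1))
    ultimately have "((\<lambda>\<tau>. c' (?m \<tau>)) has_vector_derivative dmult G g h X Y (U', c')) (at 0)"
      using has_vector_derivative_cong_nhds[of "?\<mu> \<circ> ?z" _ 0 "\<lambda>\<tau>. c' (?m \<tau>)"] by simp
    moreover have "\<forall>\<^sub>F \<tau> in nhds 0. ?z \<tau> \<in> N"
      using z_lim eventually_nhds_in_open[OF N(1,2)] unfolding filterlim_iff by blast
    then have "\<forall>\<^sub>F \<tau> in nhds 0. ?m \<tau> \<in> U'"
      using zC
    proof eventually_elim
      case (elim \<tau>)
      then show ?case using F1(1)[of "c (a \<tau>)" "d (b \<tau>)"] by simp
    qed
    ultimately show ?thesis by blast
  qed
  have m0: "?m 0 = mult G g h" by (simp add: a(1) b(1))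
  obtain O' e where O': "(O', e) \<in> arrs G" "mult G g h \<in> O'" using G.ex_chart by blast
  have "isCont (\<lambda>\<tau>. e (?m \<tau>)) 0"
    using conjunct1[OF main[OF O']] by (rule has_vector_derivative_continuous)
  then have "((\<lambda>\<tau>. e (?m \<tau>)) \<longlongrightarrow> e (?m 0)) (nhds 0)"
    unfolding continuous_at by (rule tendsto_at_iff_tendsto_nhds[where g = "\<lambda>\<tau>. e (?m \<tau>)", THEN iffD1])
  then have e_lim: "((\<lambda>\<tau>. e (?m \<tau>)) \<longlongrightarrow> e (mult G g h)) (nhds 0)" by (simp only: m0)
  have m_lim: "(?m \<longlongrightarrow> ?m 0) (nhds 0)"
    unfolding m0 filterlim_iff
  proof (intro allI impI)
    fix P assume "eventually P (nhds (mult G g h))"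
    then have "\<forall>\<^sub>F y in nhds (e (mult G g h)). P (inv_into O' e y)" using G.nhds_chart[OF O', of P] by blast
    then have "\<forall>\<^sub>F \<tau> in nhds 0. P (inv_into O' e (e (?m \<tau>)))" using e_lim unfolding filterlim_iff by blast
    then show "\<forall>\<^sub>F \<tau> in nhds 0. P (?m \<tau>)"
      using conjunct2[OF main[OF O']] by eventually_elim (simp add: G.chart_inv[OF O'(1)])
  qed
  have tan: "dmult G g h X Y \<in> TG (mult G g h)"
  proof (rule G.tangentI)
    fix U1 c1 U2 c2 assume C: "(U1, c1) \<in> arrs G" "(U2, c2) \<in> arrs G" "mult G g h \<in> U1" "mult G g h \<in> U2"
    have "((\<lambda>\<tau>. c2 (?m \<tau>)) has_vector_derivative
        frechet_derivative (\<lambda>y. c2 (inv_into U1 c1 y)) (at (c1 (?m 0))) (dmult G g h X Y (U1, c1))) (at 0)"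
      by (rule G.has_vector_derivative_in_chart[where a = ?m, OF m_lim C(1)])
         (simp_all only: m0 C conjunct1[OF main[OF C(1,3)]] G.msmooth_coord[OF C(2,4)])
    from vector_derivative_unique_at[OF conjunct1[OF main[OF C(2,4)]] this]
    show "dmult G g h X Y (U2, c2) =
        frechet_derivative (\<lambda>y. c2 (inv_into U1 c1 y)) (at (c1 (mult G g h))) (dmult G g h X Y (U1, c1))"
      by (simp only: m0)
  next
    fix U' c' assume "\<not> ((U', c') \<in> arrs G \<and> mult G g h \<in> U')"
    then show "dmult G g h X Y (U', c') = 0" by (auto simp: dmult_def)
  qed
  show ?thesis
    by (rule G.velocityI[where a = ?m, OF _ m_lim O'(1)])
       (simp_all only: m0 tan O'(2) conjunct1[OF main[OF O']])
qed

lemma dmult_differentials: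
  assumes "s g = t h" "(X, Y) \<in> composable_tangents G g h"
  shows "dmult G g h X Y \<in> TG (mult G g h)"
    and "ds (mult G g h) (dmult G g h X Y) = ds h Y"
    and "dt (mult G g h) (dmult G g h X Y) = dt g X"
proof -
  obtain a b where ab: "a 0 = g" "b 0 = h" "velocity (arrs G) a X" "velocity (arrs G) b Y"
    "\<forall>\<^sub>F \<tau> in nhds 0. s (a \<tau>) = t (b \<tau>)" by (rule composable_curves[OF assms])
  note m = velocity_mult[OF ab(1,3,2,4,5)]
  show "dmult G g h X Y \<in> TG (mult G g h)"
    using G.velocity_tangent[OF m] ab(1,2) by simp
  have "\<forall>\<^sub>F \<tau> in nhds 0. s (mult G (a \<tau>) (b \<tau>)) = s (b \<tau>)"
    using ab(5) by eventually_elim (rule src_mult)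
  from M.velocity_unique[OF S.velocity_map[OF m] S.velocity_map[OF ab(4)] this]
  show "ds (mult G g h) (dmult G g h X Y) = ds h Y" using ab(1,2) by simp
  have "\<forall>\<^sub>F \<tau> in nhds 0. t (mult G (a \<tau>) (b \<tau>)) = t (a \<tau>)"
    using ab(5) by eventually_elim (rule tgt_mult)
  from M.velocity_unique[OF T.velocity_map[OF m] T.velocity_map[OF ab(3)] this]
  show "dt (mult G g h) (dmult G g h X Y) = dt g X" using ab(1,2) by simp
qed

end

section \<open>Representations of Lie groupoids\<close>

locale groupoid_representation = Lie_groupoid G + V: vbundle_over "objs G" V
  for G :: "('m::{t2_space, second_countable_topology}, 'e::fin_dim_normed,
             'g::{t2_space, second_countable_topology}, 'k::fin_dim_normed) groupoid"
    and V :: "('m, 'v::real_vector, 'f::fin_dim_normed) vbundle" +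
  fixes \<rho> :: "'g \<Rightarrow> 'v \<Rightarrow> 'v"
  assumes rep: "groupoid_rep G V \<rho>"
begin

sublocale SV: bundle_pullback "arrs G" "objs G" "src G" V ..
sublocale TV: bundle_pullback "arrs G" "objs G" "tgt G" V ..

abbreviation "EndV \<equiv> End_bundle V"
abbreviation "act \<equiv> End_action G V \<rho>"
abbreviation "conns \<equiv> connections (objs G) V"
abbreviation "forms \<equiv> one_forms (objs G) EndV"
abbreviation "secs \<equiv> sections (arrs G) (pullback (src G) V)"
abbreviation "nabla_s nabla \<equiv> pullback_connection (arrs G) (objs G) (src G) V nabla"
abbreviation "nabla_t nabla \<equiv> pullback_connection (arrs G) (objs G) (tgt G) V nabla"
abbreviation "Theta nabla \<equiv> invariance_form G V \<rho> nabla"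

lemma rho_linear: "linear_between (fibre V (s g)) (fibre V (t g)) (\<rho> g)"
  using rep unfolding groupoid_rep_def bundle_map_def by simp

lemmas rhoD = linear_betweenD[OF rho_linear]

lemma ginv_rho_linear: "linear_between (fibre V (t g)) (fibre V (s g)) (\<rho> (ginv G g))"
  using rho_linear[of "ginv G g"] by simp

lemma rho_mult: "s g = t h \<Longrightarrow> v \<in> fibre V (s h) \<Longrightarrow> \<rho> (mult G g h) v = \<rho> g (\<rho> h v)"
  using rep unfolding groupoid_rep_def by blast

lemma rho_ginv_rho: "v \<in> fibre V (s g) \<Longrightarrow> \<rho> (ginv G g) (\<rho> g v) = v"
proof -
  assume v: "v \<in> fibre V (s g)"
  have "\<rho> (idt G (s g)) v = v" using rep v unfolding groupoid_rep_def by blast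
  then show ?thesis using rho_mult[of "ginv G g" g v] v by (simp add: mult_ginv_left)
qed

lemma rho_rho_ginv: "v \<in> fibre V (t g) \<Longrightarrow> \<rho> g (\<rho> (ginv G g) v) = v"
  using rho_ginv_rho[of v "ginv G g"] by (simp add: ginv_ginv)

lemma rho_smooth:
  assumes "(U, \<psi>) \<in> trivs V" "(W, \<theta>) \<in> trivs V" "s g \<in> U" "t g \<in> W"
  shows "G.msmooth g (\<lambda>x. \<theta> (t x) (\<rho> x (V.tinv \<psi> (s x) e)))"
proof -
  have "\<forall>(U, \<psi>)\<in>trivs (pullback (src G) V). \<forall>(O', \<theta>)\<in>trivs (pullback (tgt G) V). \<forall>e.
      smooth_fun_on (arrs G) (U \<inter> O') (\<lambda>x. \<theta> x (\<rho> x (inv_into (fibre (pullback (src G) V) x) (\<psi> x) e)))"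
    using rep unfolding groupoid_rep_def bundle_map_def by blast
  from bspec[OF this SV.pullback_triv[OF assms(1)], unfolded prod.case,
      THEN bspec[OF _ TV.pullback_triv[OF assms(2)]], unfolded prod.case, THEN spec, of e]
  have "smooth_fun_on (arrs G) (s -` U \<inter> t -` W) (\<lambda>x. \<theta> (t x) (\<rho> x (V.tinv \<psi> (s x) e)))"
    by simp
  moreover have "open (s -` U \<inter> t -` W)"
    by (intro open_Int S.open_vimage T.open_vimage V.triv_open[OF assms(1)] V.triv_open[OF assms(2)])
  ultimately show ?thesis using assms(3,4) by (simp add: G.smooth_fun_on_iff)
qed

lemma triv_rho_linear:
  assumes "(W, \<theta>) \<in> trivs V" "t x \<in> W"
  shows "linear_between (fibre V (s x)) UNIV (\<lambda>v. \<theta> (t x) (\<rho> x v))"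
  by (rule linear_betweenI) (simp_all add: rhoD linear_betweenD[OF V.triv_linear[OF assms]])

lemma msmooth_rho:
  assumes "(U, \<psi>) \<in> trivs V" "(W, \<theta>) \<in> trivs V" "s g \<in> U" "t g \<in> W"
    and "\<And>x. w x \<in> fibre V (s x)" "G.msmooth g (\<lambda>x. \<psi> (s x) (w x))"
  shows "G.msmooth g (\<lambda>x. \<theta> (t x) (\<rho> x (w x)))"
proof (rule G.msmooth_cong)
  show "G.msmooth g (\<lambda>x. \<Sum>b\<in>fbasis. fcoord b (\<psi> (s x) (w x)) *\<^sub>R \<theta> (t x) (\<rho> x (V.tinv \<psi> (s x) b)))"
    by (intro G.msmooth_sum G.msmooth_scaleR G.msmooth_bounded_linear[OF bounded_linear_fcoord assms(6)]
        rho_smooth[OF assms(1-4)])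
  show "\<forall>\<^sub>F x in nhds g. (\<Sum>b\<in>fbasis. fcoord b (\<psi> (s x) (w x)) *\<^sub>R \<theta> (t x) (\<rho> x (V.tinv \<psi> (s x) b))) =
      \<theta> (t x) (\<rho> x (w x))"
    using S.eventually_map[OF V.triv_eventually[OF assms(1,3)]] T.eventually_map[OF V.triv_eventually[OF assms(2,4)]]
    by eventually_elim
       (rule V.linear_between_expand[OF triv_rho_linear[OF assms(2)] assms(1) _ assms(5), symmetric])
qed

lemma msmooth_rho_ginv:
  assumes "(U, \<psi>) \<in> trivs V" "(W, \<theta>) \<in> trivs V" "s g \<in> U" "t g \<in> W"
    and "\<And>x. w x \<in> fibre V (t x)" "G.msmooth g (\<lambda>x. \<theta> (t x) (w x))"
  shows "G.msmooth g (\<lambda>x. \<psi> (s x) (\<rho> (ginv G x) (w x)))"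
proof (rule G.msmooth_cong)
  have coeff: "G.msmooth g (\<lambda>x. \<psi> (s x) (\<rho> (ginv G x) (V.tinv \<theta> (t x) b)))" for b
    using I.msmooth_compose[OF rho_smooth[OF assms(2,1), of "ginv G g" b]] assms(3,4) by simp
  show "G.msmooth g (\<lambda>x. \<Sum>b\<in>fbasis. fcoord b (\<theta> (t x) (w x)) *\<^sub>R \<psi> (s x) (\<rho> (ginv G x) (V.tinv \<theta> (t x) b)))"
    by (intro G.msmooth_sum G.msmooth_scaleR G.msmooth_bounded_linear[OF bounded_linear_fcoord assms(6)] coeff)
  have lin: "linear_between (fibre V (t x)) UNIV (\<lambda>v. \<psi> (s x) (\<rho> (ginv G x) v))" if "s x \<in> U" for x
    using triv_rho_linear[OF assms(1), of "ginv G x"] that by simp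
  show "\<forall>\<^sub>F x in nhds g. (\<Sum>b\<in>fbasis. fcoord b (\<theta> (t x) (w x)) *\<^sub>R \<psi> (s x) (\<rho> (ginv G x) (V.tinv \<theta> (t x) b))) =
      \<psi> (s x) (\<rho> (ginv G x) (w x))"
    using S.eventually_map[OF V.triv_eventually[OF assms(1,3)]] T.eventually_map[OF V.triv_eventually[OF assms(2,4)]]
    by eventually_elim
       (rule V.linear_between_expand[OF lin assms(2) _ assms(5), symmetric])
qed

section \<open>The invariance form\<close>

lemma phi_inv_eq:
  assumes "\<xi> g \<in> fibre V (s g)"
  shows "phi_inv G V \<rho> \<xi> g = \<rho> g (\<xi> g)"
  unfolding phi_inv_def phi_def
proof (rule inv_into_f_eq)
  show "inj_on (\<rho> (ginv G g)) (fibre V (t g))"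
    by (rule inj_on_inverseI[where g = "\<rho> g"]) (rule rho_rho_ginv)
qed (simp_all add: rhoD(1) rho_ginv_rho assms)

lemma sec_fibre: "\<xi> \<in> secs \<Longrightarrow> \<xi> g \<in> fibre V (s g)"
  using SV.P.section_fibre by simp

lemma phi_inv_sec: "\<xi> \<in> secs \<Longrightarrow> phi_inv G V \<rho> \<xi> = (\<lambda>g. \<rho> g (\<xi> g))"
  by (rule ext, rule phi_inv_eq, rule sec_fibre)

lemma phi_inv_at: "\<xi> \<in> secs \<Longrightarrow> phi_inv G V \<rho> \<xi> g = \<rho> g (\<xi> g)"
  by (simp add: phi_inv_sec)

lemma phi_inv_section:
  assumes "\<xi> \<in> secs"
  shows "phi_inv G V \<rho> \<xi> \<in> sections (arrs G) (pullback (tgt G) V)"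
  unfolding phi_inv_sec[OF assms]
proof (rule TV.P.sectionI)
  show "\<rho> g (\<xi> g) \<in> fibre (pullback (tgt G) V) g" for g by (simp add: rhoD(1) sec_fibre[OF assms])
  fix g
  obtain U \<psi> where U: "(U, \<psi>) \<in> trivs V" "s g \<in> U" using V.ex_triv by blast
  obtain W \<theta> where W: "(W, \<theta>) \<in> trivs V" "t g \<in> W" using V.ex_triv by blast
  have "G.msmooth g (\<lambda>x. \<psi> (s x) (\<xi> x))"
    using SV.P.section_msmooth[OF assms SV.pullback_triv[OF U(1)]] U(2) by simp
  from msmooth_rho[OF U(1) W(1) U(2) W(2) sec_fibre[OF assms] this] TV.pullback_triv[OF W(1)] W(2)
  show "\<exists>W \<theta>. (W, \<theta>) \<in> trivs (pullback (tgt G) V) \<and> g \<in> W \<and> G.msmooth g (\<lambda>x. \<theta> x (\<rho> x (\<xi> x)))"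
    by (intro exI[of _ "t -` W"] exI[of _ "\<lambda>x. \<theta> (t x)"]) simp
qed

lemma phi_form:
  assumes "\<omega> \<in> one_forms (arrs G) (pullback (tgt G) V)"
  shows "(\<lambda>g X. \<rho> (ginv G g) (\<omega> g X)) \<in> one_forms (arrs G) (pullback (src G) V)"
proof (rule SV.P.one_formI)
  have fib: "\<omega> g X \<in> fibre V (t g)" for g X using TV.P.one_form_fibre[OF assms] by simp
  note lin = linear_betweenD[OF ginv_rho_linear] linear_betweenD[OF TV.P.one_form_linear[OF assms]]
  show "linear_between (TG g) (fibre (pullback (src G) V) g) (\<lambda>X. \<rho> (ginv G g) (\<omega> g X))" for g
    by (rule linear_betweenI) (simp_all add: lin fib)
  show "\<rho> (ginv G g) (\<omega> g X) = 0" if "X \<notin> TG g" for g X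
    by (simp add: TV.P.one_form_outside[OF assms that]
        linear_between_0[OF ginv_rho_linear subspace_0[OF V.subspace_fibre]])
  fix g
  obtain U \<psi> where U: "(U, \<psi>) \<in> trivs V" "s g \<in> U" using V.ex_triv by blast
  obtain W \<theta> where W: "(W, \<theta>) \<in> trivs V" "t g \<in> W" using V.ex_triv by blast
  have "G.msmooth g (\<lambda>x. \<psi> (s x) (\<rho> (ginv G x) (\<omega> x (coord_vector (arrs G) (O', c) e x))))"
    if C: "(O', c) \<in> arrs G" "g \<in> O'" for O' c e
  proof (rule msmooth_rho_ginv[OF U(1) W(1) U(2) W(2) fib])
    show "G.msmooth g (\<lambda>x. \<theta> (t x) (\<omega> x (coord_vector (arrs G) (O', c) e x)))"
      using TV.P.one_form_msmooth[OF assms C TV.pullback_triv[OF W(1)]] W(2) by simp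
  qed
  with SV.pullback_triv[OF U(1)] U(2)
  show "\<exists>W \<psi>. (W, \<psi>) \<in> trivs (pullback (src G) V) \<and> g \<in> W \<and> (\<forall>U c e. (U, c) \<in> arrs G \<longrightarrow> g \<in> U \<longrightarrow>
      G.msmooth g (\<lambda>x. \<psi> x (\<rho> (ginv G x) (\<omega> x (coord_vector (arrs G) (U, c) e x)))))"
    by (intro exI[of _ "s -` U"] exI[of _ "\<lambda>x. \<psi> (s x)"]) simp
qed

text \<open>The connection \<open>\<phi> \<circ> \<nabla>\<^sup>t \<circ> \<phi>\<inverse>\<close> on \<open>s\<^sup>*V\<close>.\<close>

definition transported :: "('m, 'e, 'v) operator \<Rightarrow> ('g, 'k, 'v) operator"
  where "transported nabla \<xi> = (if \<xi> \<in> secs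
    then (\<lambda>g X. \<rho> (ginv G g) (nabla_t nabla (phi_inv G V \<rho> \<xi>) g X)) else 0)"

context
  fixes nabla assumes nabla: "nabla \<in> conns"
begin

lemma nabla_s: "nabla_s nabla \<in> connections (arrs G) (pullback (src G) V)"
  using SV.is_pullback_pullback_connection[OF nabla] by (simp add: SV.is_pullback_def)

lemma nabla_t: "nabla_t nabla \<in> connections (arrs G) (pullback (tgt G) V)"
  using TV.is_pullback_pullback_connection[OF nabla] by (simp add: TV.is_pullback_def)

lemma nabla_t_fibre: "\<xi> \<in> secs \<Longrightarrow> nabla_t nabla (phi_inv G V \<rho> \<xi>) g X \<in> fibre V (t g)"
  using TV.P.one_form_fibre[OF TV.P.conn_form[OF nabla_t phi_inv_section]] by simp

lemma transported_connection: "transported nabla \<in> connections (arrs G) (pullback (src G) V)"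
proof (rule SV.P.connectionI)
  note lin = linear_betweenD[OF ginv_rho_linear]
  show "transported nabla \<xi> \<in> one_forms (arrs G) (pullback (src G) V)" if "\<xi> \<in> secs" for \<xi>
    using phi_form[OF TV.P.conn_form[OF nabla_t phi_inv_section[OF that]]] that
    by (simp add: transported_def)
  show "transported nabla \<xi> = 0" if "\<xi> \<notin> secs" for \<xi> using that by (simp add: transported_def)
  show "transported nabla (\<lambda>x. \<xi> x + \<eta> x) g X = transported nabla \<xi> g X + transported nabla \<eta> g X"
    if st: "\<xi> \<in> secs" "\<eta> \<in> secs" for \<xi> \<eta> g X
  proof -
    have "phi_inv G V \<rho> (\<lambda>x. \<xi> x + \<eta> x) = (\<lambda>x. phi_inv G V \<rho> \<xi> x + phi_inv G V \<rho> \<eta> x)"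
      using st by (simp add: phi_inv_sec SV.P.section_add rhoD(2) sec_fibre)
    then show ?thesis
      using st by (simp add: transported_def SV.P.section_add TV.P.conn_add[OF nabla_t] phi_inv_section
          lin(2) nabla_t_fibre)
  qed
  show "transported nabla (\<lambda>y. f y *\<^sub>R \<xi> y) g X =
      dvec (arrs G) f g X *\<^sub>R \<xi> g + f g *\<^sub>R transported nabla \<xi> g X"
    if f: "\<And>x. G.msmooth x f" "\<xi> \<in> secs" "X \<in> TG g" for f \<xi> g X
  proof -
    have "phi_inv G V \<rho> (\<lambda>x. f x *\<^sub>R \<xi> x) = (\<lambda>x. f x *\<^sub>R phi_inv G V \<rho> \<xi> x)"
      using f(2) by (simp add: phi_inv_sec SV.P.section_scaleR[OF f(1,2)] rhoD(3) sec_fibre)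
    then have "nabla_t nabla (phi_inv G V \<rho> (\<lambda>y. f y *\<^sub>R \<xi> y)) g X =
        dvec (arrs G) f g X *\<^sub>R \<rho> g (\<xi> g) + f g *\<^sub>R nabla_t nabla (phi_inv G V \<rho> \<xi>) g X"
      using TV.P.conn_leibniz[OF nabla_t f(1) phi_inv_section[OF f(2)] f(3)] phi_inv_at[OF f(2)]
      by simp
    then show ?thesis
      using f(2) by (simp add: transported_def SV.P.section_scaleR[OF f(1,2)] lin nabla_t_fibre rhoD(1)
          sec_fibre subspace_scale[OF V.subspace_fibre] rho_ginv_rho)
  qed
qed

text \<open>Both \<open>\<phi> \<circ> \<nabla>\<^sup>t \<circ> \<phi>\<inverse>\<close> and \<open>\<nabla>\<^sup>s\<close> are connections on \<open>s\<^sup>*V\<close>, so the defining property of the invariance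
  form is that of their difference tensor.\<close>

lemma Theta_eq: "Theta nabla = SV.P.conn_diff (nabla_s nabla) (transported nabla)" (is "_ = ?D")
proof -
  let ?P = "\<lambda>\<Theta>. \<Theta> \<in> one_forms (arrs G) (pullback (src G) EndV) \<and>
    (\<forall>\<xi>\<in>secs. \<forall>g. \<forall>X\<in>TG g. \<Theta> g X (\<xi> g) =
      phi G \<rho> g (nabla_t nabla (phi_inv G V \<rho> \<xi>) g X) - nabla_s nabla \<xi> g X)"
  have "?P ?D"
    using SV.P.conn_diff_form[OF nabla_s transported_connection]
      SV.P.conn_diff_apply[OF nabla_s transported_connection]
    by (simp add: SV.End_bundle_pullback transported_def phi_def)
  moreover have "\<Theta> = ?D" if "?P \<Theta>" for \<Theta>
    by (rule SV.P.End_form_eqI) (use that \<open>?P ?D\<close> in \<open>simp_all add: SV.End_bundle_pullback\<close>)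
  ultimately have "(THE \<Theta>. ?P \<Theta>) = ?D" by (rule the_equality)
  then show ?thesis by (simp add: invariance_form_def)
qed

lemma Theta_form: "Theta nabla \<in> one_forms (arrs G) (pullback (src G) EndV)"
  unfolding Theta_eq SV.End_bundle_pullback[symmetric]
  by (rule SV.P.conn_diff_form[OF nabla_s transported_connection])

lemma Theta_apply:
  assumes "\<xi> \<in> secs" "X \<in> TG g"
  shows "Theta nabla g X (\<xi> g) =
    \<rho> (ginv G g) (nabla_t nabla (phi_inv G V \<rho> \<xi>) g X) - nabla_s nabla \<xi> g X"
  unfolding Theta_eq SV.P.conn_diff_apply[OF nabla_s transported_connection assms]
  using assms(1) by (simp add: transported_def)

lemma Theta_fibre: "Theta nabla g X \<in> fibre EndV (s g)"
  using vbundle_over.one_form_fibre[OF SV.P.vbundle_over_End, unfolded SV.End_bundle_pullback, OF Theta_form]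
  by (simp add: pullback_def)

lemma Theta_outside: "X \<notin> TG g \<Longrightarrow> Theta nabla g X = 0"
  by (rule vbundle_over.one_form_outside[OF SV.P.vbundle_over_End, unfolded SV.End_bundle_pullback, OF Theta_form])

text \<open>Evaluate the form on a section that is constant near \<open>g\<close> in the trivialization around the source. Then
  \<open>\<nabla>\<^sup>s\<close> contributes Christoffel symbols only, and \<open>\<nabla>\<^sup>t\<close> in addition the derivative of the matrix of the action.\<close>

lemma Theta_formula:
  assumes U: "(U, \<psi>) \<in> trivs V" "s g \<in> U" and W: "(W, \<theta>) \<in> trivs V" "t g \<in> W" and X: "X \<in> TG g"
  shows "\<theta> (t g) (\<rho> g (Theta nabla g X (V.tinv \<psi> (s g) e))) =
    dvec (arrs G) (\<lambda>x. \<theta> (t x) (\<rho> x (V.tinv \<psi> (s x) e))) g X +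
    V.christoffel nabla \<theta> (t g) (dt g X) (\<theta> (t g) (\<rho> g (V.tinv \<psi> (s g) e))) -
    \<theta> (t g) (\<rho> g (V.tinv \<psi> (s g) (V.christoffel nabla \<psi> (s g) (ds g X) e)))"
proof -
  let ?\<xi> = "SV.P.frame (\<lambda>x. \<psi> (s x)) g e"
  note PU = SV.pullback_triv[OF U(1)]
  have gU: "g \<in> s -` U" using U(2) by simp
  have \<xi>: "?\<xi> \<in> secs" by (rule SV.P.frame_section[OF PU gU])
  have ev: "\<forall>\<^sub>F x in nhds g. ?\<xi> x = V.tinv \<psi> (s x) e"
    using SV.P.frame_eventually[OF PU gU] by simp
  have \<xi>g: "?\<xi> g = V.tinv \<psi> (s g) e" by (rule eventually_nhds_x_imp_x[OF ev])
  have fs: "nabla_s nabla ?\<xi> g X \<in> fibre V (s g)"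
    using SV.P.one_form_fibre[OF SV.P.conn_form[OF nabla_s \<xi>]] by simp
  note ft = nabla_t_fibre[OF \<xi>, of g X]
  note tl = V.triv_linear[OF W]
  have "\<rho> g (Theta nabla g X (?\<xi> g)) =
      \<rho> g (\<rho> (ginv G g) (nabla_t nabla (phi_inv G V \<rho> ?\<xi>) g X)) - \<rho> g (nabla_s nabla ?\<xi> g X)"
    unfolding Theta_apply[OF \<xi> X]
    by (rule linear_between_diff[OF rho_linear V.subspace_fibre linear_betweenD(1)[OF ginv_rho_linear ft] fs])
  then have 1: "\<theta> (t g) (\<rho> g (Theta nabla g X (V.tinv \<psi> (s g) e))) =
      \<theta> (t g) (nabla_t nabla (phi_inv G V \<rho> ?\<xi>) g X) - \<theta> (t g) (\<rho> g (nabla_s nabla ?\<xi> g X))"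
    by (simp add: \<xi>g rho_rho_ginv[OF ft] linear_between_diff[OF tl V.subspace_fibre ft rhoD(1)[OF fs]])
  have "\<forall>\<^sub>F x in nhds g. \<theta> (t x) (\<rho> x (V.tinv \<psi> (s x) e)) = \<theta> (t x) (phi_inv G V \<rho> ?\<xi> x)"
    using ev by eventually_elim (simp add: phi_inv_at[OF \<xi>])
  from G.dvec_cong[OF X rho_smooth[OF U(1) W(1) U(2) W(2)] this]
  have 2: "\<theta> (t g) (nabla_t nabla (phi_inv G V \<rho> ?\<xi>) g X) =
      dvec (arrs G) (\<lambda>x. \<theta> (t x) (\<rho> x (V.tinv \<psi> (s x) e))) g X +
      V.christoffel nabla \<theta> (t g) (dt g X) (\<theta> (t g) (\<rho> g (V.tinv \<psi> (s g) e)))"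
    by (simp add: TV.is_pullback_formula[OF nabla TV.is_pullback_pullback_connection[OF nabla] W X
          phi_inv_section[OF \<xi>]] phi_inv_at[OF \<xi>] \<xi>g)
  have "\<forall>\<^sub>F x in nhds g. e = \<psi> (s x) (?\<xi> x)"
    using ev S.eventually_map[OF V.triv_eventually[OF U]]
    by eventually_elim (simp add: V.triv_tinv[OF U(1)])
  from G.dvec_cong[OF X G.msmooth_const this]
  have "\<psi> (s g) (nabla_s nabla ?\<xi> g X) = V.christoffel nabla \<psi> (s g) (ds g X) e"
    by (simp add: SV.is_pullback_formula[OF nabla SV.is_pullback_pullback_connection[OF nabla] U X \<xi>]
        G.dvec_const[OF X] \<xi>g V.triv_tinv[OF U])
  then have "nabla_s nabla ?\<xi> g X = V.tinv \<psi> (s g) (V.christoffel nabla \<psi> (s g) (ds g X) e)"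
    using V.tinv_triv[OF U fs] by simp
  with 1 2 show ?thesis by simp
qed

end

text \<open>Differentiate \<open>P(ab) = P(a) P(b)\<close> for matrices \<open>P\<close> of the action along composable curves \<open>a\<close> and \<open>b\<close> with
  velocities \<open>X\<close> and \<open>Y\<close>. Expanding the moving vector in the basis reduces this to products with scalars.\<close>

lemma dvec_rho_mult:
  assumes gh: "s g = t h" and XY: "(X, Y) \<in> composable_tangents G g h"
    and U: "(U, \<psi>) \<in> trivs V" "s h \<in> U" and W: "(W, \<theta>) \<in> trivs V" "s g \<in> W"
    and O': "(O', \<kappa>) \<in> trivs V" "t g \<in> O'"
  shows "dvec (arrs G) (\<lambda>x. \<kappa> (t x) (\<rho> x (V.tinv \<psi> (s x) e))) (mult G g h) (dmult G g h X Y) =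
    \<kappa> (t g) (\<rho> g (V.tinv \<theta> (s g) (dvec (arrs G) (\<lambda>x. \<theta> (t x) (\<rho> x (V.tinv \<psi> (s x) e))) h Y))) +
    dvec (arrs G) (\<lambda>x. \<kappa> (t x) (\<rho> x (V.tinv \<theta> (s x) (\<theta> (t h) (\<rho> h (V.tinv \<psi> (s h) e)))))) g X"
proof -
  have X: "X \<in> TG g" and Y: "Y \<in> TG h" using XY by (auto simp: composable_tangents_def)
  obtain a b where ab: "a 0 = g" "b 0 = h" "velocity (arrs G) a X" "velocity (arrs G) b Y"
    "\<forall>\<^sub>F \<tau> in nhds 0. s (a \<tau>) = t (b \<tau>)" by (rule composable_curves[OF gh XY])
  let ?m = "\<lambda>\<tau>. mult G (a \<tau>) (b \<tau>)"
  note m = velocity_mult[OF ab(1,3,2,4,5)]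
  have m0: "?m 0 = mult G g h" by (simp add: ab)
  define w where "w x = \<theta> (t x) (\<rho> x (V.tinv \<psi> (s x) e))" for x
  define Q where "Q i x = \<kappa> (t x) (\<rho> x (V.tinv \<theta> (s x) i))" for i x
  define R where "R x = \<kappa> (t x) (\<rho> x (V.tinv \<psi> (s x) e))" for x
  have w: "G.msmooth h w" unfolding w_def using rho_smooth[OF U(1) W(1) U(2)] W(2) gh by simp
  have Q: "G.msmooth g (Q i)" for i unfolding Q_def by (rule rho_smooth[OF W(1) O'(1) W(2) O'(2)])
  have R: "G.msmooth (mult G g h) R"
    unfolding R_def by (rule rho_smooth[OF U(1) O'(1)]) (simp_all add: src_mult[OF gh] tgt_mult[OF gh] U O')
  have Q_expand: "Q i x = (\<Sum>j\<in>fbasis. fcoord j i *\<^sub>R Q j x)" if "s x \<in> W" "t x \<in> O'" for i x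
    using V.linear_between_expand[OF triv_rho_linear[OF O'(1) that(2)] W(1) that(1) V.tinv_fibre[OF W(1) that(1)], of i]
    by (simp add: Q_def V.triv_tinv[OF W(1) that(1)])
  have evg: "\<forall>\<^sub>F x in nhds g. s x \<in> W \<and> t x \<in> O'"
    by (intro eventually_conj S.eventually_map T.eventually_map V.triv_eventually[OF W] V.triv_eventually[OF O'])
  have evh: "\<forall>\<^sub>F x in nhds h. s x \<in> U"
    by (intro S.eventually_map V.triv_eventually[OF U])
  have "\<forall>\<^sub>F \<tau> in nhds 0. s (a \<tau>) \<in> W \<and> t (a \<tau>) \<in> O'"
    using G.velocity_eventually[OF ab(3), of "\<lambda>x. s x \<in> W \<and> t x \<in> O'"] evg ab(1) by simp
  moreover have "\<forall>\<^sub>F \<tau> in nhds 0. s (b \<tau>) \<in> U"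
    using G.velocity_eventually[OF ab(4), of "\<lambda>x. s x \<in> U"] evh ab(2) by simp
  ultimately have eq: "\<forall>\<^sub>F \<tau> in nhds 0. (\<Sum>j\<in>fbasis. fcoord j (w (b \<tau>)) *\<^sub>R Q j (a \<tau>)) = R (?m \<tau>)"
    using ab(5)
  proof eventually_elim
    case (elim \<tau>)
    let ?v = "V.tinv \<psi> (s (b \<tau>)) e"
    have v: "?v \<in> fibre V (s (b \<tau>))" by (rule V.tinv_fibre[OF U(1) elim(2)])
    have "\<rho> (b \<tau>) ?v \<in> fibre V (s (a \<tau>))" using rhoD(1)[OF v] elim(3) by simp
    from V.linear_between_expand[OF triv_rho_linear[OF O'(1)] W(1) _ this] elim
    show ?case
      by (simp add: R_def w_def Q_def src_mult[OF elim(3)] tgt_mult[OF elim(3)] rho_mult[OF elim(3) v])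
  qed
  have wd: "((\<lambda>\<tau>. w (b \<tau>)) has_vector_derivative dvec (arrs G) w h Y) (at 0)"
    using G.velocity_fun[OF ab(4), of w] w ab(2) by simp
  have Qd: "((\<lambda>\<tau>. Q j (a \<tau>)) has_vector_derivative dvec (arrs G) (Q j) g X) (at 0)" for j
    using G.velocity_fun[OF ab(3), of "Q j"] Q[of j] ab(1) by simp
  have "((\<lambda>\<tau>. fcoord j (w (b \<tau>))) has_real_derivative fcoord j (dvec (arrs G) w h Y)) (at 0)" for j
    using bounded_linear.has_vector_derivative[OF bounded_linear_fcoord wd]
    by (simp add: has_real_derivative_iff_has_vector_derivative)
  from has_vector_derivative_scaleR[OF this Qd]
  have prod: "((\<lambda>\<tau>. fcoord j (w (b \<tau>)) *\<^sub>R Q j (a \<tau>)) has_vector_derivative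
      fcoord j (w h) *\<^sub>R dvec (arrs G) (Q j) g X + fcoord j (dvec (arrs G) w h Y) *\<^sub>R Q j g) (at 0)" for j
    by (simp add: ab(1,2))
  have "((\<lambda>\<tau>. \<Sum>j\<in>fbasis. fcoord j (w (b \<tau>)) *\<^sub>R Q j (a \<tau>)) has_vector_derivative
      (\<Sum>j\<in>fbasis. fcoord j (w h) *\<^sub>R dvec (arrs G) (Q j) g X + fcoord j (dvec (arrs G) w h Y) *\<^sub>R Q j g)) (at 0)"
    by (rule has_vector_derivative_sum) (rule prod)
  note Rd = has_vector_derivative_cong_nhds[OF this eq]
  have "dvec (arrs G) R (?m 0) (dmult G g h X Y) =
      (\<Sum>j\<in>fbasis. fcoord j (w h) *\<^sub>R dvec (arrs G) (Q j) g X + fcoord j (dvec (arrs G) w h Y) *\<^sub>R Q j g)"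
    by (rule G.dvec_eqI[where a = ?m, OF m _ Rd]) (simp add: m0 R)
  also have "\<dots> = (\<Sum>j\<in>fbasis. fcoord j (dvec (arrs G) w h Y) *\<^sub>R Q j g) +
      (\<Sum>j\<in>fbasis. fcoord j (w h) *\<^sub>R dvec (arrs G) (Q j) g X)"
    by (simp add: sum.distrib add.commute)
  also have "(\<Sum>j\<in>fbasis. fcoord j (dvec (arrs G) w h Y) *\<^sub>R Q j g) = Q (dvec (arrs G) w h Y) g"
    by (rule Q_expand[OF W(2) O'(2), symmetric])
  also have "(\<Sum>j\<in>fbasis. fcoord j (w h) *\<^sub>R dvec (arrs G) (Q j) g X) = dvec (arrs G) (Q (w h)) g X"
  proof -
    have sm: "G.msmooth g (\<lambda>x. fcoord j (w h) *\<^sub>R Q j x)" for j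
      by (intro G.msmooth_scaleR G.msmooth_const Q)
    have "\<forall>\<^sub>F x in nhds g. (\<Sum>j\<in>fbasis. fcoord j (w h) *\<^sub>R Q j x) = Q (w h) x"
      using evg by eventually_elim (rule Q_expand[symmetric], simp_all)
    from G.dvec_cong[OF X G.msmooth_sum[OF sm] this]
    have "dvec (arrs G) (Q (w h)) g X = (\<Sum>j\<in>fbasis. dvec (arrs G) (\<lambda>x. fcoord j (w h) *\<^sub>R Q j x) g X)"
      by (simp add: G.dvec_sum[OF X sm])
    also have "\<dots> = (\<Sum>j\<in>fbasis. fcoord j (w h) *\<^sub>R dvec (arrs G) (Q j) g X)"
      by (simp add: G.dvec_scaleR[OF X G.msmooth_const Q] G.dvec_const[OF X])
    finally show ?thesis by simp
  qed
  finally show ?thesis unfolding m0 by (simp add: R_def[abs_def] Q_def[abs_def] w_def[abs_def])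
qed

text \<open>In trivializations around the three objects involved, insert \<open>Theta_formula\<close> for \<open>gh\<close>, \<open>h\<close> and \<open>g\<close>. The
  derivative terms match by the Leibniz rule \<open>dvec_rho_mult\<close>. The Christoffel symbols at the middle
  object cancel since \<open>ds X = dt Y\<close>, and those at the two ends agree.\<close>

lemma Theta_multiplicative:
  assumes nabla: "nabla \<in> conns"
  shows "Theta nabla \<in> multiplicative_forms G EndV act"
  unfolding multiplicative_forms_def
proof (intro CollectI conjI Theta_form[OF nabla] allI impI ballI, clarify)
  fix g h X Y
  assume gh: "s g = t h" and XY: "(X, Y) \<in> composable_tangents G g h"
  let ?Z = "dmult G g h X Y" and ?\<Theta> = "Theta nabla"
  have X: "X \<in> TG g" and Y: "Y \<in> TG h" and dXY: "ds g X = dt h Y"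
    using XY by (auto simp: composable_tangents_def)
  note Z = dmult_differentials[OF gh XY]
  obtain U \<psi> where U: "(U, \<psi>) \<in> trivs V" "s h \<in> U" using V.ex_triv by blast
  obtain W \<theta> where W: "(W, \<theta>) \<in> trivs V" "s g \<in> W" using V.ex_triv by blast
  obtain O' \<kappa> where O': "(O', \<kappa>) \<in> trivs V" "t g \<in> O'" using V.ex_triv by blast
  have Wt: "t h \<in> W" using W(2) gh by simp
  have sm: "s (mult G g h) = s h" "t (mult G g h) = t g" by (rule src_mult[OF gh], rule tgt_mult[OF gh])
  note \<Theta>E = Theta_fibre[OF nabla]
  have E2: "act (ginv G h) (?\<Theta> g X) \<in> fibre EndV (s h)"
  proof -
    have 1: "linear_between (fibre V (s g)) (fibre V (s g)) (?\<Theta> g X)" using \<Theta>E by (simp add: V.fibre_End)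
    note lin = rhoD[of _ h] linear_betweenD[OF 1] linear_betweenD[OF ginv_rho_linear[of h]]
    show ?thesis
      unfolding V.fibre_End
      by (auto intro!: linear_betweenI simp: End_action_def ginv_ginv gh[symmetric] lin[unfolded gh[symmetric]]
          subspace_add[OF V.subspace_fibre] subspace_scale[OF V.subspace_fibre])
  qed
  show "?\<Theta> (mult G g h) ?Z = ?\<Theta> h Y + act (ginv G h) (?\<Theta> g X)"
  proof (rule V.End_eqI)
    show "?\<Theta> (mult G g h) ?Z \<in> fibre EndV (s h)" using \<Theta>E[of "mult G g h"] by (simp add: sm)
    show "?\<Theta> h Y + act (ginv G h) (?\<Theta> g X) \<in> fibre EndV (s h)"
      by (rule subspace_add[OF V.subspace_End \<Theta>E E2])
    fix u assume u: "u \<in> fibre V (s h)"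
    define e where "e = \<psi> (s h) u"
    have ue: "u = V.tinv \<psi> (s h) e" unfolding e_def by (rule V.tinv_triv[OF U u, symmetric])
    define w where "w = \<theta> (t h) (\<rho> h u)"
    have hu: "\<rho> h u \<in> fibre V (t h)" by (rule rhoD(1)[OF u])
    have uw: "\<rho> h u = V.tinv \<theta> (s g) w" unfolding w_def gh by (rule V.tinv_triv[OF W(1) Wt hu, symmetric])
    let ?\<Gamma>x = "V.christoffel nabla \<psi> (s h) (ds h Y) e"
      and ?\<Gamma>y = "V.christoffel nabla \<theta> (s g) (ds g X) w"
    let ?Q = "\<lambda>i. \<kappa> (t g) (\<rho> g (V.tinv \<theta> (s g) i))"
    let ?P = "\<lambda>v. \<kappa> (t g) (\<rho> g v)"
    have Plin: "linear_between (fibre V (t h)) UNIV ?P"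
      using triv_rho_linear[OF O'] gh by simp
    have Qlin: "linear ?Q"
    proof (rule linearI)
      note lin = linear_betweenD[OF V.tinv_linear[OF W]] linear_betweenD[OF triv_rho_linear[OF O']]
      show "?Q (i + j) = ?Q i + ?Q j" for i j by (simp add: lin)
      show "?Q (r *\<^sub>R i) = r *\<^sub>R ?Q i" for r i by (simp add: lin)
    qed
    have \<Theta>u: "?\<Theta> k K v \<in> fibre V (s k)" for k K v by (rule V.End_apply_fibre[OF \<Theta>E])
    \<comment> \<open>Apply the action of \<open>gh\<close> to both sides of the claim and read the result in the trivialization
      at the target of \<open>g\<close>; the local formula applies to each of the three values of the form.\<close>
    have F1: "?P (\<rho> h (?\<Theta> (mult G g h) ?Z u)) =
      dvec (arrs G) (\<lambda>x. \<kappa> (t x) (\<rho> x (V.tinv \<psi> (s x) e))) (mult G g h) ?Z +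
      V.christoffel nabla \<kappa> (t g) (dt g X) (?P (\<rho> h u)) - ?P (\<rho> h (V.tinv \<psi> (s h) ?\<Gamma>x))"
      using Theta_formula[OF nabla U(1) _ O'(1) _ Z(1), of e] U(2) O'(2) \<Theta>u[of "mult G g h" ?Z u]
      by (simp add: sm Z(2,3) rho_mult[OF gh] u ue[symmetric] V.tinv_fibre[OF U])
    have F2: "\<theta> (t h) (\<rho> h (?\<Theta> h Y u)) =
      dvec (arrs G) (\<lambda>x. \<theta> (t x) (\<rho> x (V.tinv \<psi> (s x) e))) h Y + ?\<Gamma>y -
      \<theta> (t h) (\<rho> h (V.tinv \<psi> (s h) ?\<Gamma>x))"
      using Theta_formula[OF nabla U W(1) Wt Y, of e] by (simp add: ue[symmetric] w_def dXY gh)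
    have F3: "?P (?\<Theta> g X (\<rho> h u)) = dvec (arrs G) (\<lambda>x. \<kappa> (t x) (\<rho> x (V.tinv \<theta> (s x) w))) g X +
      V.christoffel nabla \<kappa> (t g) (dt g X) (?P (\<rho> h u)) - ?Q ?\<Gamma>y"
      using Theta_formula[OF nabla W O' X, of w] by (simp add: uw)
    have QP: "?Q (\<theta> (t h) (\<rho> h v)) = ?P (\<rho> h v)" if "v \<in> fibre V (s h)" for v
      unfolding gh using V.tinv_triv[OF W(1) Wt rhoD(1)[OF that]] by simp
    have "?P (\<rho> h (?\<Theta> h Y u)) = ?Q (dvec (arrs G) (\<lambda>x. \<theta> (t x) (\<rho> x (V.tinv \<psi> (s x) e))) h Y) + ?Q ?\<Gamma>y -
      ?P (\<rho> h (V.tinv \<psi> (s h) ?\<Gamma>x))"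
      using arg_cong[OF F2, of ?Q]
      unfolding QP[OF \<Theta>u] linear_diff[OF Qlin] linear_add[OF Qlin] QP[OF V.tinv_fibre[OF U]] .
    with F1 F3 dvec_rho_mult[OF gh XY U W O', of e]
    have main: "?P (\<rho> h (?\<Theta> (mult G g h) ?Z u)) = ?P (\<rho> h (?\<Theta> h Y u)) + ?P (?\<Theta> g X (\<rho> h u))"
      by (simp add: ue[symmetric] w_def)
    have f1: "\<rho> h (?\<Theta> (mult G g h) ?Z u) \<in> fibre V (t h)"
      using rhoD(1) \<Theta>u[of "mult G g h" ?Z u] sm by simp
    have f2: "\<rho> h (?\<Theta> h Y u) \<in> fibre V (t h)" by (rule rhoD(1)[OF \<Theta>u])
    have f3: "?\<Theta> g X (\<rho> h u) \<in> fibre V (t h)" using \<Theta>u[of g X] gh by simp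
    have inj: "v = v'" if "v \<in> fibre V (t h)" "v' \<in> fibre V (t h)" "?P v = ?P v'" for v v'
    proof -
      have vg: "v \<in> fibre V (s g)" "v' \<in> fibre V (s g)" using that gh by simp_all
      have "\<rho> g v = \<rho> g v'" by (rule V.triv_inject[OF O' rhoD(1)[OF vg(1)] rhoD(1)[OF vg(2)] that(3)])
      from arg_cong[OF this, of "\<rho> (ginv G g)"] show ?thesis
        unfolding rho_ginv_rho[OF vg(1)] rho_ginv_rho[OF vg(2)] .
    qed
    have "\<rho> h (?\<Theta> (mult G g h) ?Z u) = \<rho> h (?\<Theta> h Y u) + ?\<Theta> g X (\<rho> h u)"
      by (rule inj[OF f1 subspace_add[OF V.subspace_fibre f2 f3]])
         (simp only: main linear_betweenD(2)[OF Plin f2 f3])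
    from arg_cong[OF this, of "\<rho> (ginv G h)"]
    have "?\<Theta> (mult G g h) ?Z u = ?\<Theta> h Y u + \<rho> (ginv G h) (?\<Theta> g X (\<rho> h u))"
      using rho_ginv_rho[of "?\<Theta> (mult G g h) ?Z u" h] \<Theta>u[of "mult G g h" ?Z u] sm(1)
        rho_ginv_rho[OF \<Theta>u[of h Y u]] linear_betweenD(2)[OF ginv_rho_linear f2 f3] by simp
    then show "?\<Theta> (mult G g h) ?Z u = (?\<Theta> h Y + act (ginv G h) (?\<Theta> g X)) u"
      using u by (simp add: End_action_def ginv_ginv)
  qed
qed

section \<open>Change of connection and cohomology\<close>

abbreviation "Mult \<equiv> multiplicative_forms G EndV act"
abbreviation "Inv \<equiv> invariant_forms G EndV act"
abbreviation "inv_conns \<equiv> invariant_connections G V \<rho>"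
abbreviation "\<delta> \<equiv> delta0 G act"
abbreviation "cls \<equiv> coh_class G EndV act"

lemma form_fibre: "\<gamma> \<in> forms \<Longrightarrow> \<gamma> x X \<in> fibre EndV x"
  by (rule vbundle_over.one_form_fibre[OF V.vbundle_over_End])

lemma delta0_apply:
  assumes "X \<in> TG g" "v \<in> fibre V (s g)"
  shows "\<delta> \<gamma> g X v = \<gamma> (s g) (ds g X) v - \<rho> (ginv G g) (\<gamma> (t g) (dt g X) (\<rho> g v))"
  using assms by (simp add: delta0_def End_action_def ginv_ginv)

lemma delta0_off_fibre:
  assumes "\<gamma> \<in> forms" "v \<notin> fibre V (s g)"
  shows "\<delta> \<gamma> g X v = 0"
  using assms form_fibre[OF assms(1), of "s g" "ds g X"]
  by (simp add: delta0_def End_action_def V.fibre_End)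

lemma delta0_outside: "X \<notin> TG g \<Longrightarrow> \<delta> \<gamma> g X = 0"
  by (simp add: delta0_def)

lemma delta0_eqI:
  assumes "\<gamma> \<in> forms"
    and "\<And>g X v. X \<in> TG g \<Longrightarrow> v \<in> fibre V (s g) \<Longrightarrow> \<delta> \<gamma> g X v = \<omega> g X v"
    and "\<And>g X v. X \<notin> TG g \<or> v \<notin> fibre V (s g) \<Longrightarrow> \<omega> g X v = 0"
  shows "\<delta> \<gamma> = \<omega>"
proof (intro ext)
  fix g X v
  show "\<delta> \<gamma> g X v = \<omega> g X v"
    using assms(2)[of X g v] assms(3)[of X g v] delta0_off_fibre[OF assms(1), of v g X] delta0_outside[of X g \<gamma>]
    by (cases "X \<in> TG g"; cases "v \<in> fibre V (s g)") simp_all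
qed

lemma subspace_forms: "subspace forms"
  by (rule vbundle_over.subspace_one_forms[OF V.vbundle_over_End])

lemma delta0_add:
  assumes "\<gamma> \<in> forms" "\<gamma>' \<in> forms"
  shows "\<delta> (\<gamma> + \<gamma>') = \<delta> \<gamma> + \<delta> \<gamma>'"
proof (rule delta0_eqI[OF subspace_add[OF subspace_forms assms]])
  fix g X v assume a: "X \<in> TG g" "v \<in> fibre V (s g)"
  have "\<gamma> (t g) (dt g X) (\<rho> g v) \<in> fibre V (t g)" "\<gamma>' (t g) (dt g X) (\<rho> g v) \<in> fibre V (t g)"
    using V.End_apply_fibre[OF form_fibre] assms by auto
  then show "\<delta> (\<gamma> + \<gamma>') g X v = (\<delta> \<gamma> + \<delta> \<gamma>') g X v"
    by (simp add: delta0_apply[OF a] linear_betweenD(2)[OF ginv_rho_linear])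
next
  fix g X v assume "X \<notin> TG g \<or> v \<notin> fibre V (s g)"
  then show "(\<delta> \<gamma> + \<delta> \<gamma>') g X v = 0"
    by (auto simp: delta0_outside delta0_off_fibre[OF assms(1)] delta0_off_fibre[OF assms(2)])
qed

lemma delta0_scaleR:
  assumes "\<gamma> \<in> forms"
  shows "\<delta> (r *\<^sub>R \<gamma>) = r *\<^sub>R \<delta> \<gamma>"
proof (rule delta0_eqI[OF subspace_scale[OF subspace_forms assms]])
  fix g X v assume a: "X \<in> TG g" "v \<in> fibre V (s g)"
  have "\<gamma> (t g) (dt g X) (\<rho> g v) \<in> fibre V (t g)"
    using V.End_apply_fibre[OF form_fibre] assms by auto
  then show "\<delta> (r *\<^sub>R \<gamma>) g X v = (r *\<^sub>R \<delta> \<gamma>) g X v"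
    by (simp add: delta0_apply[OF a] linear_betweenD(3)[OF ginv_rho_linear] scaleR_diff_right)
next
  fix g X v assume "X \<notin> TG g \<or> v \<notin> fibre V (s g)"
  then show "(r *\<^sub>R \<delta> \<gamma>) g X v = 0"
    by (auto simp: delta0_outside delta0_off_fibre[OF assms(1)])
qed

lemma delta0_uminus: "\<gamma> \<in> forms \<Longrightarrow> \<delta> (- \<gamma>) = - \<delta> \<gamma>"
  using delta0_scaleR[of \<gamma> "- 1"] by simp

lemma delta0_0: "\<delta> 0 = 0"
  using delta0_scaleR[OF subspace_0[OF subspace_forms], of 0] by simp

lemma subspace_Inv: "subspace Inv"
  unfolding invariant_forms_def
  by (rule subspaceI)
     (auto simp: delta0_0 delta0_add delta0_scaleR subspace_0[OF subspace_forms]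
       subspace_add[OF subspace_forms] subspace_scale[OF subspace_forms])

text \<open>Adding \<open>\<gamma>\<close> to a connection adds \<open>s\<^sup>*\<gamma>\<close> and \<open>t\<^sup>*\<gamma>\<close> to the two pullback connections, so the
  invariance form changes by \<open>g\<inverse> \<cdot> t\<^sup>*\<gamma> - s\<^sup>*\<gamma>\<close>.\<close>

lemma Theta_translate:
  assumes nabla: "nabla \<in> conns" and \<gamma>: "\<gamma> \<in> forms"
  shows "Theta (translate (objs G) V nabla \<gamma>) = Theta nabla - \<delta> \<gamma>"
proof -
  let ?n = "translate (objs G) V nabla \<gamma>"
  have n: "?n \<in> conns" by (rule V.translate_connection[OF assms])
  have "\<delta> \<gamma> = Theta nabla - Theta ?n"
  proof (rule delta0_eqI[OF \<gamma>])
    fix g X v assume X: "X \<in> TG g" and v: "v \<in> fibre V (s g)"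
    then obtain \<xi> where \<xi>: "\<xi> \<in> secs" "\<xi> g = v" using SV.P.ex_section_through[of v g] by auto
    let ?t = "nabla_t nabla (phi_inv G V \<rho> \<xi>) g X" and ?\<gamma>t = "\<gamma> (t g) (dt g X) (\<rho> g v)"
    have ft: "?t \<in> fibre V (t g)" by (rule nabla_t_fibre[OF nabla \<xi>(1)])
    have fg: "?\<gamma>t \<in> fibre V (t g)" by (rule V.End_apply_fibre[OF form_fibre[OF \<gamma>]])
    have 1: "nabla_s ?n \<xi> g X = nabla_s nabla \<xi> g X + \<gamma> (s g) (ds g X) v"
      using SV.is_pullback_translate[OF assms SV.is_pullback_pullback_connection[OF nabla]
          SV.is_pullback_pullback_connection[OF n] \<xi>(1) X] \<xi>(2) by simp
    have 2: "nabla_t ?n (phi_inv G V \<rho> \<xi>) g X = ?t + ?\<gamma>t"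
      using TV.is_pullback_translate[OF assms TV.is_pullback_pullback_connection[OF nabla]
          TV.is_pullback_pullback_connection[OF n] phi_inv_section[OF \<xi>(1)] X] \<xi>(2)
      by (simp add: phi_inv_at[OF \<xi>(1)])
    have "Theta ?n g X v = \<rho> (ginv G g) (?t + ?\<gamma>t) - (nabla_s nabla \<xi> g X + \<gamma> (s g) (ds g X) v)"
      using Theta_apply[OF n \<xi>(1) X] \<xi>(2) unfolding 1 2 by simp
    moreover have "Theta nabla g X v = \<rho> (ginv G g) ?t - nabla_s nabla \<xi> g X"
      using Theta_apply[OF nabla \<xi>(1) X] \<xi>(2) by simp
    ultimately show "\<delta> \<gamma> g X v = (Theta nabla - Theta ?n) g X v"
      by (simp add: delta0_apply[OF X v] linear_betweenD(2)[OF ginv_rho_linear ft fg])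
  next
    fix g X v assume "X \<notin> TG g \<or> v \<notin> fibre V (s g)"
    then show "(Theta nabla - Theta ?n) g X v = 0"
      using Theta_fibre[OF nabla, of g X] Theta_fibre[OF n, of g X]
      by (auto simp: Theta_outside[OF nabla] Theta_outside[OF n] V.fibre_End)
  qed
  then show ?thesis by simp
qed

lemma Theta_diff:
  assumes "nabla \<in> conns" "nabla' \<in> conns"
  shows "Theta nabla - Theta nabla' = \<delta> (V.conn_diff nabla nabla')"
  using Theta_translate[OF assms(1) V.conn_diff_form[OF assms]]
  by (simp add: V.translate_conn_diff[OF assms])

lemma coh_class_cong:
  assumes "\<omega> \<in> Mult" "\<omega>' \<in> Mult" "\<gamma> \<in> forms" "\<omega> - \<omega>' = \<delta> \<gamma>"
  shows "cls \<omega> = cls \<omega>'"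
proof -
  have "\<omega> - \<eta> \<in> \<delta> ` forms \<longleftrightarrow> \<omega>' - \<eta> \<in> \<delta> ` forms" for \<eta>
  proof
    assume "\<omega> - \<eta> \<in> \<delta> ` forms"
    then obtain \<beta> where \<beta>: "\<beta> \<in> forms" "\<omega> - \<eta> = \<delta> \<beta>" by blast
    have "\<omega>' - \<eta> = (\<omega> - \<eta>) - (\<omega> - \<omega>')" by simp
    also have "\<dots> = \<delta> \<beta> - \<delta> \<gamma>" by (simp only: \<beta>(2) assms(4))
    also have "\<dots> = \<delta> \<beta> + \<delta> (- \<gamma>)" by (simp add: delta0_uminus[OF assms(3)])
    also have "\<dots> = \<delta> (\<beta> + - \<gamma>)"
      by (rule delta0_add[OF \<beta>(1) subspace_neg[OF subspace_forms assms(3)], symmetric])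
    finally show "\<omega>' - \<eta> \<in> \<delta> ` forms"
      using subspace_add[OF subspace_forms \<beta>(1) subspace_neg[OF subspace_forms assms(3)]] by (rule image_eqI)
  next
    assume "\<omega>' - \<eta> \<in> \<delta> ` forms"
    then obtain \<beta> where \<beta>: "\<beta> \<in> forms" "\<omega>' - \<eta> = \<delta> \<beta>" by blast
    have "\<omega> - \<eta> = (\<omega>' - \<eta>) + (\<omega> - \<omega>')" by simp
    also have "\<dots> = \<delta> (\<beta> + \<gamma>)" by (simp only: \<beta>(2) assms(4) delta0_add[OF \<beta>(1) assms(3)])
    finally show "\<omega> - \<eta> \<in> \<delta> ` forms"
      using subspace_add[OF subspace_forms \<beta>(1) assms(3)] by (rule image_eqI)
  qed
  then show ?thesis using assms(1,2) by (auto simp: coh_class_def cohomologous_def)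
qed

lemma coh_class_Theta:
  assumes "nabla \<in> conns" "nabla' \<in> conns"
  shows "cls (Theta nabla) = cls (Theta nabla')"
  by (rule coh_class_cong[OF Theta_multiplicative[OF assms(1)] Theta_multiplicative[OF assms(2)]
        V.conn_diff_form[OF assms] Theta_diff[OF assms]])

text \<open>The definite description in \<^const>\<open>obs\<close> is meaningful because all connections have the same class.\<close>

lemma obs_eq:
  assumes "nabla \<in> conns"
  shows "obs G V \<rho> = cls (Theta nabla)"
  unfolding obs_def
proof (rule the_equality)
  show "\<exists>nabla'\<in>conns. cls (Theta nabla) = cls (Theta nabla')" using assms by blast
next
  fix C assume "\<exists>nabla\<in>conns. C = cls (Theta nabla)"
  then show "C = cls (Theta nabla)" using coh_class_Theta[OF _ assms] by blast
qed

text \<open>Existence of a connection is essential here: without one the obstruction class would be undefined.\<close>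

lemma obs_in_H11: "obs G V \<rho> \<in> H11 G EndV act"
proof -
  obtain nabla where n: "nabla \<in> conns" using V.ex_connection by blast
  show ?thesis
    unfolding obs_eq[OF n] H11_def coh_class_def by (rule quotientI[OF Theta_multiplicative[OF n]])
qed

lemma translate_invariant:
  assumes "nabla \<in> inv_conns" "\<gamma> \<in> Inv"
  shows "translate (objs G) V nabla \<gamma> \<in> inv_conns"
  using assms Theta_translate[of nabla \<gamma>] V.translate_connection[of nabla \<gamma>]
  by (simp add: invariant_connections_def invariant_forms_def)

text \<open>The difference of two invariant connections is invariant, because \<open>\<delta>\<^sup>0\<close> of it is the difference of their
  invariance forms.\<close>

lemma affine_invariant_connections:
  "affine_space_over inv_conns Inv (translate (objs G) V)"
  unfolding affine_space_over_def
proof (intro conjI ballI subspace_Inv translate_invariant)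
  fix a assume a: "a \<in> inv_conns"
  then have ac: "a \<in> conns" by (simp add: invariant_connections_def)
  show "translate (objs G) V a 0 = a"
  proof (rule ext)
    fix \<xi>
    show "translate (objs G) V a 0 \<xi> = a \<xi>"
      by (cases "\<xi> \<in> sections (objs G) V") (simp_all add: translate_def V.conn_outside[OF ac])
  qed
  show "translate (objs G) V (translate (objs G) V a v) w = translate (objs G) V a (v + w)" for v w
    by (rule ext) (simp add: translate_def add.assoc)
  fix b assume b: "b \<in> inv_conns"
  then have bc: "b \<in> conns" by (simp add: invariant_connections_def)
  show "\<exists>!w. w \<in> Inv \<and> translate (objs G) V a w = b"
  proof (rule ex1I)
    have "\<delta> (V.conn_diff a b) = 0"
      using Theta_diff[OF ac bc] a b by (simp add: invariant_connections_def)
    then show "V.conn_diff a b \<in> Inv \<and> translate (objs G) V a (V.conn_diff a b) = b"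
      by (simp add: invariant_forms_def V.conn_diff_form[OF ac bc] V.translate_conn_diff[OF ac bc])
    fix w assume w: "w \<in> Inv \<and> translate (objs G) V a w = b"
    show "w = V.conn_diff a b"
      by (rule V.translate_unique[OF ac _ V.conn_diff_form[OF ac bc]])
         (use w in \<open>simp_all add: invariant_forms_def V.translate_conn_diff[OF ac bc]\<close>)
  qed
qed

text \<open>If the class of \<open>\<Theta>\<close> vanishes, then \<open>\<Theta> = \<delta>\<^sup>0\<gamma>\<close> for some \<open>\<gamma>\<close>, and adding \<open>\<gamma>\<close> to the connection
  makes it invariant.\<close>

lemma invariant_connection_iff:
  "(\<exists>nabla. nabla \<in> inv_conns) \<longleftrightarrow> obs G V \<rho> = cls 0"
proof
  assume "\<exists>nabla. nabla \<in> inv_conns"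
  then obtain nabla where "nabla \<in> conns" "Theta nabla = 0" by (auto simp: invariant_connections_def)
  with obs_eq[of nabla] show "obs G V \<rho> = cls 0" by simp
next
  assume obs: "obs G V \<rho> = cls 0"
  obtain nabla where n: "nabla \<in> conns" using V.ex_connection by blast
  note m = Theta_multiplicative[OF n]
  have "Theta nabla - Theta nabla \<in> \<delta> ` forms"
    by (rule image_eqI[OF _ subspace_0[OF subspace_forms]]) (simp add: delta0_0)
  then have "Theta nabla \<in> cls (Theta nabla)" using m by (simp add: coh_class_def cohomologous_def)
  then have "Theta nabla \<in> cls 0" using obs obs_eq[OF n] by simp
  then obtain \<gamma> where \<gamma>: "\<gamma> \<in> forms" "0 - Theta nabla = \<delta> \<gamma>" by (auto simp: coh_class_def cohomologous_def)
  have "\<delta> (- \<gamma>) = Theta nabla" using \<gamma>(2) by (simp add: delta0_uminus[OF \<gamma>(1)] flip: \<gamma>(2))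
  moreover have "- \<gamma> \<in> forms" by (rule subspace_neg[OF subspace_forms \<gamma>(1)])
  ultimately have "translate (objs G) V nabla (- \<gamma>) \<in> inv_conns"
    by (simp add: invariant_connections_def V.translate_connection[OF n] Theta_translate[OF n])
  then show "\<exists>nabla. nabla \<in> inv_conns" by blast
qed

end

theorem theorem3p15:
  fixes G :: "('m::{t2_space, second_countable_topology}, 'e::fin_dim_normed,
               'g::{t2_space, second_countable_topology}, 'k::fin_dim_normed) groupoid"
    and V :: "('m, 'v::real_vector, 'f::fin_dim_normed) vbundle"
    and \<rho> :: "'g \<Rightarrow> 'v \<Rightarrow> 'v"
  assumes "lie_groupoid G"
    and "vector_bundle (objs G) V"
    and "groupoid_rep G V \<rho>"
  shows
    "(\<forall>nabla\<in>connections (objs G) V.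
        invariance_form G V \<rho> nabla \<in> multiplicative_forms G (End_bundle V) (End_action G V \<rho>)) \<and>
     affine_space_over (invariant_connections G V \<rho>)
       (invariant_forms G (End_bundle V) (End_action G V \<rho>)) (translate (objs G) V) \<and>
     ((\<forall>nabla\<in>connections (objs G) V. \<forall>nabla'\<in>connections (objs G) V.
        coh_class G (End_bundle V) (End_action G V \<rho>) (invariance_form G V \<rho> nabla) =
        coh_class G (End_bundle V) (End_action G V \<rho>) (invariance_form G V \<rho> nabla')) \<and>
      obs G V \<rho> \<in> H11 G (End_bundle V) (End_action G V \<rho>) \<and>
      (\<forall>nabla\<in>connections (objs G) V.
        obs G V \<rho> =
        coh_class G (End_bundle V) (End_action G V \<rho>) (invariance_form G V \<rho> nabla))) \<and>
     ((\<exists>nabla. nabla \<in> invariant_connections G V \<rho>) \<longleftrightarrow>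
      obs G V \<rho> = coh_class G (End_bundle V) (End_action G V \<rho>) 0)"
proof -
  interpret Lie_groupoid G by unfold_locales (rule assms(1))
  interpret groupoid_representation G V \<rho> by unfold_locales (rule assms)+
  show ?thesis
    by (intro conjI ballI Theta_multiplicative affine_invariant_connections coh_class_Theta obs_in_H11
        obs_eq invariant_connection_iff)
qed

end
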